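(* Let $P\subset N_{\mathbb{R}}$ be a full-dimensional lattice polytope, and let $(m_1,Q_1),(m_2,Q_2)$ be two deformation pairs of $P$ which are mutually compatible, $$Q_1,Q_2\subset\ker\pi_M(m_1)\cap\ker\pi_M(m_2),$$ and satisfy $\varphi_{m_1}(v)\,\varphi_{m_2}(v)=0$ for every vertex $v$ of $P$. Fix a finite set of boundary generators and boundary representatives adapted to $Q_1$ and $Q_2$. Then the equations $$F_{\mathbf k}(\mathbf x,u,t_1,t_2)=\mathbf x^{\mathbf k}-\sum_{\substack{\boldsymbol\alpha\in\mathbb{N}^2\\ \alpha_i\leq \eta_{Q_i}(\mathbf k),\ i=1,2}}\binom{\eta_{Q_1}(\mathbf k)}{\alpha_1}\binom{\eta_{Q_2}(\mathbf k)}{\alpha_2}\,t_1^{\alpha_1}t_2^{\alpha_2}\,\chi_P^{\,s_{\mathbf k}-\alpha_1m_1-\alpha_2m_2},\qquad \mathbf k\in\mathbb{N}^r,$$ define a formal two-parameter deformation of $X_P$ over $\mathbb{C}[[t_1,t_2]]$. The restriction of this deformation to the $t_i$-axis (i.e. setting the other parameter equal to zero) is the one-parameter deformation associated with $(m_i,Q_i)$, for $i=1,2$.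
   Context: Work over $\mathbb{C}$; $\mathbb{N}=\{0,1,2,\dots\}$. Let $N\cong\mathbb{Z}^n$, $M=\operatorname{Hom}_{\mathbb{Z}}(N,\mathbb{Z})$, $\widetilde N=N\oplus\mathbb{Z}$, $\widetilde M=M\oplus\mathbb{Z}$, with projections $\pi_M:\widetilde M\to M$, $\pi_{\mathbb{Z}}:\widetilde M\to\mathbb{Z}$. For a full-dimensional lattice polytope $P\subset N_{\mathbb{R}}$, let $\sigma\subset\widetilde N_{\mathbb{R}}$ be the cone generated by $P\times\{1\}$, $\sigma^\vee$ its dual, $S_P=\sigma^\vee\cap\widetilde M$, $X_P=\operatorname{Spec}\mathbb{C}[S_P]$, $R^*=(0,1)\in\widetilde M$. For a lattice polytope $Q\subset N_{\mathbb{R}}$ and $c\in M_{\mathbb{R}}$, $\eta_Q(c):=-\min_{v\in Q}\langle c,v\rangle$. For $m\in\widetilde M$, $\varphi_m(v):=\langle m,(v,1)\rangle=\langle\pi_M(m),v\rangle+\pi_{\mathbb{Z}}(m)$. Deformation pair: a pair $(m,Q)$ with $m\in\widetilde M$ and $Q\subset\ker(\pi_M(m))\subset N_{\mathbb{R}}$ a lattice polytope such that, for every $i\in\mathbb{N}$ for which $P_i(m):=P\cap\{\varphi_m=i\}$ is nonempty, there is a polytope $R_i$ with $P_i(m)=iQ+R_i$ (Minkowski sum; $0Q=\{0\}$). Presentation: every $s\in S_P$ decomposes uniquely as $s=\partial_P(s)+n_P(s)R^*$ with $n_P(s)\in\mathbb{N}$, $\partial_P(s)\in S_P$ and $\partial_P(s)-R^*\notin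 S_P$; the set of boundary elements is $\partial_P(S_P)=\{(c,\eta_P(c)) : c\in M\}$. A set of boundary generators is a finite set of boundary elements $s_j=(c_j,\eta_P(c_j))$, $j=1,\dots,r$, such that $s_1,\dots,s_r,R^*$ generate the semigroup $S_P$ (not necessarily minimally). For $\mathbf k\in\mathbb{N}^r$ put $s_{\mathbf k}=\sum_jk_js_j$, $\mathbf x^{\mathbf k}=\prod_jx_j^{k_j}$, and for a lattice polytope $Q$ put $\eta_Q(\mathbf k):=\sum_j\eta_Q(k_jc_j)-\eta_Q\bigl(\sum_jk_jc_j\bigr)$. Boundary representatives are a choice, for each $b\in\partial_P(S_P)$, of $\partial(b)\in\mathbb{N}^r$ with $s_{\partial(b)}=b$; extend by $\partial(s):=\partial(\partial_P(s))$ for $s\in S_P$ and put $\chi_P^s:=\mathbf x^{\partial(s)}u^{n_P(s)}\in\mathbb{C}[\mathbf x,u]$. The choice is adapted to $Q_1,Q_2$ if $\eta_{Q_i}(\partial(b))=0$ for all $b\in\partial_P(S_P)$, $i=1,2$ (adapted choices exist after adjoining finitely many boundary elements to the generators). One has $X_P\cong\operatorname{Spec}\mathbb{C}[\mathbf x,u]/I_P$ where $I_P$, the kernel of $x_j\mapsto\chi^{s_j}$, $u\mapsto\chi^{R^*}$, is generated by $\mathbf x^{\mathbf k}-\chi_P^{s_{\mathbf k}}$, $\mathbf k\in\mathbb{N}^r$. Under the stated hypotheses all elements $s_{\mathbf k}-\alpha_1m_1-\alpha_2m_2$ occurring in $F_{\mathbf k}$ lie in $S_P$, so $F_{\mathbf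 k}$ is well defined. The one-parameter deformation associated with a deformation pair $(m,Q)$ is the one over $\mathbb{C}[[t]]$ defined, in this presentation, by the equations $\mathbf x^{\mathbf k}-\sum_{j=0}^{\eta_Q(\mathbf k)}\binom{\eta_Q(\mathbf k)}{j}t^j\chi_P^{\,s_{\mathbf k}-jm}$, $\mathbf k\in\mathbb{N}^r$. A formal deformation of $X_P$ over a complete local $\mathbb{C}$-algebra $(B,\mathfrak m_B)$ is a compatible system of flat deformations of $X_P$ over the quotients $B/\mathfrak m_B^{q+1}$, $q\ge0$. *)

theory Defs
  imports
    "HOL-Analysis.Analysis"
    "HOL-Algebra.Algebraic_Closure_Type"
    "HOL-Algebra.Ideal_Product"
    "HOL-Algebra.QuotRing"
    "HOL-Algebra.Free_Abelian_Groups"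
    "HOL-Library.Set_Algebras"
begin

section \<open>Flatness\<close>

text \<open>The tensor product of two \<open>R\<close>-modules is the free abelian group on pairs modulo the
  subgroup generated by the bilinearity relations. Only its group structure is needed.\<close>

definition tensor_relators ::
    "('r, 'x) ring_scheme \<Rightarrow> ('r, 'a) module \<Rightarrow> ('r, 'b) module \<Rightarrow> ('a \<times> 'b \<Rightarrow>\<^sub>0 int) set" where
  "tensor_relators R M N =
     {frag_of (x \<oplus>\<^bsub>M\<^esub> x', y) - frag_of (x, y) - frag_of (x', y) | x x' y.
        x \<in> carrier M \<and> x' \<in> carrier M \<and> y \<in> carrier N} \<union>
     {frag_of (x, y \<oplus>\<^bsub>N\<^esub> y') - frag_of (x, y) - frag_of (x, y') | x y y'.
        x \<in> carrier M \<and> y \<in> carrier N \<and> y' \<in> carrier N} \<union>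
     {frag_of (r \<odot>\<^bsub>M\<^esub> x, y) - frag_of (x, r \<odot>\<^bsub>N\<^esub> y) | r x y.
        r \<in> carrier R \<and> x \<in> carrier M \<and> y \<in> carrier N}"

definition tensor_subgroup ::
    "('r, 'x) ring_scheme \<Rightarrow> ('r, 'a) module \<Rightarrow> ('r, 'b) module \<Rightarrow> ('a \<times> 'b \<Rightarrow>\<^sub>0 int) set" where
  "tensor_subgroup R M N =
     generate (free_Abelian_group (carrier M \<times> carrier N)) (tensor_relators R M N)"

definition tensor_product ::
    "('r, 'x) ring_scheme \<Rightarrow> ('r, 'a) module \<Rightarrow> ('r, 'b) module \<Rightarrow> ('a \<times> 'b \<Rightarrow>\<^sub>0 int) set monoid" where
  "tensor_product R M N =
     free_Abelian_group (carrier M \<times> carrier N) Mod tensor_subgroup R M N"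

text \<open>The map induced by \<open>h\<close> on cosets; meaningful when \<open>h\<close> is constant on each coset.\<close>

definition induced :: "('a \<Rightarrow> 'b) \<Rightarrow> 'a set \<Rightarrow> 'b" where
  "induced h C = the_elem (h ` C)"

definition tensor_map ::
    "('r, 'x) ring_scheme \<Rightarrow> ('r, 'a) module \<Rightarrow> ('r, 'b) module \<Rightarrow> ('b \<Rightarrow> 'b) \<Rightarrow>
      ('a \<times> 'b \<Rightarrow>\<^sub>0 int) set \<Rightarrow> ('a \<times> 'b \<Rightarrow>\<^sub>0 int) set" where
  "tensor_map R M N' f =
     induced (\<lambda>w. r_coset (free_Abelian_group (carrier M \<times> carrier N')) (tensor_subgroup R M N')
       (frag_extend (\<lambda>(x, y). frag_of (x, f y)) w))"

definition linear_maps ::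
    "('r, 'x) ring_scheme \<Rightarrow> ('r, 'b) module \<Rightarrow> ('r, 'b) module \<Rightarrow> ('b \<Rightarrow> 'b) set" where
  "linear_maps R N N' =
     {f \<in> carrier N \<rightarrow> carrier N'.
        (\<forall>x\<in>carrier N. \<forall>y\<in>carrier N. f (x \<oplus>\<^bsub>N\<^esub> y) = f x \<oplus>\<^bsub>N'\<^esub> f y) \<and>
        (\<forall>r\<in>carrier R. \<forall>x\<in>carrier N. f (r \<odot>\<^bsub>N\<^esub> x) = r \<odot>\<^bsub>N'\<^esub> f x)}"

text \<open>\<open>M\<close> is flat if \<open>M \<otimes> _\<close> preserves injectivity. HOL cannot quantify over types inside a
  definition, so the element type \<open>'t\<close> of the test modules \<open>N\<close>, \<open>N'\<close> is a parameter; a theorem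
  in which \<open>'t\<close> is a free type variable asserts the property for all test modules. (Taking
  \<open>N\<close> and \<open>N'\<close> over the same type is no restriction: replace \<open>N\<close> by its image, a submodule
  of \<open>N'\<close>.)\<close>

definition flat_module ::
    "'t itself \<Rightarrow> ('r, 'x) ring_scheme \<Rightarrow> ('r, 'a) module \<Rightarrow> bool" where
  "flat_module _ R M \<longleftrightarrow>
     Module.module R M \<and>
     (\<forall>(N :: ('r, 't) module) (N' :: ('r, 't) module) f.
        Module.module R N \<longrightarrow> Module.module R N' \<longrightarrow>
        f \<in> linear_maps R N N' \<longrightarrow> inj_on f (carrier N) \<longrightarrow>
        inj_on (tensor_map R M N' f) (carrier (tensor_product R M N)))"


section \<open>Formal deformations of affine schemes\<close>

text \<open>The ring \<open>A\<close> as a module over the source of a ring homomorphism \<open>\<phi>\<close> into \<open>A\<close>.\<close>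

definition module_along :: "('b \<Rightarrow> 'a) \<Rightarrow> 'a ring \<Rightarrow> ('b, 'a) module" where
  "module_along \<phi> A =
     \<lparr>carrier = carrier A, monoid.mult = monoid.mult A, one = monoid.one A,
      ring.zero = ring.zero A, add = ring.add A,
      smult = (\<lambda>b a. \<phi> b \<otimes>\<^bsub>A\<^esub> a)\<rparr>"

text \<open>\<open>g\<close> exhibits the \<open>B'\<close>-algebra \<open>(A', \<phi>')\<close> as the base change of the \<open>B\<close>-algebra \<open>(A, \<phi>)\<close>
  along the \<^emph>\<open>surjection\<close> \<open>\<delta>\<close>: as \<open>B' = B/ker \<delta>\<close>, one has \<open>A \<otimes>\<^sub>B B' = A/(ker \<delta>)A\<close>.
  Geometrically, \<open>Spec A'\<close> is the restriction of \<open>Spec A\<close> to the closed subscheme \<open>Spec B'\<close>.\<close>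

definition base_change ::
    "'b ring \<Rightarrow> 'c ring \<Rightarrow> ('b \<Rightarrow> 'c) \<Rightarrow> 'a ring \<Rightarrow> ('b \<Rightarrow> 'a) \<Rightarrow> 'd ring \<Rightarrow> ('c \<Rightarrow> 'd) \<Rightarrow>
      ('a \<Rightarrow> 'd) \<Rightarrow> bool" where
  "base_change B B' \<delta> A \<phi> A' \<phi>' g \<longleftrightarrow>
     \<delta> \<in> ring_hom B B' \<and> \<delta> ` carrier B = carrier B' \<and>
     \<phi> \<in> ring_hom B A \<and> \<phi>' \<in> ring_hom B' A' \<and>
     g \<in> ring_hom A A' \<and> g ` carrier A = carrier A' \<and>
     (\<forall>b\<in>carrier B. g (\<phi> b) = \<phi>' (\<delta> b)) \<and>
     a_kernel A A' g = genideal A (\<phi> ` a_kernel B B' \<delta>)"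

primrec ideal_power :: "'b ring \<Rightarrow> 'b set \<Rightarrow> nat \<Rightarrow> 'b set" where
  "ideal_power B I 0 = carrier B"
| "ideal_power B I (Suc k) = ideal_prod B I (ideal_power B I k)"

abbreviation complex_ring :: "complex ring" where
  "complex_ring \<equiv> ring_of_type_algebra"

text \<open>A local \<open>\<complex>\<close>-algebra with residue field \<open>\<complex>\<close> is given by its residue map \<open>\<epsilon>\<close>.\<close>

definition max_ideal :: "'b ring \<Rightarrow> ('b \<Rightarrow> complex) \<Rightarrow> 'b set" where
  "max_ideal B \<epsilon> = a_kernel B complex_ring \<epsilon>"

definition thickening :: "'b ring \<Rightarrow> ('b \<Rightarrow> complex) \<Rightarrow> nat \<Rightarrow> 'b set ring" where
  "thickening B \<epsilon> q = B Quot ideal_power B (max_ideal B \<epsilon>) (Suc q)"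

definition to_thickening :: "'b ring \<Rightarrow> ('b \<Rightarrow> complex) \<Rightarrow> nat \<Rightarrow> 'b \<Rightarrow> 'b set" where
  "to_thickening B \<epsilon> q b = ideal_power B (max_ideal B \<epsilon>) (Suc q) +>\<^bsub>B\<^esub> b"

text \<open>A system of algebras \<open>level q\<close> over \<open>B/m\<^sup>q\<^sup>+\<^sup>1\<close>, with maps \<open>level (q + 1) \<rightarrow> level q\<close> and
  maps from each \<open>level q\<close> to the coordinate ring of the deformed scheme.\<close>

record ('b, 'a, 'c) formal_family =
  level :: "nat \<Rightarrow> 'a ring"
  structure_map :: "nat \<Rightarrow> 'b set \<Rightarrow> 'a"
  transition :: "nat \<Rightarrow> 'a \<Rightarrow> 'a"
  fibre_map :: "nat \<Rightarrow> 'a \<Rightarrow> 'c"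

text \<open>Formal deformation, over the complete local \<open>\<complex>\<close>-algebra \<open>B\<close> with residue map \<open>\<epsilon>\<close>, of the
  spectrum of the \<open>\<complex>\<close>-algebra \<open>(A0, \<kappa>)\<close>. All deformations of an affine scheme over Artinian
  bases are affine. The parameter \<open>'t\<close> is that of \<open>flat_module\<close>.\<close>

definition formal_deformation ::
    "'t itself \<Rightarrow> 'b ring \<Rightarrow> ('b \<Rightarrow> complex) \<Rightarrow> 'c ring \<Rightarrow> (complex \<Rightarrow> 'c) \<Rightarrow>
      ('b, 'a, 'c) formal_family \<Rightarrow> bool" where
  "formal_deformation T B \<epsilon> A0 \<kappa> D \<longleftrightarrow>
     (\<forall>q. cring (level D q) \<and>
          flat_module T (thickening B \<epsilon> q) (module_along (structure_map D q) (level D q)) \<and>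
          base_change (thickening B \<epsilon> q) complex_ring (induced \<epsilon>)
            (level D q) (structure_map D q) A0 \<kappa> (fibre_map D q) \<and>
          base_change (thickening B \<epsilon> (Suc q)) (thickening B \<epsilon> q) (induced (to_thickening B \<epsilon> q))
            (level D (Suc q)) (structure_map D (Suc q)) (level D q) (structure_map D q)
            (transition D q) \<and>
          (\<forall>a\<in>carrier (level D (Suc q)).
             fibre_map D q (transition D q a) = fibre_map D (Suc q) a))"

text \<open>The restriction of \<open>D\<close> along a surjection \<open>\<delta>\<close> from \<open>B\<close> to \<open>B'\<close> is \<open>D'\<close>, up to an isomorphism
  of systems that is the identity on the deformed scheme.\<close>

definition restricts_to ::
    "'b ring \<Rightarrow> ('b \<Rightarrow> complex) \<Rightarrow> 'd ring \<Rightarrow> ('d \<Rightarrow> complex) \<Rightarrow> ('b \<Rightarrow> 'd) \<Rightarrow>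
      ('b, 'a, 'c) formal_family \<Rightarrow> ('d, 'e, 'c) formal_family \<Rightarrow> bool" where
  "restricts_to B \<epsilon> B' \<epsilon>' \<delta> D D' \<longleftrightarrow>
     (\<exists>g. \<forall>q.
        base_change (thickening B \<epsilon> q) (thickening B' \<epsilon>' q)
          (induced (\<lambda>b. to_thickening B' \<epsilon>' q (\<delta> b)))
          (level D q) (structure_map D q) (level D' q) (structure_map D' q) (g q) \<and>
        (\<forall>a\<in>carrier (level D q). fibre_map D' q (g q a) = fibre_map D q a) \<and>
        (\<forall>a\<in>carrier (level D (Suc q)).
           g q (transition D q a) = transition D' q (g (Suc q) a)))"


section \<open>Families defined by polynomial equations\<close>

type_synonym ('v, 'k) mpolynomial = "('v \<Rightarrow>\<^sub>0 nat) \<Rightarrow>\<^sub>0 'k"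

definition Const :: "'k \<Rightarrow> ('v, 'k :: zero) mpolynomial" where
  "Const c = Poly_Mapping.single 0 c"

definition Var :: "'v \<Rightarrow> ('v, 'k :: zero_neq_one) mpolynomial" where
  "Var v = Poly_Mapping.single (Poly_Mapping.single v 1) 1"

text \<open>Substitution \<open>v \<mapsto> g v\<close>, with \<open>h\<close> applied to the coefficients.\<close>

definition substitute ::
    "('k \<Rightarrow> 'a) \<Rightarrow> ('v \<Rightarrow> 'a) \<Rightarrow> ('v :: finite, 'k :: zero) mpolynomial \<Rightarrow> 'a :: comm_semiring_1" where
  "substitute h g f =
     (\<Sum>e\<in>Poly_Mapping.keys f. h (Poly_Mapping.lookup f e) * (\<Prod>v\<in>UNIV. g v ^ Poly_Mapping.lookup e v))"

definition mpoly_ring :: "('v, 'k :: comm_ring_1) mpolynomial ring" where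
  "mpoly_ring = ring_of_type_algebra"

definition level_ideal ::
    "('k :: comm_ring_1 \<Rightarrow> complex) \<Rightarrow> ('v, 'k) mpolynomial set \<Rightarrow> nat \<Rightarrow> ('v, 'k) mpolynomial set" where
  "level_ideal \<epsilon> F q =
     genideal mpoly_ring
       (Const ` ideal_power ring_of_type_algebra (max_ideal ring_of_type_algebra \<epsilon>) (Suc q) \<union> F)"

text \<open>The family over the local ring \<open>'k\<close> cut out by the equations \<open>F\<close>: its level \<open>q\<close> is
  \<open>(B/m\<^sup>q\<^sup>+\<^sup>1)[V]/(F)\<close>, written as \<open>B[V]/(m\<^sup>q\<^sup>+\<^sup>1, F)\<close>. The map to the special fibre is the substitution
  of \<open>g\<close> for the variables.\<close>

definition family_of_equations ::
    "('k :: comm_ring_1 \<Rightarrow> complex) \<Rightarrow> (complex \<Rightarrow> 'c) \<Rightarrow> ('v :: finite \<Rightarrow> 'c :: comm_ring_1) \<Rightarrow>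
      ('v, 'k) mpolynomial set \<Rightarrow> ('k, ('v, 'k) mpolynomial set, 'c) formal_family" where
  "family_of_equations \<epsilon> \<kappa> g F =
     \<lparr>level = (\<lambda>q. mpoly_ring Quot level_ideal \<epsilon> F q),
      structure_map = (\<lambda>q. induced (\<lambda>b. level_ideal \<epsilon> F q +>\<^bsub>mpoly_ring\<^esub> Const b)),
      transition = (\<lambda>q. induced (\<lambda>f. level_ideal \<epsilon> F q +>\<^bsub>mpoly_ring\<^esub> f)),
      fibre_map = (\<lambda>q. induced (substitute (\<lambda>c. \<kappa> (\<epsilon> c)) g))\<rparr>"


section \<open>Lattice polytopes and their toric varieties\<close>

text \<open>\<open>N = \<int>\<^sup>n\<close> sits in \<open>N\<^sub>\<real> = real ^ 'n\<close> as the vectors with integer entries, and \<open>M\<close> is identified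
  with \<open>int ^ 'n\<close> by the dual basis.\<close>

type_synonym 'n ext_dual = "(int ^ 'n) \<times> int"

definition pairing :: "int ^ 'n \<Rightarrow> real ^ 'n \<Rightarrow> real" where
  "pairing c v = (\<Sum>i\<in>UNIV. of_int (c $ i) * v $ i)"

definition ext_pairing :: "'n ext_dual \<Rightarrow> (real ^ 'n) \<times> real \<Rightarrow> real" where
  "ext_pairing m w = pairing (fst m) (fst w) + of_int (snd m) * snd w"

definition phi :: "'n ext_dual \<Rightarrow> real ^ 'n \<Rightarrow> real" where
  "phi m v = ext_pairing m (v, 1)"

definition mscale :: "int \<Rightarrow> 'n::finite ext_dual \<Rightarrow> 'n ext_dual" where
  "mscale a m = (a *s fst m, a * snd m)"

definition lattice_polytope :: "(real ^ 'n) set \<Rightarrow> bool" where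
  "lattice_polytope Q \<longleftrightarrow>
     (\<exists>V. finite V \<and> V \<noteq> {} \<and> (\<forall>v\<in>V. \<forall>i. v $ i \<in> \<int>) \<and> Q = convex hull V)"

definition kernel_of :: "'n::finite ext_dual \<Rightarrow> (real ^ 'n) set" where
  "kernel_of m = {v. pairing (fst m) v = 0}"

definition dual_semigroup :: "(real ^ 'n) set \<Rightarrow> 'n ext_dual set" where
  "dual_semigroup P = {m. \<forall>w \<in> convex_cone hull (P \<times> {1}). ext_pairing m w \<ge> 0}"

definition Rstar :: "'n::finite ext_dual" where
  "Rstar = (0, 1)"

text \<open>The infimum is a minimum on the compact nonempty sets to which it is applied.\<close>

definition eta :: "(real ^ 'n) set \<Rightarrow> int ^ 'n \<Rightarrow> real" where
  "eta Q c = - (INF v\<in>Q. pairing c v)"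

definition deformation_pair :: "(real ^ 'n) set \<Rightarrow> 'n ext_dual \<Rightarrow> (real ^ 'n) set \<Rightarrow> bool" where
  "deformation_pair P m Q \<longleftrightarrow>
     lattice_polytope Q \<and> Q \<subseteq> kernel_of m \<and>
     (\<forall>i::nat. P \<inter> {v. phi m v = real i} \<noteq> {} \<longrightarrow>
        (\<exists>R. polytope R \<and> P \<inter> {v. phi m v = real i} = (\<lambda>v. real i *\<^sub>R v) ` Q + R))"

definition height :: "(real ^ 'n) set \<Rightarrow> 'n ext_dual \<Rightarrow> nat" where
  "height P s =
     (THE k. s - mscale (int k) Rstar \<in> dual_semigroup P \<and>
             s - mscale (int k) Rstar - Rstar \<notin> dual_semigroup P)"

definition boundary_part :: "(real ^ 'n) set \<Rightarrow> 'n ext_dual \<Rightarrow> 'n ext_dual" where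
  "boundary_part P s = s - mscale (int (height P s)) Rstar"

definition boundary_elements :: "(real ^ 'n) set \<Rightarrow> 'n ext_dual set" where
  "boundary_elements P = boundary_part P ` dual_semigroup P"

text \<open>A list \<open>s\<^sub>1, \<dots>, s\<^sub>r\<close> of generators is a family over a finite index type \<open>'r\<close>.\<close>

definition combination :: "('r :: finite \<Rightarrow> 'n::finite ext_dual) \<Rightarrow> ('r \<Rightarrow> nat) \<Rightarrow> 'n ext_dual" where
  "combination s k = (\<Sum>j\<in>UNIV. mscale (int (k j)) (s j))"

definition boundary_generators :: "(real ^ 'n) set \<Rightarrow> ('r :: finite \<Rightarrow> 'n ext_dual) \<Rightarrow> bool" where
  "boundary_generators P s \<longleftrightarrow>
     (\<forall>j. s j \<in> boundary_elements P) \<and>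
     dual_semigroup P = {combination s k + mscale (int l) Rstar | k l. True}"

definition boundary_representatives ::
    "(real ^ 'n) set \<Rightarrow> ('r :: finite \<Rightarrow> 'n ext_dual) \<Rightarrow> ('n ext_dual \<Rightarrow> 'r \<Rightarrow> nat) \<Rightarrow> bool" where
  "boundary_representatives P s d \<longleftrightarrow> (\<forall>b\<in>boundary_elements P. combination s (d b) = b)"

text \<open>For a lattice polytope \<open>Q\<close> the argument of the floor is a nonnegative integer.\<close>

definition eta_defect ::
    "(real ^ 'n) set \<Rightarrow> ('r :: finite \<Rightarrow> 'n ext_dual) \<Rightarrow> ('r \<Rightarrow> nat) \<Rightarrow> nat" where
  "eta_defect Q s k =
     nat \<lfloor>(\<Sum>j\<in>UNIV. eta Q (int (k j) *s fst (s j))) - eta Q (\<Sum>j\<in>UNIV. int (k j) *s fst (s j))\<rfloor>"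

definition adapted ::
    "(real ^ 'n) set \<Rightarrow> ('r :: finite \<Rightarrow> 'n ext_dual) \<Rightarrow> ('n ext_dual \<Rightarrow> 'r \<Rightarrow> nat) \<Rightarrow> (real ^ 'n) set \<Rightarrow> bool" where
  "adapted P s d Q \<longleftrightarrow> (\<forall>b\<in>boundary_elements P. eta_defect Q s (d b) = 0)"

definition semigroup_algebra :: "'m set \<Rightarrow> ('m :: comm_monoid_add \<Rightarrow>\<^sub>0 complex) ring" where
  "semigroup_algebra S = ring_of_type_algebra\<lparr>carrier := {f. Poly_Mapping.keys f \<subseteq> S}\<rparr>"

definition character :: "'m :: comm_monoid_add \<Rightarrow> ('m \<Rightarrow>\<^sub>0 complex)" where
  "character m = Poly_Mapping.single m 1"

definition toric_const :: "complex \<Rightarrow> ('n::finite ext_dual \<Rightarrow>\<^sub>0 complex)" where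
  "toric_const c = Poly_Mapping.single 0 c"

definition toric_coordinates ::
    "('r \<Rightarrow> 'n::finite ext_dual) \<Rightarrow> 'r option \<Rightarrow> ('n ext_dual \<Rightarrow>\<^sub>0 complex)" where
  "toric_coordinates s = case_option (character Rstar) (\<lambda>j. character (s j))"


section \<open>The equations\<close>

text \<open>The variables are indexed by \<open>'r option\<close>: \<open>Some j\<close> stands for \<open>x\<^sub>j\<close> and \<open>None\<close> for \<open>u\<close>.
  The polynomials \<open>\<chi>\<^sub>P\<^sup>s\<close> are needed over the coefficient rings \<open>\<complex>[[t]]\<close> and \<open>\<complex>[[t\<^sub>1, t\<^sub>2]]\<close>.\<close>

definition xmonomial :: "('r :: finite \<Rightarrow> nat) \<Rightarrow> ('r option, 'k :: comm_ring_1) mpolynomial" where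
  "xmonomial k = (\<Prod>j\<in>UNIV. Var (Some j) ^ k j)"

definition chi ::
    "(real ^ 'n) set \<Rightarrow> ('n ext_dual \<Rightarrow> 'r :: finite \<Rightarrow> nat) \<Rightarrow> 'n ext_dual \<Rightarrow>
      ('r option, 'k :: comm_ring_1) mpolynomial" where
  "chi P d s = xmonomial (d (boundary_part P s)) * Var None ^ height P s"

definition one_param_equation ::
    "(real ^ 'n) set \<Rightarrow> ('r :: finite \<Rightarrow> 'n ext_dual) \<Rightarrow> ('n ext_dual \<Rightarrow> 'r \<Rightarrow> nat) \<Rightarrow>
      'n ext_dual \<Rightarrow> (real ^ 'n) set \<Rightarrow> ('r \<Rightarrow> nat) \<Rightarrow> ('r option, complex fps) mpolynomial" where
  "one_param_equation P s d m Q k =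
     xmonomial k -
     (\<Sum>j\<in>{..eta_defect Q s k}.
        Const (of_nat (eta_defect Q s k choose j) * fps_X ^ j) *
        chi P d (combination s k - mscale (int j) m))"

text \<open>\<open>\<complex>[[t\<^sub>1, t\<^sub>2]]\<close> is \<open>complex fps fps\<close>, the inner variable being \<open>t\<^sub>1\<close> and the outer one \<open>t\<^sub>2\<close>.\<close>

definition t1 :: "complex fps fps" where
  "t1 = fps_const fps_X"

definition t2 :: "complex fps fps" where
  "t2 = fps_X"

definition two_param_equation ::
    "(real ^ 'n) set \<Rightarrow> ('r :: finite \<Rightarrow> 'n ext_dual) \<Rightarrow> ('n ext_dual \<Rightarrow> 'r \<Rightarrow> nat) \<Rightarrow>
      'n ext_dual \<Rightarrow> (real ^ 'n) set \<Rightarrow> 'n ext_dual \<Rightarrow> (real ^ 'n) set \<Rightarrow> ('r \<Rightarrow> nat) \<Rightarrow>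
      ('r option, complex fps fps) mpolynomial" where
  "two_param_equation P s d m1 Q1 m2 Q2 k =
     xmonomial k -
     (\<Sum>(a1, a2)\<in>{..eta_defect Q1 s k} \<times> {..eta_defect Q2 s k}.
        Const (of_nat (eta_defect Q1 s k choose a1) * of_nat (eta_defect Q2 s k choose a2) *
               t1 ^ a1 * t2 ^ a2) *
        chi P d (combination s k - mscale (int a1) m1 - mscale (int a2) m2))"

definition residue1 :: "complex fps \<Rightarrow> complex" where
  "residue1 f = fps_nth f 0"

definition residue2 :: "complex fps fps \<Rightarrow> complex" where
  "residue2 f = fps_nth (fps_nth f 0) 0"

definition set_t2_zero :: "complex fps fps \<Rightarrow> complex fps" where
  "set_t2_zero f = fps_nth f 0"

definition set_t1_zero :: "complex fps fps \<Rightarrow> complex fps" where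
  "set_t1_zero f = Abs_fps (\<lambda>i. fps_nth (fps_nth f i) 0)"

definition one_param_family ::
    "(real ^ 'n) set \<Rightarrow> ('r :: finite \<Rightarrow> 'n ext_dual) \<Rightarrow> ('n ext_dual \<Rightarrow> 'r \<Rightarrow> nat) \<Rightarrow>
      'n ext_dual \<Rightarrow> (real ^ 'n) set \<Rightarrow>
      (complex fps, ('r option, complex fps) mpolynomial set, 'n ext_dual \<Rightarrow>\<^sub>0 complex) formal_family" where
  "one_param_family P s d m Q =
     family_of_equations residue1 toric_const (toric_coordinates s)
       (range (one_param_equation P s d m Q))"

definition two_param_family ::
    "(real ^ 'n) set \<Rightarrow> ('r :: finite \<Rightarrow> 'n ext_dual) \<Rightarrow> ('n ext_dual \<Rightarrow> 'r \<Rightarrow> nat) \<Rightarrow>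
      'n ext_dual \<Rightarrow> (real ^ 'n) set \<Rightarrow> 'n ext_dual \<Rightarrow> (real ^ 'n) set \<Rightarrow>
      (complex fps fps, ('r option, complex fps fps) mpolynomial set, 'n ext_dual \<Rightarrow>\<^sub>0 complex)
        formal_family" where
  "two_param_family P s d m1 Q1 m2 Q2 =
     family_of_equations residue2 toric_const (toric_coordinates s)
       (range (two_param_equation P s d m1 Q1 m2 Q2))"

end

theory Submission
  imports Defs
begin

text \<open>Put \<open>f\<^sub>i = 1 + t\<^sub>i \<chi>\<^sup>-\<^sup>m\<^sup>i\<close> and \<open>s\<^sub>j = (c\<^sub>j, \<eta>\<^sub>P(c\<^sub>j))\<close>. As \<open>Q\<^sub>1\<close> and \<open>Q\<^sub>2\<close> lie in both
  kernels, \<open>\<eta>\<^bsub>Q\<^sub>i\<^esub>\<close> does not change under shifts by the \<open>m\<^sub>i\<close>, and so the substitution that sends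
  \<open>x\<^sub>j\<close> to \<open>\<chi>\<^bsup>s\<^sub>j\<^esup>\<close> times the product of the powers of \<open>f\<^sub>i\<close> with exponents \<open>\<eta>\<^bsub>Q\<^sub>i\<^esub>(c\<^sub>j)\<close> solves the
  equations. Normalising the \<open>\<chi>\<^sub>P\<close> to \<open>\<chi>\<close> removes the negative exponents: the linear normal form
  sends \<open>x\<^sup>k u\<^sup>l\<close> to \<open>\<chi>\<close> with exponent \<open>s\<^sub>k + l R\<^sup>*\<close>, times the powers of \<open>f\<^sub>i\<close> with exponents the defects
  \<open>\<eta>\<^bsub>Q\<^sub>i\<^esub>(k)\<close>. It vanishes on the ideal of the equations, and every polynomial is congruent to its
  normal form with \<open>\<chi>\<close> replaced by \<open>\<chi>\<^sub>P\<close>. Hence the coefficients of the normal form and the \<open>\<chi>\<^sub>P\<close>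
  are a dual basis of every level, which is therefore flat, and the reduction of the normal form
  modulo the parameters computes the special fibre.\<close>

section \<open>Quotient rings and base change\<close>

text \<open>The numbers \<eta>(c_j) may be negative, and for m \<noteq> 0 the inverse of 1 + t
  \<chi>^(-m) is an infinite series, so the multiplicative substitution does not live in a group
  algebra of finite supports. Passing to defects makes all exponents natural numbers, at the price
  of multiplicativity: the normal form is only linear over the power series, and vanishing on the
  equations does not by itself imply vanishing on their ideal. What rescues this is the identity
  \<eta>(k) + \<eta>(k' + d(b)) = \<eta>(k' + k), valid when b is the boundary part of any shift of
  s_k that occurs in the equation: after multiplication by x^k' all subtracted terms carry the same
  surplus power of the factors f_i. The kernel conditions and the adapted representatives are what
  this identity rests on. The vertex condition has a different role: it keeps the shifted exponents
  inside the semigroup, since at a vertex at most one of the two shifts changes the value and the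
  estimate for a single deformation pair suffices. Working modulo an arbitrary ideal of coefficients
  treats all infinitesimal levels at once.\<close>

lemma (in ideal) induced_coset:
  assumes G: "G \<in> ring_hom R A" and A: "ring A" and kills: "G ` I \<subseteq> {\<zero>\<^bsub>A\<^esub>}" and x: "x \<in> carrier R"
  shows "induced G (I +> x) = G x"
proof -
  interpret A: ring A by fact
  have "G y = G x" if y: "y \<in> I +> x" for y
  proof -
    obtain i where i: "i \<in> I" "y = i \<oplus> x"
      using y by (auto simp: a_r_coset_def')
    have "G i = \<zero>\<^bsub>A\<^esub>" using kills i by auto
    then show ?thesis
      using i x G ring_hom_closed[OF G x] by (simp add: ring_hom_add Icarr)
  qed
  moreover have "x \<in> I +> x" using x by (rule a_rcos_self)
  ultimately have "G ` (I +> x) = {G x}" by blast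
  then show ?thesis by (simp add: induced_def)
qed

lemma (in ideal) carrier_quot: "carrier (R Quot I) = (\<lambda>x. I +> x) ` carrier R"
  by (auto simp: FactRing_simps)

lemma (in ideal) quot_closed: "x \<in> carrier R \<Longrightarrow> I +> x \<in> carrier (R Quot I)"
  by (simp add: carrier_quot)

lemma (in ideal) quot_cases:
  assumes "u \<in> carrier (R Quot I)"
  obtains x where "x \<in> carrier R" "u = I +> x"
  using assms unfolding carrier_quot by (rule imageE)

lemma (in ideal) quot_simps:
  assumes "x \<in> carrier R" "y \<in> carrier R"
  shows "(I +> x) \<otimes>\<^bsub>R Quot I\<^esub> (I +> y) = I +> (x \<otimes> y)"
    and "(I +> x) \<oplus>\<^bsub>R Quot I\<^esub> (I +> y) = I +> (x \<oplus> y)"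
  using ring_hom_mult[OF rcos_ring_hom assms] ring_hom_add[OF rcos_ring_hom assms] by simp_all

lemma (in ideal) quot_one: "\<one>\<^bsub>R Quot I\<^esub> = I +> \<one>"
  using ring_hom_one[OF rcos_ring_hom] by simp

lemma (in ideal) quot_zero: "\<zero>\<^bsub>R Quot I\<^esub> = I"
  by (simp add: FactRing_def)

lemma (in ideal) coset_eq_iff:
  assumes "x \<in> carrier R" "y \<in> carrier R"
  shows "I +> x = I +> y \<longleftrightarrow> x \<ominus> y \<in> I"
  using assms quotient_eq_iff_same_a_r_cos[OF ideal_axioms assms] by blast

lemma (in ideal) coset_zero_iff:
  assumes "x \<in> carrier R"
  shows "I +> x = I \<longleftrightarrow> x \<in> I"
  using assms a_coset_join1 a_rcos_const a_rcos_zero by (metis a_rcos_self ideal_axioms)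

text \<open>\<open>induced\<close> takes the single element of an image set, so it is meaningful
  only for maps constant on cosets; a homomorphism that kills \<open>I\<close> is such a map, and
  the ring laws are inherited through representatives.\<close>

lemma (in ideal) induced_ring_hom:
  assumes G: "G \<in> ring_hom R A" and A: "ring A" and kills: "G ` I \<subseteq> {\<zero>\<^bsub>A\<^esub>}"
  shows "induced G \<in> ring_hom (R Quot I) A"
proof (rule ring_hom_memI)
  note [simp] = induced_coset[OF G A kills]
  fix u assume u: "u \<in> carrier (R Quot I)"
  then obtain x where x: "x \<in> carrier R" "u = I +> x" by (auto simp: carrier_quot)
  then show "induced G u \<in> carrier A" using ring_hom_closed[OF G] by simp
  fix v assume "v \<in> carrier (R Quot I)"
  then obtain y where y: "y \<in> carrier R" "v = I +> y" by (auto simp: carrier_quot)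
  show "induced G (u \<otimes>\<^bsub>R Quot I\<^esub> v) = induced G u \<otimes>\<^bsub>A\<^esub> induced G v"
    using x y G by (simp add: quot_simps ring_hom_mult)
  show "induced G (u \<oplus>\<^bsub>R Quot I\<^esub> v) = induced G u \<oplus>\<^bsub>A\<^esub> induced G v"
    using x y G by (simp add: quot_simps ring_hom_add)
next
  show "induced G \<one>\<^bsub>R Quot I\<^esub> = \<one>\<^bsub>A\<^esub>"
    using induced_coset[OF G A kills one_closed] G by (simp add: quot_one ring_hom_one)
qed

lemma (in ideal) to_quot_ring_hom:
  assumes "\<phi> \<in> ring_hom B R"
  shows "(\<lambda>b. I +> \<phi> b) \<in> ring_hom B (R Quot I)"
  using ring_hom_trans[OF assms rcos_ring_hom] by (simp add: comp_def)

text \<open>The conditions of \<open>base_change\<close> are moved from quotients to representatives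
  in \<open>B\<close> and \<open>R\<close>. The hypothesis on the zeros of \<open>G\<close> is the
  only one that is not formal: upstairs, they must come from \<open>I\<close> and from the constants
  that die under \<open>\<delta>\<close>.\<close>

lemma base_change_quot:
  assumes B: "cring B" and R: "cring R" and J: "ideal J B" and I: "ideal I R"
    and \<phi>: "\<phi> \<in> ring_hom B R" and \<phi>J: "\<phi> ` J \<subseteq> I"
    and B': "ring B'" and A': "ring A'"
    and \<delta>: "\<delta> \<in> ring_hom B B'" "\<delta> ` carrier B = carrier B'" and \<delta>J: "\<delta> ` J \<subseteq> {\<zero>\<^bsub>B'\<^esub>}"
    and \<phi>': "\<phi>' \<in> ring_hom B' A'"
    and G: "G \<in> ring_hom R A'" "G ` carrier R = carrier A'" and GI: "G ` I \<subseteq> {\<zero>\<^bsub>A'\<^esub>}"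
    and comm: "\<And>b. b \<in> carrier B \<Longrightarrow> G (\<phi> b) = \<phi>' (\<delta> b)"
    and ker: "\<And>f. f \<in> carrier R \<Longrightarrow> G f = \<zero>\<^bsub>A'\<^esub> \<Longrightarrow> f \<in> genideal R (I \<union> \<phi> ` a_kernel B B' \<delta>)"
  shows "base_change (B Quot J) B' (induced \<delta>) (R Quot I) (induced (\<lambda>b. I +>\<^bsub>R\<^esub> \<phi> b)) A' \<phi>' (induced G)"
proof -
  interpret B: cring B by fact
  interpret R: cring R by fact
  interpret J: ideal J B by fact
  interpret I: ideal I R by fact
  interpret B': ring B' by fact
  interpret A': ring A' by fact
  interpret RI: ring "R Quot I" by (rule I.quotient_is_ring)
  let ?\<phi> = "\<lambda>b. I +>\<^bsub>R\<^esub> \<phi> b"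
  have \<phi>hom: "?\<phi> \<in> ring_hom B (R Quot I)" by (rule I.to_quot_ring_hom[OF \<phi>])
  have \<phi>c: "\<phi> b \<in> carrier R" if "b \<in> carrier B" for b using ring_hom_closed[OF \<phi> that] .
  have \<phi>kills: "?\<phi> ` J \<subseteq> {\<zero>\<^bsub>R Quot I\<^esub>}"
  proof -
    have "I +>\<^bsub>R\<^esub> \<phi> b = I" if "b \<in> J" for b
      using that \<phi>J I.coset_zero_iff[OF \<phi>c[OF J.Icarr[OF that]]] by blast
    then show ?thesis by (auto simp only: I.quot_zero)
  qed
  note [simp] = J.induced_coset[OF \<delta>(1) B' \<delta>J] J.induced_coset[OF \<phi>hom RI.ring_axioms \<phi>kills]
    I.induced_coset[OF G(1) A' GI]
  let ?K = "a_kernel (R Quot I) A' (induced G)"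
  let ?L = "genideal (R Quot I) (induced ?\<phi> ` a_kernel (B Quot J) B' (induced \<delta>))"
  have surj1: "induced \<delta> ` carrier (B Quot J) = carrier B'"
    unfolding J.carrier_quot image_image \<delta>(2)[symmetric] by (rule image_cong) simp_all
  have surj2: "induced G ` carrier (R Quot I) = carrier A'"
    unfolding I.carrier_quot image_image G(2)[symmetric] by (rule image_cong) simp_all
  have hom1: "induced \<delta> \<in> ring_hom (B Quot J) B'" by (rule J.induced_ring_hom[OF \<delta>(1) B' \<delta>J])
  have hom2: "induced G \<in> ring_hom (R Quot I) A'" by (rule I.induced_ring_hom[OF G(1) A' GI])
  have hom3: "induced ?\<phi> \<in> ring_hom (B Quot J) (R Quot I)"
    by (rule J.induced_ring_hom[OF \<phi>hom RI.ring_axioms \<phi>kills])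
  have comm': "induced G (induced ?\<phi> b) = \<phi>' (induced \<delta> b)" if b: "b \<in> carrier (B Quot J)" for b
  proof -
    obtain c where "c \<in> carrier B" "b = J +>\<^bsub>B\<^esub> c"
      using b by (rule J.quot_cases)
    then show ?thesis using comm \<phi>c by simp
  qed
  \<comment> \<open>As \<open>\<delta>\<close> kills \<open>J\<close>, the kernel of the induced map
    consists of the cosets of elements of the kernel of \<open>\<delta>\<close>; the generators of
    \<open>?L\<close> thus have explicit representatives.\<close>
  have gens: "induced ?\<phi> ` a_kernel (B Quot J) B' (induced \<delta>) = (\<lambda>b. I +>\<^bsub>R\<^esub> \<phi> b) ` a_kernel B B' \<delta>"
  proof -
    have "a_kernel (B Quot J) B' (induced \<delta>) = (\<lambda>b. J +>\<^bsub>B\<^esub> b) ` a_kernel B B' \<delta>"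
    proof -
      have c: "J +>\<^bsub>B\<^esub> b \<in> carrier (B Quot J)" if "b \<in> carrier B" for b
        using that by (rule J.quot_closed)
      show ?thesis
        unfolding a_kernel_def'
      proof (intro equalityI subsetI)
        fix u assume "u \<in> {x \<in> carrier (B Quot J). induced \<delta> x = \<zero>\<^bsub>B'\<^esub>}"
        then have u: "u \<in> carrier (B Quot J)" "induced \<delta> u = \<zero>\<^bsub>B'\<^esub>" by simp_all
        from u(1) obtain b where b: "b \<in> carrier B" "u = J +>\<^bsub>B\<^esub> b"
          by (rule J.quot_cases)
        then have "\<delta> b = \<zero>\<^bsub>B'\<^esub>" using u(2) by simp
        then show "u \<in> (+>\<^bsub>B\<^esub>) J ` {x \<in> carrier B. \<delta> x = \<zero>\<^bsub>B'\<^esub>}"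
          unfolding b(2) by (intro imageI) (simp add: b(1))
      next
        fix u assume "u \<in> (+>\<^bsub>B\<^esub>) J ` {x \<in> carrier B. \<delta> x = \<zero>\<^bsub>B'\<^esub>}"
        then obtain b where "b \<in> carrier B" "\<delta> b = \<zero>\<^bsub>B'\<^esub>" "u = J +>\<^bsub>B\<^esub> b" by blast
        then show "u \<in> {x \<in> carrier (B Quot J). induced \<delta> x = \<zero>\<^bsub>B'\<^esub>}" using c by simp
      qed
    qed
    then show ?thesis by (simp add: image_image a_kernel_def')
  qed
  have gensc: "(\<lambda>b. I +>\<^bsub>R\<^esub> \<phi> b) ` a_kernel B B' \<delta> \<subseteq> carrier (R Quot I)"
    unfolding I.carrier_quot using \<phi>c by (simp add: a_kernel_def' image_subset_iff)
  interpret Gh: ring_hom_ring "R Quot I" A' "induced G"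
    by (rule ring_hom_ringI2[OF RI.ring_axioms A' hom2])
  have "?L \<subseteq> ?K"
  proof (rule RI.genideal_minimal[OF Gh.kernel_is_ideal])
    show "induced ?\<phi> ` a_kernel (B Quot J) B' (induced \<delta>) \<subseteq> ?K"
      unfolding gens
    proof (rule image_subsetI)
      fix b assume "b \<in> a_kernel B B' \<delta>"
      then have b: "b \<in> carrier B" "\<delta> b = \<zero>\<^bsub>B'\<^esub>" by (simp_all add: a_kernel_def')
      have "I +>\<^bsub>R\<^esub> \<phi> b \<in> carrier (R Quot I)"
        using \<phi>c[OF b(1)] by (simp add: I.carrier_quot)
      moreover have "induced G (I +>\<^bsub>R\<^esub> \<phi> b) = \<zero>\<^bsub>A'\<^esub>"
        unfolding I.induced_coset[OF G(1) A' GI \<phi>c[OF b(1)]] comm[OF b(1)] b(2)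
        by (rule ring_hom_zero[OF \<phi>' B' A'])
      ultimately show "I +>\<^bsub>R\<^esub> \<phi> b \<in> ?K"
        unfolding a_kernel_def' by blast
    qed
  qed
  moreover have "?K \<subseteq> ?L"
  proof
    fix u assume "u \<in> ?K"
    then have u: "u \<in> carrier (R Quot I)" "induced G u = \<zero>\<^bsub>A'\<^esub>"
      unfolding a_kernel_def' by simp_all
    from u(1) obtain f where f0: "f \<in> carrier R" "u = I +>\<^bsub>R\<^esub> f"
      by (rule I.quot_cases)
    with u(2) have f: "f \<in> carrier R" "u = I +>\<^bsub>R\<^esub> f" "G f = \<zero>\<^bsub>A'\<^esub>"
      by simp_all
    have L: "ideal ?L (R Quot I)"
      using RI.genideal_ideal[OF gensc] by (simp add: gens)
    interpret pr: ring_hom_ring R "R Quot I" "\<lambda>x. I +>\<^bsub>R\<^esub> x"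
      by (rule I.rcos_ring_hom_ring)
    interpret L: ideal ?L "R Quot I" by (rule L)
    \<comment> \<open>The preimage of \<open>?L\<close> in \<open>R\<close> is an ideal that
      contains \<open>I\<close> and the images of the kernel of \<open>\<delta>\<close>, hence
      everything they generate, in particular the representative \<open>f\<close>.\<close>
    have "ideal {r \<in> carrier R. I +>\<^bsub>R\<^esub> r \<in> ?L} R"
      using pr.ideal_vimage[OF L] .
    moreover have "I \<union> \<phi> ` a_kernel B B' \<delta> \<subseteq> {r \<in> carrier R. I +>\<^bsub>R\<^esub> r \<in> ?L}"
    proof -
      have "I +>\<^bsub>R\<^esub> r \<in> ?L" if "r \<in> I" for r
        using that L.zero_closed I.coset_zero_iff[OF I.Icarr[OF that]] by (simp add: I.quot_zero)
      moreover have "I +>\<^bsub>R\<^esub> \<phi> b \<in> ?L" if "b \<in> a_kernel B B' \<delta>" for b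
        using RI.genideal_self[OF gensc] that unfolding gens by blast
      moreover have "I \<subseteq> carrier R" "\<phi> ` a_kernel B B' \<delta> \<subseteq> carrier R"
        using \<phi>c I.Icarr by (auto simp: a_kernel_def')
      ultimately show ?thesis by blast
    qed
    ultimately have "genideal R (I \<union> \<phi> ` a_kernel B B' \<delta>) \<subseteq> {r \<in> carrier R. I +>\<^bsub>R\<^esub> r \<in> ?L}"
      by (rule R.genideal_minimal)
    then show "u \<in> ?L" using ker[OF f(1,3)] f(2) by blast
  qed
  ultimately show ?thesis
    unfolding base_change_def using hom1 surj1 hom3 \<phi>' hom2 surj2 comm' by blast
qed

section \<open>Flatness of modules with a dual basis\<close>

lemma (in abelian_group) add_minus_minus:
  assumes "x \<in> carrier G" "y \<in> carrier G"
  shows "(x \<oplus> y) \<ominus> x \<ominus> y = \<zero>"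
proof -
  have "(x \<oplus> y) \<ominus> x = y" using assms by (simp add: a_comm[of x y] minus_eq a_assoc r_neg)
  then show ?thesis using assms by (simp add: minus_eq r_neg)
qed

section \<open>Tensor products as cosets of bilinearity relators\<close>

locale module_pair = M: Module.module R M + N: Module.module R N
  for R :: "('r, 'x) ring_scheme" and M :: "('r, 'a) module" and N :: "('r, 'b) module"
begin

abbreviation "F \<equiv> free_Abelian_group (carrier M \<times> carrier N)"
abbreviation "H \<equiv> tensor_subgroup R M N"

lemma F_diff: "u \<in> carrier F \<Longrightarrow> v \<in> carrier F \<Longrightarrow> u - v \<in> carrier F"
  using keys_diff[of u v] by auto

lemma relators_cases:
  assumes "u \<in> tensor_relators R M N"
  obtains
    (add_left) x x' y where "u = frag_of (x \<oplus>\<^bsub>M\<^esub> x', y) - frag_of (x, y) - frag_of (x', y)"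
        "x \<in> carrier M" "x' \<in> carrier M" "y \<in> carrier N"
  | (add_right) x y y' where "u = frag_of (x, y \<oplus>\<^bsub>N\<^esub> y') - frag_of (x, y) - frag_of (x, y')"
        "x \<in> carrier M" "y \<in> carrier N" "y' \<in> carrier N"
  | (smult) r x y where "u = frag_of (r \<odot>\<^bsub>M\<^esub> x, y) - frag_of (x, r \<odot>\<^bsub>N\<^esub> y)"
        "r \<in> carrier R" "x \<in> carrier M" "y \<in> carrier N"
  using assms unfolding tensor_relators_def
  apply (elim UnE CollectE exE conjE)
  subgoal by (rule add_left)
  subgoal by (rule add_right)
  subgoal by (rule smult)
  done

lemma relators_carrier: "tensor_relators R M N \<subseteq> carrier F"
proof
  fix u assume "u \<in> tensor_relators R M N"
  then show "u \<in> carrier F"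
    by (cases rule: relators_cases)
       (simp_all only: F_diff frag_of_in_free_Abelian_group mem_Sigma_iff
          M.a_closed N.a_closed M.smult_closed N.smult_closed)
qed

lemma subgroup_H: "subgroup H F"
  unfolding tensor_subgroup_def
  by (rule group.generate_is_subgroup[OF group_free_Abelian_group relators_carrier])

text \<open>The group \<open>F\<close> is addition of finitely supported integer functions. Closure
  of \<open>H\<close> is restated with ordinary \<open>+\<close> and \<open>-\<close>, so that
  relators can be combined by additive rewriting.\<close>

lemma H_zero: "0 \<in> H"
  using subgroup.one_closed[OF subgroup_H] by simp

lemma H_add: "u \<in> H \<Longrightarrow> v \<in> H \<Longrightarrow> u + v \<in> H"
  using subgroup.m_closed[OF subgroup_H] by simp

lemma H_minus: "u \<in> H \<Longrightarrow> - u \<in> H"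
  using subgroup.m_inv_closed[OF subgroup_H, of u] subgroup.mem_carrier[OF subgroup_H, of u] by simp

lemma H_diff: "u \<in> H \<Longrightarrow> v \<in> H \<Longrightarrow> u - v \<in> H"
  using H_add[OF _ H_minus, of u v] by simp

lemma H_sum: "(\<And>i. i \<in> T \<Longrightarrow> g i \<in> H) \<Longrightarrow> sum g T \<in> H"
  by (induction T rule: infinite_finite_induct) (auto intro: H_zero H_add)

lemma H_relator: "u \<in> tensor_relators R M N \<Longrightarrow> u \<in> H"
  unfolding tensor_subgroup_def by (rule generate.incl)

lemma H_add_left:
  "x \<in> carrier M \<Longrightarrow> x' \<in> carrier M \<Longrightarrow> y \<in> carrier N \<Longrightarrow>
    frag_of (x \<oplus>\<^bsub>M\<^esub> x', y) - frag_of (x, y) - frag_of (x', y) \<in> H"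
  by (rule H_relator) (unfold tensor_relators_def, blast)

lemma H_add_right:
  "x \<in> carrier M \<Longrightarrow> y \<in> carrier N \<Longrightarrow> y' \<in> carrier N \<Longrightarrow>
    frag_of (x, y \<oplus>\<^bsub>N\<^esub> y') - frag_of (x, y) - frag_of (x, y') \<in> H"
  by (rule H_relator) (unfold tensor_relators_def, blast)

lemma H_smult:
  "r \<in> carrier R \<Longrightarrow> x \<in> carrier M \<Longrightarrow> y \<in> carrier N \<Longrightarrow>
    frag_of (r \<odot>\<^bsub>M\<^esub> x, y) - frag_of (x, r \<odot>\<^bsub>N\<^esub> y) \<in> H"
  by (rule H_relator) (unfold tensor_relators_def, blast)

text \<open>For \<open>y = y' = 0\<close> the relator of \<open>H_add_right\<close> is minus the
  generator itself.\<close>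

lemma H_zero_right: "x \<in> carrier M \<Longrightarrow> frag_of (x, \<zero>\<^bsub>N\<^esub>) \<in> H"
  using H_minus[OF H_add_right[of x "\<zero>\<^bsub>N\<^esub>" "\<zero>\<^bsub>N\<^esub>"]] by simp

lemma H_zero_left: "y \<in> carrier N \<Longrightarrow> frag_of (\<zero>\<^bsub>M\<^esub>, y) \<in> H"
  using H_minus[OF H_add_left[of "\<zero>\<^bsub>M\<^esub>" "\<zero>\<^bsub>M\<^esub>" y]] by simp

lemma H_diff_right:
  assumes "x \<in> carrier M" "y \<in> carrier N" "y' \<in> carrier N"
  shows "frag_of (x, y \<ominus>\<^bsub>N\<^esub> y') - (frag_of (x, y) - frag_of (x, y')) \<in> H"
proof -
  have "(y \<ominus>\<^bsub>N\<^esub> y') \<oplus>\<^bsub>N\<^esub> y' = y"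
    using assms by (simp add: N.minus_eq N.a_assoc N.l_neg)
  then have "frag_of (x, y) - frag_of (x, y \<ominus>\<^bsub>N\<^esub> y') - frag_of (x, y') \<in> H"
    using H_add_right[of x "y \<ominus>\<^bsub>N\<^esub> y'" y'] assms by simp
  from H_minus[OF this] show ?thesis by (simp add: algebra_simps)
qed

lemma H_finsum_left:
  assumes y: "y \<in> carrier N"
  shows "finite T \<Longrightarrow> g \<in> T \<rightarrow> carrier M \<Longrightarrow>
    frag_of (finsum M g T, y) - (\<Sum>i\<in>T. frag_of (g i, y)) \<in> H"
proof (induction T rule: finite_induct)
  case empty
  then show ?case using H_zero_left[OF y] by simp
next
  case (insert i T)
  have gi: "g i \<in> carrier M" and gT: "g \<in> T \<rightarrow> carrier M" using insert.prems by auto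
  have "frag_of (g i \<oplus>\<^bsub>M\<^esub> finsum M g T, y) - frag_of (g i, y) - frag_of (finsum M g T, y) \<in> H"
    using H_add_left[OF gi M.finsum_closed[OF gT] y] .
  from H_add[OF this insert.IH[OF gT]] show ?case
    using insert.hyps gi gT by (simp add: algebra_simps)
qed

lemma mem_coset_iff: "w \<in> H #>\<^bsub>F\<^esub> v \<longleftrightarrow> w - v \<in> H"
proof
  assume "w \<in> H #>\<^bsub>F\<^esub> v"
  then obtain h where "h \<in> H" "w = h + v"
    unfolding r_coset_def mult_free_Abelian_group by blast
  then show "w - v \<in> H" by simp
next
  assume "w - v \<in> H"
  moreover have "w = (w - v) + v" by simp
  ultimately show "w \<in> H #>\<^bsub>F\<^esub> v"
    unfolding r_coset_def mult_free_Abelian_group by blast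
qed

lemma coset_eq_iff:
  assumes "u \<in> carrier F" "v \<in> carrier F"
  shows "H #>\<^bsub>F\<^esub> u = H #>\<^bsub>F\<^esub> v \<longleftrightarrow> u - v \<in> H"
proof
  assume "H #>\<^bsub>F\<^esub> u = H #>\<^bsub>F\<^esub> v"
  then have "u \<in> H #>\<^bsub>F\<^esub> v"
    using group.rcos_self[OF group_free_Abelian_group assms(1) subgroup_H] by simp
  then show "u - v \<in> H" by (simp only: mem_coset_iff)
next
  assume "u - v \<in> H"
  then have "u \<in> H #>\<^bsub>F\<^esub> v" by (simp only: mem_coset_iff)
  then show "H #>\<^bsub>F\<^esub> u = H #>\<^bsub>F\<^esub> v"
    using group.repr_independence[OF group_free_Abelian_group _ assms(2) subgroup_H, of u] by simp
qed

text \<open>The descent half of the universal property of the tensor product: the kernel of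
  \<open>h\<close> is a subgroup, so it contains whatever the relators generate.\<close>

lemma hom_kills_H:
  assumes h: "h \<in> hom F (add_monoid N)"
    and "\<And>u. u \<in> tensor_relators R M N \<Longrightarrow> h u = \<zero>\<^bsub>N\<^esub>" and u: "u \<in> H"
  shows "h u = \<zero>\<^bsub>N\<^esub>"
proof -
  interpret h: group_hom F "add_monoid N" h
    by (intro group_hom.intro group_hom_axioms.intro N.a_group group_free_Abelian_group h)
  have "tensor_relators R M N \<subseteq> kernel F (add_monoid N) h"
  proof
    fix v assume v: "v \<in> tensor_relators R M N"
    have "v \<in> carrier F" using relators_carrier v by (rule subsetD)
    then show "v \<in> kernel F (add_monoid N) h"
      unfolding kernel_def using assms(2)[OF v] by (intro CollectI conjI) simp_all
  qed
  then have "H \<subseteq> kernel F (add_monoid N) h"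
    unfolding tensor_subgroup_def
    by (rule group.generate_subgroup_incl[OF group_free_Abelian_group _ h.subgroup_kernel])
  then have "u \<in> kernel F (add_monoid N) h" using u by (rule subsetD)
  then show ?thesis by (simp add: kernel_def)
qed

end

text \<open>The family \<open>e\<close> need not be linearly independent: a module with a dual basis is projective.\<close>

locale module_dual_basis = Module.module R M
  for R :: "('r, 'x) ring_scheme" and M :: "('r, 'a) module" +
  fixes e :: "'s \<Rightarrow> 'a" and c :: "'s \<Rightarrow> 'a \<Rightarrow> 'r"
  assumes e: "\<And>i. e i \<in> carrier M"
    and c: "\<And>i x. x \<in> carrier M \<Longrightarrow> c i x \<in> carrier R"
    and c_add: "\<And>i x y. x \<in> carrier M \<Longrightarrow> y \<in> carrier M \<Longrightarrow> c i (x \<oplus>\<^bsub>M\<^esub> y) = c i x \<oplus>\<^bsub>R\<^esub> c i y"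
    and c_smult: "\<And>i r x. r \<in> carrier R \<Longrightarrow> x \<in> carrier M \<Longrightarrow> c i (r \<odot>\<^bsub>M\<^esub> x) = r \<otimes>\<^bsub>R\<^esub> c i x"
    and expand: "\<And>x. x \<in> carrier M \<Longrightarrow> \<exists>T. finite T \<and> (\<forall>i. i \<notin> T \<longrightarrow> c i x = \<zero>\<^bsub>R\<^esub>) \<and>
          x = finsum M (\<lambda>i. c i x \<odot>\<^bsub>M\<^esub> e i) T"

locale module_dual_basis_pair = module_pair R M N + module_dual_basis R M e c
  for R :: "('r, 'x) ring_scheme" and M :: "('r, 'a) module" and N :: "('r, 'b) module"
    and e :: "'s \<Rightarrow> 'a" and c :: "'s \<Rightarrow> 'a \<Rightarrow> 'r"
begin

text \<open>The map (x, y) \<mapsto> c_i(x) y extends from generators by the universal property of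
  the free abelian group; its bilinearity enters only when it is passed to the tensor
  product.\<close>

lemma ex_coordinate:
  "\<exists>h. h \<in> hom F (add_monoid N) \<and>
      (\<forall>x\<in>carrier M. \<forall>y\<in>carrier N. h (frag_of (x, y)) = c i x \<odot>\<^bsub>N\<^esub> y)"
proof -
  have sub: "(\<lambda>(x, y). c i x \<odot>\<^bsub>N\<^esub> y) ` (carrier M \<times> carrier N) \<subseteq> carrier (add_monoid N)"
    using c N.smult_closed by auto
  obtain h where "h \<in> hom F (add_monoid N)"
    "\<And>z. z \<in> carrier M \<times> carrier N \<Longrightarrow> h (frag_of z) = (\<lambda>(x, y). c i x \<odot>\<^bsub>N\<^esub> y) z"
    using comm_group.free_Abelian_group_universal[OF N.a_comm_group sub] by blast
  then show ?thesis by auto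
qed

text \<open>\<open>SOME\<close> is used because the universal property gives mere existence and
  prescribes nothing off the carrier of \<open>F\<close>; only the homomorphism property and the
  values on generators are ever referred to.\<close>

definition coordinate :: "'s \<Rightarrow> ('a \<times> 'b \<Rightarrow>\<^sub>0 int) \<Rightarrow> 'b" where
  "coordinate i = (SOME h. h \<in> hom F (add_monoid N) \<and>
      (\<forall>x\<in>carrier M. \<forall>y\<in>carrier N. h (frag_of (x, y)) = c i x \<odot>\<^bsub>N\<^esub> y))"

lemma coordinate_hom: "coordinate i \<in> hom F (add_monoid N)"
  and coordinate_frag_of:
    "x \<in> carrier M \<Longrightarrow> y \<in> carrier N \<Longrightarrow> coordinate i (frag_of (x, y)) = c i x \<odot>\<^bsub>N\<^esub> y"
  using someI_ex[OF ex_coordinate[of i]] unfolding coordinate_def by blast+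

lemma coordinate_closed: "u \<in> carrier F \<Longrightarrow> coordinate i u \<in> carrier N"
  using hom_in_carrier[OF coordinate_hom] by simp

lemma coordinate_zero: "coordinate i 0 = \<zero>\<^bsub>N\<^esub>"
  using hom_one[OF coordinate_hom[of i] group_free_Abelian_group N.a_group] by simp

lemma coordinate_diff:
  assumes "u \<in> carrier F" "v \<in> carrier F"
  shows "coordinate i (u - v) = coordinate i u \<ominus>\<^bsub>N\<^esub> coordinate i v"
proof -
  interpret h: group_hom F "add_monoid N" "coordinate i"
    by (intro group_hom.intro group_hom_axioms.intro N.a_group group_free_Abelian_group coordinate_hom)
  have "- v \<in> carrier F" using assms by simp
  then have "coordinate i (u + (- v)) = coordinate i u \<oplus>\<^bsub>N\<^esub> coordinate i (- v)"
    using h.hom_mult[of u "- v"] assms by simp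
  moreover have "coordinate i (- v) = \<ominus>\<^bsub>N\<^esub> coordinate i v"
    using h.hom_inv[of v] assms by (simp add: a_inv_def)
  ultimately show ?thesis by (simp add: N.minus_eq)
qed

text \<open>The three kinds of relators correspond to additivity of c_i, additivity of the action,
  and linearity over scalars; the last one moves \<open>r\<close> past the coefficient by
  commutativity of \<open>R\<close>.\<close>

lemma coordinate_kills: "u \<in> H \<Longrightarrow> coordinate i u = \<zero>\<^bsub>N\<^esub>"
proof (rule hom_kills_H[OF coordinate_hom])
  fix u assume "u \<in> tensor_relators R M N"
  then show "coordinate i u = \<zero>\<^bsub>N\<^esub>"
  proof (cases rule: relators_cases)
    case l: (add_left x x' y)
    have u: "frag_of (x \<oplus>\<^bsub>M\<^esub> x', y) \<in> carrier F" "frag_of (x, y) \<in> carrier F" "frag_of (x', y) \<in> carrier F"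
      using l(2-4) M.a_closed by auto
    have "coordinate i u = c i (x \<oplus>\<^bsub>M\<^esub> x') \<odot>\<^bsub>N\<^esub> y \<ominus>\<^bsub>N\<^esub> c i x \<odot>\<^bsub>N\<^esub> y \<ominus>\<^bsub>N\<^esub> c i x' \<odot>\<^bsub>N\<^esub> y"
      unfolding l(1) coordinate_diff[OF F_diff[OF u(1,2)] u(3)] coordinate_diff[OF u(1,2)]
      using l(2-4) by (simp add: coordinate_frag_of)
    then show ?thesis
      using l(2-4) c N.add_minus_minus N.smult_closed by (simp add: c_add N.smult_l_distr)
  next
    case r: (add_right x y y')
    have u: "frag_of (x, y \<oplus>\<^bsub>N\<^esub> y') \<in> carrier F" "frag_of (x, y) \<in> carrier F" "frag_of (x, y') \<in> carrier F"
      using r(2-4) N.a_closed by auto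
    have "coordinate i u = c i x \<odot>\<^bsub>N\<^esub> (y \<oplus>\<^bsub>N\<^esub> y') \<ominus>\<^bsub>N\<^esub> c i x \<odot>\<^bsub>N\<^esub> y \<ominus>\<^bsub>N\<^esub> c i x \<odot>\<^bsub>N\<^esub> y'"
      unfolding r(1) coordinate_diff[OF F_diff[OF u(1,2)] u(3)] coordinate_diff[OF u(1,2)]
      using r(2-4) by (simp add: coordinate_frag_of)
    then show ?thesis
      using r(2-4) c N.add_minus_minus N.smult_closed by (simp add: N.smult_r_distr)
  next
    case s: (smult r x y)
    have u: "frag_of (r \<odot>\<^bsub>M\<^esub> x, y) \<in> carrier F" "frag_of (x, r \<odot>\<^bsub>N\<^esub> y) \<in> carrier F"
      using s(2-4) M.smult_closed N.smult_closed by auto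
    have "coordinate i u = c i (r \<odot>\<^bsub>M\<^esub> x) \<odot>\<^bsub>N\<^esub> y \<ominus>\<^bsub>N\<^esub> c i x \<odot>\<^bsub>N\<^esub> (r \<odot>\<^bsub>N\<^esub> y)"
      unfolding s(1) coordinate_diff[OF u(1,2)]
      using s(2-4) M.smult_closed N.smult_closed by (simp add: coordinate_frag_of)
    also have "c i (r \<odot>\<^bsub>M\<^esub> x) \<odot>\<^bsub>N\<^esub> y = c i x \<odot>\<^bsub>N\<^esub> (r \<odot>\<^bsub>N\<^esub> y)"
      using s(2-4) c[of x i] M.m_comm[of r "c i x"] by (simp add: c_smult N.smult_assoc1[symmetric])
    finally show ?thesis
      using s(2-4) c[of x i] N.smult_closed by (simp add: N.minus_eq N.r_neg)
  qed
qed

text \<open>Modulo \<open>H\<close>, x \<otimes> y is the sum of the (c_i x) e_i \<otimes> y, hence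
  of the e_i \<otimes> (c_i x) y. The claim covers all larger finite index sets, so that the sums
  for \<open>u\<close> and \<open>v\<close> can be subtracted over a common one.\<close>

lemma expand_tensor:
  assumes "u \<in> carrier F"
  shows "\<exists>T. finite T \<and> (\<forall>T'. finite T' \<longrightarrow> T \<subseteq> T' \<longrightarrow>
           u - (\<Sum>i\<in>T'. frag_of (e i, coordinate i u)) \<in> H)"
proof -
  from assms have "Poly_Mapping.keys u \<subseteq> carrier M \<times> carrier N" by simp
  then show ?thesis
  proof (induction u rule: free_Abelian_group_induct[consumes 1, case_names zero diff frag_of])
    case zero
    show ?case
      by (intro exI[of _ "{}"]) (auto simp: coordinate_zero intro!: H_minus H_sum H_zero_right e)
  next
    case (diff u v)
    from diff obtain T where T: "finite T" "\<And>T'. finite T' \<Longrightarrow> T \<subseteq> T' \<Longrightarrow> u - (\<Sum>i\<in>T'. frag_of (e i, coordinate i u)) \<in> H"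
      by blast
    from diff obtain S where S: "finite S" "\<And>T'. finite T' \<Longrightarrow> S \<subseteq> T' \<Longrightarrow> v - (\<Sum>i\<in>T'. frag_of (e i, coordinate i v)) \<in> H"
      by blast
    show ?case
    proof (intro exI[of _ "T \<union> S"] conjI allI impI)
      fix T' assume T': "finite T'" "T \<union> S \<subseteq> T'"
      have uv: "u \<in> carrier F" "v \<in> carrier F" using diff by simp_all
      \<comment> \<open>Coordinates are additive, but e_i \<otimes> (a - b) splits only modulo
        \<open>H\<close>; this sum collects the corrections.\<close>
      have "(\<Sum>i\<in>T'. frag_of (e i, coordinate i u \<ominus>\<^bsub>N\<^esub> coordinate i v)
              - (frag_of (e i, coordinate i u) - frag_of (e i, coordinate i v))) \<in> H"
        using uv by (intro H_sum H_diff_right e coordinate_closed)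
      moreover have "(u - (\<Sum>i\<in>T'. frag_of (e i, coordinate i u)))
           - (v - (\<Sum>i\<in>T'. frag_of (e i, coordinate i v))) \<in> H"
        using T(2)[of T'] S(2)[of T'] T' by (blast intro: H_diff)
      ultimately have "(u - (\<Sum>i\<in>T'. frag_of (e i, coordinate i u)))
           - (v - (\<Sum>i\<in>T'. frag_of (e i, coordinate i v)))
           - (\<Sum>i\<in>T'. frag_of (e i, coordinate i u \<ominus>\<^bsub>N\<^esub> coordinate i v)
              - (frag_of (e i, coordinate i u) - frag_of (e i, coordinate i v))) \<in> H"
        by (rule H_diff[rotated])
      then show "u - v - (\<Sum>i\<in>T'. frag_of (e i, coordinate i (u - v))) \<in> H"
        by (simp add: coordinate_diff[OF uv] sum_subtractf sum.distrib algebra_simps)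
    qed (use T S in auto)
  next
    case (frag_of z)
    obtain x y where z: "z = (x, y)" "x \<in> carrier M" "y \<in> carrier N" using frag_of by auto
    obtain T where T: "finite T" "\<And>i. i \<notin> T \<Longrightarrow> c i x = \<zero>\<^bsub>R\<^esub>"
      "x = finsum M (\<lambda>i. c i x \<odot>\<^bsub>M\<^esub> e i) T"
      using expand[OF z(2)] by blast
    show ?case
    proof (intro exI[of _ T] conjI allI impI)
      fix T' assume T': "finite T'" "T \<subseteq> T'"
      have "frag_of (finsum M (\<lambda>i. c i x \<odot>\<^bsub>M\<^esub> e i) T, y) - (\<Sum>i\<in>T. frag_of (c i x \<odot>\<^bsub>M\<^esub> e i, y)) \<in> H"
        using T(1) z c e by (intro H_finsum_left) auto
      moreover have "(\<Sum>i\<in>T. frag_of (c i x \<odot>\<^bsub>M\<^esub> e i, y) - frag_of (e i, c i x \<odot>\<^bsub>N\<^esub> y)) \<in> H"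
        using z c e by (intro H_sum H_smult)
      ultimately have "frag_of (finsum M (\<lambda>i. c i x \<odot>\<^bsub>M\<^esub> e i) T, y) - (\<Sum>i\<in>T. frag_of (c i x \<odot>\<^bsub>M\<^esub> e i, y))
          + (\<Sum>i\<in>T. frag_of (c i x \<odot>\<^bsub>M\<^esub> e i, y) - frag_of (e i, c i x \<odot>\<^bsub>N\<^esub> y)) \<in> H"
        by (rule H_add)
      then have "frag_of (x, y) - (\<Sum>i\<in>T. frag_of (e i, c i x \<odot>\<^bsub>N\<^esub> y)) \<in> H"
        unfolding T(3)[symmetric] by (simp add: sum_subtractf)
      \<comment> \<open>Indices outside \<open>T\<close> have coefficient zero and contribute e_i
        \<otimes> 0.\<close>
      moreover have "(\<Sum>i\<in>T' - T. frag_of (e i, c i x \<odot>\<^bsub>N\<^esub> y)) \<in> H"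
        using z T(2) e by (intro H_sum) (auto intro!: H_zero_right)
      ultimately have "frag_of (x, y) - (\<Sum>i\<in>T. frag_of (e i, c i x \<odot>\<^bsub>N\<^esub> y))
          - (\<Sum>i\<in>T' - T. frag_of (e i, c i x \<odot>\<^bsub>N\<^esub> y)) \<in> H"
        by (rule H_diff)
      then show "frag_of z - (\<Sum>i\<in>T'. frag_of (e i, coordinate i (frag_of z))) \<in> H"
        using z T' by (simp add: coordinate_frag_of sum.subset_diff[OF T'(2,1)] algebra_simps)
    qed (use T in auto)
  qed
qed

text \<open>The coordinates together embed the tensor product into a product of copies of
  \<open>N\<close>: if they all vanish, the expansion consists of terms e_i \<otimes> 0.\<close>

lemma mem_H_iff:
  assumes u: "u \<in> carrier F"
  shows "u \<in> H \<longleftrightarrow> (\<forall>i. coordinate i u = \<zero>\<^bsub>N\<^esub>)"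
proof
  assume *: "\<forall>i. coordinate i u = \<zero>\<^bsub>N\<^esub>"
  obtain T where T: "u - (\<Sum>i\<in>T. frag_of (e i, coordinate i u)) \<in> H"
    using expand_tensor[OF u] by blast
  moreover have "(\<Sum>i\<in>T. frag_of (e i, coordinate i u)) \<in> H"
    using * e by (intro H_sum) (auto intro!: H_zero_right)
  ultimately have "u - (\<Sum>i\<in>T. frag_of (e i, coordinate i u)) + (\<Sum>i\<in>T. frag_of (e i, coordinate i u)) \<in> H"
    by (rule H_add)
  then show "u \<in> H" by simp
qed (use coordinate_kills in blast)

end

text \<open>In coordinates, the map induced by \<open>f\<close> is \<open>f\<close> on each copy of
  \<open>N\<close>. A tensor is zero exactly if its coordinates are, and an injective additive
  \<open>f\<close> reflects zero.\<close>

theorem (in module_dual_basis) flat: "flat_module TYPE('t) R M"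
  unfolding flat_module_def
proof (intro conjI allI impI)
  show "Module.module R M" by unfold_locales
  fix N N' :: "('r, 't) module" and f
  assume N: "Module.module R N" and N': "Module.module R N'"
    and f: "f \<in> linear_maps R N N'" and inj: "inj_on f (carrier N)"
  interpret N: Module.module R N by fact
  interpret N': Module.module R N' by fact
  interpret P: module_dual_basis_pair R M N e c by unfold_locales
  interpret P': module_dual_basis_pair R M N' e c by unfold_locales
  let ?f = "frag_extend (\<lambda>(x, y). frag_of (x, f y))"
  have fc: "f y \<in> carrier N'" if "y \<in> carrier N" for y using f that by (auto simp: linear_maps_def)
  have fa: "f (y \<oplus>\<^bsub>N\<^esub> z) = f y \<oplus>\<^bsub>N'\<^esub> f z" if "y \<in> carrier N" "z \<in> carrier N" for y z
    using f that by (auto simp: linear_maps_def)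
  have fs: "f (r \<odot>\<^bsub>N\<^esub> y) = r \<odot>\<^bsub>N'\<^esub> f y" if "r \<in> carrier R" "y \<in> carrier N" for r y
    using f that by (auto simp: linear_maps_def)
  interpret f: group_hom "add_monoid N" "add_monoid N'" f
    by (rule group_hom.intro[OF N.a_group N'.a_group])
       (auto intro!: group_hom_axioms.intro homI simp: fc fa)
  have f0: "f \<zero>\<^bsub>N\<^esub> = \<zero>\<^bsub>N'\<^esub>" using f.hom_one by simp
  have fm: "f (y \<ominus>\<^bsub>N\<^esub> z) = f y \<ominus>\<^bsub>N'\<^esub> f z" if "y \<in> carrier N" "z \<in> carrier N" for y z
    using that f.hom_inv[of z] fa by (simp add: a_minus_def a_inv_def)
  have ext: "?f u \<in> carrier P'.F \<and> (\<forall>i. P'.coordinate i (?f u) = f (P.coordinate i u))"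
    if "u \<in> carrier P.F" for u
  proof -
    from that have "Poly_Mapping.keys u \<subseteq> carrier M \<times> carrier N" by simp
    then show ?thesis
    proof (induction u rule: free_Abelian_group_induct[consumes 1, case_names zero diff frag_of])
      case zero
      then show ?case by (simp add: P.coordinate_zero P'.coordinate_zero f0)
    next
      case (diff u v)
      from diff have uv: "u \<in> carrier P.F" "v \<in> carrier P.F" by simp_all
      have "?f u - ?f v \<in> carrier P'.F"
        using diff keys_diff[of "?f u" "?f v"] by auto
      moreover have "P'.coordinate i (?f u - ?f v) = f (P.coordinate i (u - v))" for i
        using diff P.coordinate_closed[OF uv(1)] P.coordinate_closed[OF uv(2)]
        by (simp only: P'.coordinate_diff P.coordinate_diff[OF uv] fm)
      ultimately show ?case by (simp add: frag_extend_diff)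
    next
      case (frag_of z)
      from frag_of obtain x y where "z = (x, y)" "x \<in> carrier M" "y \<in> carrier N" by auto
      then show ?case
        using fc c fs by (simp add: P.coordinate_frag_of P'.coordinate_frag_of keys_frag_of)
    qed
  qed
  have mem: "?f u \<in> P'.H \<longleftrightarrow> u \<in> P.H" if u: "u \<in> carrier P.F" for u
  proof -
    have "f (P.coordinate i u) = \<zero>\<^bsub>N'\<^esub> \<longleftrightarrow> P.coordinate i u = \<zero>\<^bsub>N\<^esub>" for i
      using inj_onD[OF inj, of "P.coordinate i u" "\<zero>\<^bsub>N\<^esub>"] f0 P.coordinate_closed[OF u] by auto
    then show ?thesis using ext[OF u] P.mem_H_iff[OF u] P'.mem_H_iff[of "?f u"] by simp
  qed
  \<comment> \<open>From right to left this makes the induced map well defined on cosets, from left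
    to right it is injectivity.\<close>
  have eq: "P'.H #>\<^bsub>P'.F\<^esub> ?f u = P'.H #>\<^bsub>P'.F\<^esub> ?f v \<longleftrightarrow> P.H #>\<^bsub>P.F\<^esub> u = P.H #>\<^bsub>P.F\<^esub> v"
    if u: "u \<in> carrier P.F" and v: "v \<in> carrier P.F" for u v
  proof -
    have "u - v \<in> carrier P.F" using u v keys_diff[of u v] by auto
    from mem[OF this] show ?thesis
      unfolding P.coset_eq_iff[OF u v] P'.coset_eq_iff[OF ext[OF u, THEN conjunct1] ext[OF v, THEN conjunct1]]
        frag_extend_diff .
  qed
  have map: "tensor_map R M N' f (P.H #>\<^bsub>P.F\<^esub> u) = P'.H #>\<^bsub>P'.F\<^esub> ?f u"
    if u: "u \<in> carrier P.F" for u
  proof -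
    have "(\<lambda>w. P'.H #>\<^bsub>P'.F\<^esub> ?f w) ` (P.H #>\<^bsub>P.F\<^esub> u) = {P'.H #>\<^bsub>P'.F\<^esub> ?f u}"
    proof (intro equalityI subsetI)
      fix K assume "K \<in> (\<lambda>w. P'.H #>\<^bsub>P'.F\<^esub> ?f w) ` (P.H #>\<^bsub>P.F\<^esub> u)"
      then obtain w where w: "w \<in> P.H #>\<^bsub>P.F\<^esub> u" "K = P'.H #>\<^bsub>P'.F\<^esub> ?f w" by blast
      have "w \<in> carrier P.F"
        using w(1) subgroup.elemrcos_carrier[OF P.subgroup_H group_free_Abelian_group u] by blast
      moreover have "P.H #>\<^bsub>P.F\<^esub> w = P.H #>\<^bsub>P.F\<^esub> u"
        using group.repr_independence[OF group_free_Abelian_group w(1) u P.subgroup_H] by simp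
      ultimately show "K \<in> {P'.H #>\<^bsub>P'.F\<^esub> ?f u}" using eq[OF _ u] w(2) by blast
    next
      fix K assume "K \<in> {P'.H #>\<^bsub>P'.F\<^esub> ?f u}"
      then show "K \<in> (\<lambda>w. P'.H #>\<^bsub>P'.F\<^esub> ?f w) ` (P.H #>\<^bsub>P.F\<^esub> u)"
        using group.rcos_self[OF group_free_Abelian_group u P.subgroup_H] by blast
    qed
    then show ?thesis by (simp add: tensor_map_def induced_def)
  qed
  show "inj_on (tensor_map R M N' f) (carrier (tensor_product R M N))"
  proof (rule inj_onI)
    fix A B assume A: "A \<in> carrier (tensor_product R M N)" and B: "B \<in> carrier (tensor_product R M N)"
      and AB: "tensor_map R M N' f A = tensor_map R M N' f B"
    from A obtain u where u: "u \<in> carrier P.F" "A = P.H #>\<^bsub>P.F\<^esub> u"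
      unfolding tensor_product_def carrier_FactGroup by (rule imageE)
    from B obtain v where v: "v \<in> carrier P.F" "B = P.H #>\<^bsub>P.F\<^esub> v"
      unfolding tensor_product_def carrier_FactGroup by (rule imageE)
    show "A = B" using AB eq[OF u(1) v(1)] map[OF u(1)] map[OF v(1)] u(2) v(2) by simp
  qed
qed

section \<open>Ideals and polynomials over rings of type classes\<close>

lemma type_ring_simps [simp]:
  "carrier (ring_of_type_algebra :: 'a::comm_ring_1 ring) = UNIV"
  "\<zero>\<^bsub>ring_of_type_algebra :: 'a::comm_ring_1 ring\<^esub> = 0"
  "\<one>\<^bsub>ring_of_type_algebra :: 'a::comm_ring_1 ring\<^esub> = 1"
  "(x :: 'a) \<oplus>\<^bsub>ring_of_type_algebra\<^esub> y = x + y"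
  "(x :: 'a) \<otimes>\<^bsub>ring_of_type_algebra\<^esub> y = x * y"
  by (simp_all add: ring_of_type_algebra_def)

lemma type_ring_uminus [simp]: "\<ominus>\<^bsub>ring_of_type_algebra\<^esub> (x :: 'a::comm_ring_1) = - x"
proof -
  interpret cring "ring_of_type_algebra :: 'a ring" by (rule cring_from_type_algebra)
  show ?thesis by (rule minus_equality) simp_all
qed

lemma type_ring_minus [simp]: "(x :: 'a::comm_ring_1) \<ominus>\<^bsub>ring_of_type_algebra\<^esub> y = x - y"
  by (simp add: a_minus_def)

text \<open>Negatives need no condition of their own: they come from multiplication by
  \<open>- 1\<close>.\<close>

lemma type_idealI:
  fixes J :: "'a::comm_ring_1 set"
  assumes "0 \<in> J" and add: "\<And>x y. x \<in> J \<Longrightarrow> y \<in> J \<Longrightarrow> x + y \<in> J" and mult: "\<And>r x. x \<in> J \<Longrightarrow> r * x \<in> J"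
  shows "ideal J ring_of_type_algebra"
proof (rule idealI)
  show "ring (ring_of_type_algebra :: 'a ring)" by (rule ring_from_type_algebra)
  then interpret ring "ring_of_type_algebra :: 'a ring" .
  have "- x \<in> J" if "x \<in> J" for x using mult[OF that, of "- 1"] by simp
  moreover have "inv\<^bsub>add_monoid ring_of_type_algebra\<^esub> x = - x" for x :: 'a
    using type_ring_uminus[of x] by (simp only: a_inv_def)
  ultimately show "subgroup J (add_monoid ring_of_type_algebra)"
    using assms(1) add by (intro subgroup.intro) (simp_all only: partial_object.simps monoid.simps type_ring_simps subset_UNIV)
qed (use mult in \<open>auto simp: mult.commute\<close>)

lemma type_idealD:
  assumes "ideal J (ring_of_type_algebra :: 'a::comm_ring_1 ring)"
  shows "0 \<in> J" "x \<in> J \<Longrightarrow> y \<in> J \<Longrightarrow> x + y \<in> J" "x \<in> J \<Longrightarrow> r * x \<in> J"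
    "x \<in> J \<Longrightarrow> - x \<in> J" "x \<in> J \<Longrightarrow> y \<in> J \<Longrightarrow> x - y \<in> J"
proof -
  note sub = ideal.axioms(1)[OF assms]
  show "0 \<in> J" using additive_subgroup.zero_closed[OF sub] by (simp only: type_ring_simps)
  show *: "x \<in> J \<Longrightarrow> y \<in> J \<Longrightarrow> x + y \<in> J" for x y using additive_subgroup.a_closed[OF sub, of x y] by (simp only: type_ring_simps)
  show "x \<in> J \<Longrightarrow> r * x \<in> J" for r x using ideal.I_l_closed[OF assms, of x r] by (simp only: type_ring_simps UNIV_I)
  show m: "x \<in> J \<Longrightarrow> - x \<in> J" for x using ideal.I_l_closed[OF assms, of x "- 1"] by simp
  show "x \<in> J \<Longrightarrow> y \<in> J \<Longrightarrow> x - y \<in> J" using *[OF _ m, of x y] by simp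
qed

lemma type_ideal_sum:
  assumes "ideal J (ring_of_type_algebra :: 'a::comm_ring_1 ring)" "\<And>i. i \<in> T \<Longrightarrow> g i \<in> J"
  shows "sum g T \<in> J"
  using assms(2) by (induction T rule: infinite_finite_induct) (auto intro: type_idealD[OF assms(1)])

lemma ideal_type_genideal: "ideal (genideal (ring_of_type_algebra :: 'a::comm_ring_1 ring) S) ring_of_type_algebra"
  by (rule ring.genideal_ideal[OF ring_from_type_algebra]) simp

lemma type_genideal_self: "x \<in> S \<Longrightarrow> x \<in> genideal (ring_of_type_algebra :: 'a::comm_ring_1 ring) S"
  using ring.genideal_self[OF ring_from_type_algebra, of S] by auto

lemma type_genideal_minimal:
  "ideal J (ring_of_type_algebra :: 'a::comm_ring_1 ring) \<Longrightarrow> S \<subseteq> J \<Longrightarrow> genideal ring_of_type_algebra S \<subseteq> J"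
  by (rule ring.genideal_minimal[OF ring_from_type_algebra])

lemma type_genideal_mono:
  "S \<subseteq> T \<Longrightarrow> genideal (ring_of_type_algebra :: 'a::comm_ring_1 ring) S \<subseteq> genideal ring_of_type_algebra T"
  by (rule type_genideal_minimal[OF ideal_type_genideal]) (auto intro: type_genideal_self)

text \<open>Homomorphisms between whole types. Coefficient maps, \<open>Const\<close>, substitutions
  and the special fibre are all instances, so sums, products and powers are pushed through by one
  set of facts instead of carrier arguments.\<close>

locale comm_ring_map =
  fixes \<delta> :: "'a::comm_ring_1 \<Rightarrow> 'b::comm_ring_1"
  assumes add: "\<delta> (x + y) = \<delta> x + \<delta> y"
    and mult: "\<delta> (x * y) = \<delta> x * \<delta> y"
    and one: "\<delta> 1 = 1"
begin

lemma zero [simp]: "\<delta> 0 = 0"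
  using add[of 0 0] by simp

lemma uminus: "\<delta> (- x) = - \<delta> x"
  using add[of x "- x"] by (simp add: eq_neg_iff_add_eq_0 add.commute)

lemma minus: "\<delta> (x - y) = \<delta> x - \<delta> y"
  using add[of x "- y"] by (simp add: uminus)

lemma sum: "\<delta> (sum g T) = (\<Sum>i\<in>T. \<delta> (g i))"
  by (induction T rule: infinite_finite_induct) (auto simp: add)

lemma prod: "\<delta> (prod g T) = (\<Prod>i\<in>T. \<delta> (g i))"
  by (induction T rule: infinite_finite_induct) (auto simp: mult one)

lemma power: "\<delta> (x ^ n) = \<delta> x ^ n"
  by (induction n) (auto simp: mult one)

lemma of_nat: "\<delta> (of_nat n) = of_nat n"
  by (induction n) (auto simp: add one)

lemma ring_hom: "\<delta> \<in> ring_hom ring_of_type_algebra ring_of_type_algebra"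
  by (rule ring_hom_memI) (auto simp: add mult one)

end

lemma poly_mapping_sum_single: "f = (\<Sum>k\<in>Poly_Mapping.keys f. Poly_Mapping.single k (Poly_Mapping.lookup f k))"
proof (rule poly_mapping_eqI)
  fix k
  show "Poly_Mapping.lookup f k = Poly_Mapping.lookup (\<Sum>k\<in>Poly_Mapping.keys f. Poly_Mapping.single k (Poly_Mapping.lookup f k)) k"
    by (cases "k \<in> Poly_Mapping.keys f")
      (auto simp: lookup_sum lookup_single when_def sum.delta not_in_keys_iff_lookup_eq_zero)
qed

lemma poly_mapping_single_induct [case_names zero add single]:
  fixes f :: "'a \<Rightarrow>\<^sub>0 'b::comm_monoid_add"
  assumes "P 0" "\<And>f g. P f \<Longrightarrow> P g \<Longrightarrow> P (f + g)" "\<And>k c. P (Poly_Mapping.single k c)"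
  shows "P f"
proof -
  have "P (\<Sum>k\<in>T. Poly_Mapping.single k (Poly_Mapping.lookup f k))" for T
    by (induction T rule: infinite_finite_induct) (auto intro: assms)
  then show ?thesis by (subst poly_mapping_sum_single)
qed

text \<open>Cancellation may shrink the support of a sum; the condition at 0 makes the lost terms
  vanish anyway.\<close>

lemma sum_keys_add:
  fixes b :: "'a \<Rightarrow> 'b::comm_monoid_add \<Rightarrow> 'c::comm_monoid_add"
  assumes "\<And>k. b k 0 = 0" "\<And>k x y. b k (x + y) = b k x + b k y"
  shows "(\<Sum>k\<in>Poly_Mapping.keys (f + g). b k (Poly_Mapping.lookup (f + g) k)) =
    (\<Sum>k\<in>Poly_Mapping.keys f. b k (Poly_Mapping.lookup f k)) + (\<Sum>k\<in>Poly_Mapping.keys g. b k (Poly_Mapping.lookup g k))"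
  using assms by (rule setsum_keys_plus_distrib)

text \<open>Both sides are biadditive, so factors with a single term suffice. This yields
  multiplicativity of coefficient maps and of substitutions alike.\<close>

lemma mult_of_mult_single:
  fixes L :: "('a::comm_monoid_add \<Rightarrow>\<^sub>0 'b::comm_ring_1) \<Rightarrow> 'c::comm_ring_1"
  assumes add: "\<And>f g. L (f + g) = L f + L g"
    and singles: "\<And>k l x y. L (Poly_Mapping.single k x * Poly_Mapping.single l y) = L (Poly_Mapping.single k x) * L (Poly_Mapping.single l y)"
  shows "L (f * g) = L f * L g"
proof -
  have L0: "L 0 = 0" using add[of 0 0] by simp
  show ?thesis
  proof (induction f rule: poly_mapping_single_induct)
    case (single k c)
    show ?case
      by (induction g rule: poly_mapping_single_induct) (auto simp: L0 add singles distrib_left)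
  qed (auto simp: L0 add distrib_right)
qed

section \<open>Substitution and change of coefficients\<close>

lemma substitute_add:
  fixes h :: "'k::comm_ring_1 \<Rightarrow> 'a::comm_ring_1"
  assumes "\<And>x y. h (x + y) = h x + h y"
  shows "substitute h g (p + q) = substitute h g p + substitute h g q"
proof -
  have "h 0 = 0" using assms[of 0 0] by simp
  then show ?thesis
    unfolding substitute_def by (intro sum_keys_add) (auto simp: assms distrib_right)
qed

lemma substitute_single:
  fixes h :: "'k::comm_ring_1 \<Rightarrow> 'a::comm_ring_1"
  assumes "h 0 = 0"
  shows "substitute h g (Poly_Mapping.single e c) = h c * (\<Prod>v\<in>UNIV. g v ^ Poly_Mapping.lookup e v)"
  using assms by (cases "c = 0") (auto simp: substitute_def)

context comm_ring_map
begin

lemma lookup_map [simp]: "Poly_Mapping.lookup (Poly_Mapping.map \<delta> f) k = \<delta> (Poly_Mapping.lookup f k)"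
  by (simp add: Poly_Mapping.map.rep_eq when_def)

lemma map_single: "Poly_Mapping.map \<delta> (Poly_Mapping.single k c) = Poly_Mapping.single k (\<delta> c)"
  by (rule poly_mapping_eqI) (simp add: lookup_single when_def)

lemma map_ring_map: "comm_ring_map (Poly_Mapping.map \<delta> :: ('c::comm_monoid_add \<Rightarrow>\<^sub>0 'a) \<Rightarrow> _)"
proof
  show add_map: "Poly_Mapping.map \<delta> (f + g) = Poly_Mapping.map \<delta> f + Poly_Mapping.map \<delta> g" for f g :: "'c \<Rightarrow>\<^sub>0 'a"
    by (rule poly_mapping_eqI) (simp add: lookup_add add)
  show "Poly_Mapping.map \<delta> (f * g) = Poly_Mapping.map \<delta> f * Poly_Mapping.map \<delta> g" for f g :: "'c \<Rightarrow>\<^sub>0 'a"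
    by (rule mult_of_mult_single) (simp_all add: add_map mult_single map_single mult)
  show "Poly_Mapping.map \<delta> (1 :: 'c \<Rightarrow>\<^sub>0 'a) = 1"
    by (simp add: map_single one flip: single_one)
qed

lemma surj_map:
  assumes "surj \<delta>"
  shows "surj (Poly_Mapping.map \<delta> :: ('c::comm_monoid_add \<Rightarrow>\<^sub>0 'a) \<Rightarrow> _)"
proof -
  interpret map: comm_ring_map "Poly_Mapping.map \<delta> :: ('c \<Rightarrow>\<^sub>0 'a) \<Rightarrow> _" by (rule map_ring_map)
  have "\<exists>f. g = Poly_Mapping.map \<delta> f" for g :: "'c \<Rightarrow>\<^sub>0 'b"
  proof (induction g rule: poly_mapping_single_induct)
    case zero
    show ?case by (rule exI[of _ 0]) simp
  next
    case (add f g)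
    then show ?case using map.add by metis
  next
    case (single k c)
    then show ?case using map_single surjD[OF assms, of c] by metis
  qed
  then show ?thesis unfolding surj_def by blast
qed

lemma substitute_ring_map: "comm_ring_map (substitute \<delta> g)"
proof
  show a: "substitute \<delta> g (p + q) = substitute \<delta> g p + substitute \<delta> g q" for p q
    by (rule substitute_add[OF add])
  show "substitute \<delta> g (p * q) = substitute \<delta> g p * substitute \<delta> g q" for p q
    by (rule mult_of_mult_single[OF a])
      (simp add: mult_single substitute_single mult lookup_add power_add prod.distrib ac_simps)
  show "substitute \<delta> g 1 = 1"
    by (simp add: substitute_single one flip: single_one)
qed

end

section \<open>Constants and monomials\<close>

lemma Const_ring_map: "comm_ring_map (Const :: 'k::comm_ring_1 \<Rightarrow> ('v, 'k) mpolynomial)"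
  by standard (simp_all add: Const_def single_add mult_single)

lemma Const_mult: "Const (c * c') = Const c * (Const c' :: ('v, 'k::comm_ring_1) mpolynomial)"
  by (simp add: Const_def mult_single)

lemma single_eq_Const_mult: "Poly_Mapping.single e c = Const c * Poly_Mapping.single e (1 :: 'k::comm_ring_1)"
  by (simp add: Const_def mult_single)

lemma (in comm_ring_map) map_Const: "Poly_Mapping.map \<delta> (Const c) = Const (\<delta> c)"
  by (simp add: Const_def map_single)

lemma Var_power: "(Var v :: ('v, 'k::comm_ring_1) mpolynomial) ^ n = Poly_Mapping.single (Poly_Mapping.single v n) 1"
  by (induction n) (auto simp: Var_def mult_single simp flip: single_add)

lemma prod_single_one:
  fixes g :: "'i \<Rightarrow> 'a::comm_monoid_add"
  shows "(\<Prod>i\<in>T. Poly_Mapping.single (g i) (1 :: 'k::comm_ring_1)) = Poly_Mapping.single (sum g T) 1"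
  by (induction T rule: infinite_finite_induct) (auto simp: mult_single)

definition exponent :: "('r :: finite \<Rightarrow> nat) \<Rightarrow> nat \<Rightarrow> ('r option \<Rightarrow>\<^sub>0 nat)" where
  "exponent k l = (\<Sum>j\<in>UNIV. Poly_Mapping.single (Some j) (k j)) + Poly_Mapping.single None l"

lemma lookup_exponent [simp]:
  "Poly_Mapping.lookup (exponent k l) (Some j) = k j" "Poly_Mapping.lookup (exponent k l) None = l"
  by (auto simp: exponent_def lookup_add lookup_sum lookup_single when_def sum.delta)

lemma exponent_lookup: "exponent (\<lambda>j. Poly_Mapping.lookup e (Some j)) (Poly_Mapping.lookup e None) = e"
proof (rule poly_mapping_eqI)
  show "Poly_Mapping.lookup (exponent (\<lambda>j. Poly_Mapping.lookup e (Some j)) (Poly_Mapping.lookup e None)) v = Poly_Mapping.lookup e v" for v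
    by (cases v) simp_all
qed

lemma monomial_eq_single:
  "xmonomial k * Var None ^ l = (Poly_Mapping.single (exponent k l) 1 :: ('r :: finite option, 'k::comm_ring_1) mpolynomial)"
  by (simp add: xmonomial_def Var_power prod_single_one mult_single exponent_def)

lemma xmonomial_add: "xmonomial (\<lambda>j. k j + k' j) = xmonomial k * (xmonomial k' :: ('r :: finite option, 'k::comm_ring_1) mpolynomial)"
  by (simp add: xmonomial_def power_add prod.distrib)

text \<open>Normal forms and fibres are known explicitly on terms c x^k u^l. The zero polynomial is
  such a term with c = 0 and so gets no case.\<close>

lemma mpolynomial_induct [case_names add monomial]:
  fixes f :: "('r :: finite option, 'k::comm_ring_1) mpolynomial"
  assumes "\<And>f g. P f \<Longrightarrow> P g \<Longrightarrow> P (f + g)" and mon: "\<And>c k l. P (Const c * (xmonomial k * Var None ^ l))"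
  shows "P f"
proof (induction f rule: poly_mapping_single_induct)
  case zero
  show ?case using mon[of 0] by (simp add: Const_def)
next
  case (single e c)
  show ?case
    using mon[of c "\<lambda>j. Poly_Mapping.lookup e (Some j)" "Poly_Mapping.lookup e None"]
    unfolding monomial_eq_single exponent_lookup by (simp flip: single_eq_Const_mult)
qed (use assms in blast)

lemma (in comm_ring_map) map_monomial:
  "Poly_Mapping.map \<delta> (xmonomial k :: ('r :: finite option, 'a) mpolynomial) = xmonomial k"
  "Poly_Mapping.map \<delta> (Var v :: ('r option, 'a) mpolynomial) = Var v"
proof -
  interpret map: comm_ring_map "Poly_Mapping.map \<delta> :: ('r option, 'a) mpolynomial \<Rightarrow> _" by (rule map_ring_map)
  show v: "Poly_Mapping.map \<delta> (Var v :: ('r option, 'a) mpolynomial) = Var v" for v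
    by (simp add: Var_def map_single one)
  show "Poly_Mapping.map \<delta> (xmonomial k :: ('r option, 'a) mpolynomial) = xmonomial k"
    by (simp add: xmonomial_def map.prod map.power v)
qed

section \<open>The normal form\<close>

lemma mscale_simps:
  "mscale 0 m = 0" "mscale (a + b) m = mscale a m + mscale b m" "mscale 1 m = m"
  "mscale a (m + m') = mscale a m + mscale a m'"
  by (simp_all add: mscale_def vec_eq_iff zero_prod_def distrib_right distrib_left vector_sadd_rdistrib
      vector_add_ldistrib prod_eq_iff)

lemma single_power:
  "(Poly_Mapping.single (- m) (c :: 'k::comm_ring_1)) ^ n = Poly_Mapping.single (- mscale (int n) m) (c ^ n)"
  for m :: "'n::finite ext_dual"
  by (induction n) (auto simp: mult_single mscale_simps algebra_simps simp flip: single_one)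

lemma binomial_single:
  "(1 + Poly_Mapping.single (- m) (c :: 'k::comm_ring_1)) ^ n =
     (\<Sum>a\<le>n. Poly_Mapping.single (- mscale (int a) m) (of_nat (n choose a) * c ^ a))"
  for m :: "'n::finite ext_dual"
proof -
  have "(Poly_Mapping.single (- m) c + 1) ^ n =
      (\<Sum>a\<le>n. of_nat (n choose a) * Poly_Mapping.single (- m) c ^ a)"
    by (simp add: binomial_ring)
  then show ?thesis
    by (simp add: add.commute single_power of_nat_single[symmetric] mult_single flip: single_of_nat)
qed

lemma combination_add: "combination s (\<lambda>j. k j + k' j) = combination s k + combination s k'"
  by (simp add: combination_def mscale_simps sum.distrib)

text \<open>These facts are all that the algebra takes from the convex geometry.
  \<open>defect_shift\<close> is the decisive one: replacing x^k inside x^(k' + k) by a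
  representative of any shift occurring in its equation lowers each defect by exactly the defect of
  \<open>k\<close>. It concerns both polytopes under shifts by both \<open>m1\<close> and
  \<open>m2\<close>, which is where mutual compatibility is felt.\<close>

locale twisted_toric =
  fixes P Q1 Q2 :: "(real ^ 'n) set"
    and m1 m2 :: "'n ext_dual"
    and s :: "'r::finite \<Rightarrow> 'n ext_dual"
    and d :: "'n ext_dual \<Rightarrow> 'r \<Rightarrow> nat"
  assumes representative: "b \<in> dual_semigroup P \<Longrightarrow>
      combination s (d (boundary_part P b)) + mscale (int (height P b)) Rstar = b"
    and height_add_Rstar: "b \<in> dual_semigroup P \<Longrightarrow> height P (b + mscale (int l) Rstar) = height P b + l"
    and boundary_part_add_Rstar: "b \<in> dual_semigroup P \<Longrightarrow> boundary_part P (b + mscale (int l) Rstar) = boundary_part P b"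
    and shift_mem: "a1 \<le> eta_defect Q1 s k \<Longrightarrow> a2 \<le> eta_defect Q2 s k \<Longrightarrow>
      combination s k - mscale (int a1) m1 - mscale (int a2) m2 \<in> dual_semigroup P"
    and defect_shift: "a1 \<le> eta_defect Q1 s k \<Longrightarrow> a2 \<le> eta_defect Q2 s k \<Longrightarrow> Q \<in> {Q1, Q2} \<Longrightarrow>
      eta_defect Q s k + eta_defect Q s (\<lambda>j. k' j + d (boundary_part P (combination s k - mscale (int a1) m1 - mscale (int a2) m2)) j)
        = eta_defect Q s (\<lambda>j. k' j + k j)"
    and generators: "dual_semigroup P = {combination s k + mscale (int l) Rstar | k l. True}"
begin

abbreviation h1 :: "('r \<Rightarrow> nat) \<Rightarrow> nat" where "h1 k \<equiv> eta_defect Q1 s k"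
abbreviation h2 :: "('r \<Rightarrow> nat) \<Rightarrow> nat" where "h2 k \<equiv> eta_defect Q2 s k"

abbreviation shift :: "('r \<Rightarrow> nat) \<Rightarrow> nat \<times> nat \<Rightarrow> 'n ext_dual" where
  "shift k a \<equiv> combination s k - mscale (int (fst a)) m1 - mscale (int (snd a)) m2"

abbreviation range2 :: "('r \<Rightarrow> nat) \<Rightarrow> (nat \<times> nat) set" where
  "range2 k \<equiv> {..h1 k} \<times> {..h2 k}"

abbreviation coef :: "('r \<Rightarrow> nat) \<Rightarrow> nat \<times> nat \<Rightarrow> complex fps fps" where
  "coef k a \<equiv> of_nat (h1 k choose fst a) * of_nat (h2 k choose snd a) * t1 ^ fst a * t2 ^ snd a"

abbreviation equation :: "('r \<Rightarrow> nat) \<Rightarrow> ('r option, complex fps fps) mpolynomial" where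
  "equation \<equiv> two_param_equation P s d m1 Q1 m2 Q2"

definition twist :: "nat \<Rightarrow> nat \<Rightarrow> ('n ext_dual \<Rightarrow>\<^sub>0 complex fps fps)" where
  "twist p q = (1 + Poly_Mapping.single (- m1) t1) ^ p * (1 + Poly_Mapping.single (- m2) t2) ^ q"

definition normal_monomial :: "('r \<Rightarrow> nat) \<Rightarrow> nat \<Rightarrow> ('n ext_dual \<Rightarrow>\<^sub>0 complex fps fps)" where
  "normal_monomial k l = Poly_Mapping.single (combination s k + mscale (int l) Rstar) 1 * twist (h1 k) (h2 k)"

text \<open>The target is the group algebra of the whole group, so that no membership in the semigroup
  has to be checked.\<close>

definition normal_form :: "('r option, complex fps fps) mpolynomial \<Rightarrow> ('n ext_dual \<Rightarrow>\<^sub>0 complex fps fps)" where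
  "normal_form f = (\<Sum>e\<in>Poly_Mapping.keys f. Poly_Mapping.single 0 (Poly_Mapping.lookup f e) *
      normal_monomial (\<lambda>j. Poly_Mapping.lookup e (Some j)) (Poly_Mapping.lookup e None))"

lemma equation_eq: "equation k = xmonomial k - (\<Sum>a\<in>range2 k. Const (coef k a) * chi P d (shift k a))"
  by (simp add: two_param_equation_def case_prod_unfold)

lemma shift_mem': "a \<in> range2 k \<Longrightarrow> shift k a \<in> dual_semigroup P"
  by (rule shift_mem) auto

lemma twist_add: "twist (p + p') (q + q') = twist p q * twist p' q'"
  by (simp add: twist_def power_add ac_simps)

text \<open>The binomial theorem produces precisely the index range and the coefficients of the
  equations: in the group algebra, the character of s_k times the twist is the sum subtracted from
  x^k, with characters in place of \<open>chi\<close>.\<close>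

lemma twist_expand:
  "twist (h1 k) (h2 k) = (\<Sum>a\<in>range2 k. Poly_Mapping.single (shift k a - combination s k) (coef k a))"
  unfolding twist_def binomial_single sum_product sum.cartesian_product
  by (simp add: mult_single case_prod_unfold ac_simps)

lemma normal_monomial_expand:
  "normal_monomial k l = (\<Sum>a\<in>range2 k. Poly_Mapping.single (shift k a + mscale (int l) Rstar) (coef k a))"
  unfolding normal_monomial_def twist_expand sum_distrib_left
  by (simp add: mult_single algebra_simps)

lemma normal_form_add: "normal_form (f + g) = normal_form f + normal_form g"
  unfolding normal_form_def by (rule sum_keys_add) (auto simp: single_add distrib_right)

lemma normal_form_zero: "normal_form 0 = 0"
  by (simp add: normal_form_def)

lemma normal_form_minus: "normal_form (f - g) = normal_form f - normal_form g"
  using normal_form_add[of "f - g" g] by (simp add: algebra_simps)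

lemma normal_form_sum: "normal_form (sum g T) = (\<Sum>i\<in>T. normal_form (g i))"
  by (induction T rule: infinite_finite_induct) (auto simp: normal_form_zero normal_form_add)

lemma normal_form_monomial:
  "normal_form (Const c * (xmonomial k * Var None ^ l)) = Poly_Mapping.single 0 c * normal_monomial k l"
  by (cases "c = 0") (auto simp: monomial_eq_single normal_form_def simp flip: single_eq_Const_mult)

lemma normal_form_Const: "normal_form (Const c * f) = Poly_Mapping.single 0 c * normal_form f"
proof (induction f rule: mpolynomial_induct)
  case (add f g)
  then show ?case by (simp add: normal_form_add distrib_left)
next
  case (monomial c' k l)
  show ?case
    unfolding mult.assoc[symmetric] Const_mult[symmetric]
    unfolding mult.assoc normal_form_monomial by (simp add: mult_single mult.assoc[symmetric])
qed

text \<open>The product is again a constant times a monomial, in whose exponent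
  \<open>d (boundary_part P b)\<close> is added to \<open>k\<close>, and
  \<open>representative\<close> identifies its lattice point. The twist is governed by the defects
  of that sum of exponents, not by those of \<open>k\<close>.\<close>

lemma normal_form_chi:
  assumes "b \<in> dual_semigroup P"
  shows "normal_form (Const c * (xmonomial k * Var None ^ l) * (Const c' * chi P d b)) =
    Poly_Mapping.single (combination s k + mscale (int l) Rstar) c *
      twist (h1 (\<lambda>j. k j + d (boundary_part P b) j)) (h2 (\<lambda>j. k j + d (boundary_part P b) j)) *
      Poly_Mapping.single b c'"
proof -
  let ?k = "\<lambda>j. k j + d (boundary_part P b) j"
  have "Const c * (xmonomial k * Var None ^ l) * (Const c' * chi P d b) =
      (Const (c * c') * (xmonomial ?k * Var None ^ (l + height P b)) :: ('r option, complex fps fps) mpolynomial)"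
    by (simp add: chi_def xmonomial_add power_add Const_mult ac_simps)
  moreover have "combination s ?k + mscale (int (l + height P b)) Rstar =
      combination s k + mscale (int l) Rstar + b"
    using representative[OF assms] by (simp add: combination_add mscale_simps algebra_simps)
  ultimately have "normal_form (Const c * (xmonomial k * Var None ^ l) * (Const c' * chi P d b)) =
      Poly_Mapping.single 0 (c * c') *
        (Poly_Mapping.single (combination s k + mscale (int l) Rstar + b) 1 * twist (h1 ?k) (h2 ?k))"
    by (simp only: normal_form_monomial normal_monomial_def)
  also have "\<dots> = Poly_Mapping.single (combination s k + mscale (int l) Rstar + b) (c * c') * twist (h1 ?k) (h2 ?k)"
    by (simp add: mult_single flip: mult.assoc)
  also have "\<dots> = (Poly_Mapping.single (combination s k + mscale (int l) Rstar) c * Poly_Mapping.single b c') * twist (h1 ?k) (h2 ?k)"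
    by (simp only: mult_single)
  finally show ?thesis by (simp only: ac_simps)
qed

text \<open>Multiples of an equation have to be treated because the normal form need not be
  multiplicative. All subtracted terms, multiplied by x^k' u^l, carry the same twist, with exponents
  the defects of k' + k minus those of k. Once it is factored out, the remaining sum is the
  character of s_k with the twist of k, and the two twists combine to the one that belongs to x^(k'
  + k).\<close>

lemma normal_form_equation:
  "normal_form (Const c * (xmonomial k' * Var None ^ l) * equation k) = 0"
proof -
  let ?x = "Poly_Mapping.single (combination s k' + mscale (int l) Rstar) c"
  let ?k = "\<lambda>j. k' j + k j"
  let ?p = "h1 ?k - h1 k" and ?q = "h2 ?k - h2 k"
  have defects: "h1 (\<lambda>j. k' j + d (boundary_part P (shift k a)) j) = ?p"
      "h2 (\<lambda>j. k' j + d (boundary_part P (shift k a)) j) = ?q" if "a \<in> range2 k" for a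
    using defect_shift[of "fst a" k "snd a" Q1 k'] defect_shift[of "fst a" k "snd a" Q2 k'] that
    by auto
  \<comment> \<open>The case a1 = a2 = 0 of \<open>defect_shift\<close> shows that the truncated
    differences \<open>?p\<close> and \<open>?q\<close> are true ones.\<close>
  have le: "h1 k \<le> h1 ?k" "h2 k \<le> h2 ?k"
    using defect_shift[of 0 k 0 Q1 k'] defect_shift[of 0 k 0 Q2 k'] by auto
  have summand: "normal_form (Const c * (xmonomial k' * Var None ^ l) * (Const (coef k a) * chi P d (shift k a))) =
     ?x * twist ?p ?q * Poly_Mapping.single (shift k a) (coef k a)" if a: "a \<in> range2 k" for a
    by (simp only: normal_form_chi[OF shift_mem'[OF a]] defects[OF a])
  have "(\<Sum>a\<in>range2 k. normal_form (Const c * (xmonomial k' * Var None ^ l) * (Const (coef k a) * chi P d (shift k a)))) =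
      ?x * twist ?p ?q * (\<Sum>a\<in>range2 k. Poly_Mapping.single (shift k a) (coef k a))"
    unfolding sum_distrib_left by (rule sum.cong[OF refl summand])
  also have "(\<Sum>a\<in>range2 k. Poly_Mapping.single (shift k a) (coef k a)) =
      Poly_Mapping.single (combination s k) 1 * twist (h1 k) (h2 k)"
    using normal_monomial_expand[of k 0] by (simp add: normal_monomial_def mscale_simps)
  also have "?x * twist ?p ?q * (Poly_Mapping.single (combination s k) 1 * twist (h1 k) (h2 k)) =
      Poly_Mapping.single 0 c * (Poly_Mapping.single (combination s ?k + mscale (int l) Rstar) 1 * twist (h1 ?k) (h2 ?k))"
  proof -
    have "twist ?p ?q * twist (h1 k) (h2 k) = twist (h1 ?k) (h2 ?k)"
      unfolding twist_add[symmetric] using le by simp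
    moreover have "?x * Poly_Mapping.single (combination s k) 1 =
        Poly_Mapping.single 0 c * Poly_Mapping.single (combination s ?k + mscale (int l) Rstar) 1"
      by (simp add: mult_single combination_add ac_simps)
    moreover have "?x * twist ?p ?q * (Poly_Mapping.single (combination s k) 1 * twist (h1 k) (h2 k)) =
        (?x * Poly_Mapping.single (combination s k) 1) * (twist ?p ?q * twist (h1 k) (h2 k))"
      by (simp only: ac_simps)
    ultimately show ?thesis by (simp only: mult.assoc)
  qed
  also have "\<dots> = normal_form (Const c * (xmonomial k' * Var None ^ l) * xmonomial k)"
  proof -
    have "Const c * (xmonomial k' * Var None ^ l) * xmonomial k =
        (Const c * (xmonomial ?k * Var None ^ l) :: ('r option, complex fps fps) mpolynomial)"
      by (simp add: xmonomial_add ac_simps)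
    then show ?thesis by (simp add: normal_form_monomial normal_monomial_def)
  qed
  finally have "(\<Sum>a\<in>range2 k. normal_form (Const c * (xmonomial k' * Var None ^ l) * (Const (coef k a) * chi P d (shift k a)))) =
      normal_form (Const c * (xmonomial k' * Var None ^ l) * xmonomial k)" .
  then show ?thesis
    unfolding equation_eq right_diff_distrib sum_distrib_left normal_form_minus normal_form_sum
    by (rule eq_iff_diff_eq_0[THEN iffD1, OF sym])
qed

lemma normal_form_mult_equation: "normal_form (g * equation k) = 0"
  by (induction g rule: mpolynomial_induct) (simp_all add: distrib_right normal_form_add normal_form_equation)

definition expansion :: "('n ext_dual \<Rightarrow>\<^sub>0 complex fps fps) \<Rightarrow> ('r option, complex fps fps) mpolynomial" where
  "expansion w = (\<Sum>x\<in>Poly_Mapping.keys w. Const (Poly_Mapping.lookup w x) * chi P d x)"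

interpretation Const: comm_ring_map "Const :: complex fps fps \<Rightarrow> ('r option, complex fps fps) mpolynomial"
  by (rule Const_ring_map)

lemma expansion_add: "expansion (v + w) = expansion v + expansion w"
  unfolding expansion_def by (rule sum_keys_add) (simp_all add: Const.add distrib_right)

lemma expansion_single: "expansion (Poly_Mapping.single x c) = Const c * chi P d x"
  by (cases "c = 0") (simp_all add: expansion_def)

lemma expansion_zero: "expansion 0 = 0"
  by (simp add: expansion_def)

lemma expansion_sum: "expansion (sum g T) = (\<Sum>i\<in>T. expansion (g i))"
  by (induction T rule: infinite_finite_induct) (auto simp: expansion_zero expansion_add)

lemma expansion_Const: "expansion (Poly_Mapping.single 0 c * w) = Const c * expansion w"
proof (induction w rule: poly_mapping_single_induct)
  case zero
  then show ?case by (simp add: expansion_zero)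
next
  case (add f g)
  then show ?case by (simp add: expansion_add distrib_left)
next
  case (single k x)
  then show ?case by (simp add: mult_single expansion_single Const.mult mult.assoc)
qed

abbreviation relations :: "('r option, complex fps fps) mpolynomial set" where
  "relations \<equiv> genideal ring_of_type_algebra (range equation)"

lemma chi_add_Rstar:
  assumes "b \<in> dual_semigroup P"
  shows "(chi P d (b + mscale (int l) Rstar) :: ('r option, complex fps fps) mpolynomial) = chi P d b * Var None ^ l"
  by (simp add: chi_def height_add_Rstar[OF assms] boundary_part_add_Rstar[OF assms] power_add mult.assoc)

text \<open>For c x^k u^l the difference is c u^l times the equation with index \<open>k\<close>,
  because the factor u^l only raises heights. One rewriting step reaches the normal form, so no
  termination argument arises.\<close>

lemma normal_form_congruent: "f - expansion (normal_form f) \<in> relations"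
proof (induction f rule: mpolynomial_induct)
  case (add f g)
  have "f + g - expansion (normal_form (f + g)) = (f - expansion (normal_form f)) + (g - expansion (normal_form g))"
    by (simp add: normal_form_add expansion_add algebra_simps)
  then show ?case using add type_idealD(2)[OF ideal_type_genideal] by metis
next
  case (monomial c k l)
  have "expansion (normal_monomial k l) = (\<Sum>a\<in>range2 k. Const (coef k a) * chi P d (shift k a)) * Var None ^ l"
    unfolding normal_monomial_expand expansion_sum expansion_single sum_distrib_right
    by (rule sum.cong[OF refl]) (simp only: chi_add_Rstar[OF shift_mem'] mult.assoc)
  then have "Const c * (xmonomial k * Var None ^ l) - expansion (normal_form (Const c * (xmonomial k * Var None ^ l))) =
      Const c * Var None ^ l * equation k"
    by (simp only: normal_form_monomial expansion_Const equation_eq) (simp only: algebra_simps)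
  then show ?case
    using type_idealD(3)[OF ideal_type_genideal type_genideal_self[OF rangeI]] by metis
qed

text \<open>The polynomials whose normal form has coefficients in \<open>J\<close> are not visibly
  an ideal. \<open>?K\<close> therefore builds stability under all multipliers \<open>g\<close> into
  its definition; the vanishing on every multiple of an equation places the generators in it, and
  \<open>g = 1\<close> gives the claim.\<close>

lemma normal_form_ideal:
  assumes J: "ideal J (ring_of_type_algebra :: complex fps fps ring)"
    and f: "f \<in> genideal ring_of_type_algebra (Const ` J \<union> range equation)"
  shows "Poly_Mapping.lookup (normal_form f) x \<in> J"
proof -
  let ?K = "{f. \<forall>g x. Poly_Mapping.lookup (normal_form (g * f)) x \<in> J}"
  have "ideal ?K ring_of_type_algebra"
  proof (rule type_idealI)
    show "0 \<in> ?K" by (simp add: normal_form_zero type_idealD(1)[OF J])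
    show "v + w \<in> ?K" if "v \<in> ?K" "w \<in> ?K" for v w
      using that by (simp add: distrib_left normal_form_add lookup_add type_idealD(2)[OF J])
    show "r * v \<in> ?K" if "v \<in> ?K" for r v
      using that by (simp flip: mult.assoc)
  qed
  moreover have "Const c \<in> ?K" if "c \<in> J" for c
  proof -
    have "Poly_Mapping.lookup (normal_form (g * Const c)) x \<in> J" for g x
    proof -
      have "Poly_Mapping.lookup (normal_form (g * Const c)) x = Poly_Mapping.lookup (normal_form g) x * c"
        unfolding mult.commute[of g] normal_form_Const
        by (simp add: mult_map_scale_conv_mult[symmetric] Poly_Mapping.map.rep_eq when_def mult.commute)
      then show ?thesis using type_idealD(3)[OF J that] by simp
    qed
    then show ?thesis by blast
  qed
  moreover have "equation k \<in> ?K" for k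
    by (simp add: normal_form_mult_equation type_idealD(1)[OF J])
  ultimately have "genideal ring_of_type_algebra (Const ` J \<union> range equation) \<subseteq> ?K"
    by (intro type_genideal_minimal) auto
  then have "Poly_Mapping.lookup (normal_form (1 * f)) x \<in> J" using f by blast
  then show ?thesis by simp
qed

text \<open>For an ideal \<open>J\<close> this is the converse of \<open>normal_form_ideal\<close>.
  With the maximal ideal for \<open>J\<close> it computes the kernel of the map to the special
  fibre.\<close>

lemma expansion_mem:
  assumes "\<And>x. Poly_Mapping.lookup (normal_form f) x \<in> J"
  shows "f \<in> genideal ring_of_type_algebra (Const ` J \<union> range equation)" (is "f \<in> ?I")
proof -
  have "expansion (normal_form f) \<in> ?I"
    unfolding expansion_def
  proof (rule type_ideal_sum[OF ideal_type_genideal])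
    fix x
    have "Const (Poly_Mapping.lookup (normal_form f) x) \<in> ?I"
      using assms by (intro type_genideal_self) simp
    from type_idealD(3)[OF ideal_type_genideal this, of "chi P d x"]
    show "Const (Poly_Mapping.lookup (normal_form f) x) * chi P d x \<in> ?I"
      by (simp only: mult.commute)
  qed
  moreover have "f - expansion (normal_form f) \<in> ?I"
    using normal_form_congruent type_genideal_mono[of "range equation" "Const ` J \<union> range equation"] by blast
  ultimately have "(f - expansion (normal_form f)) + expansion (normal_form f) \<in> ?I"
    using type_idealD(2)[OF ideal_type_genideal] by blast
  then show ?thesis by simp
qed

end

section \<open>Base change of families\<close>

text \<open>Meant for the coordinates on a level: they are additive but need not be ring
  homomorphisms, so constancy on cosets is assumed directly.\<close>

lemma (in ideal) induced_coset_of_invariant: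
  assumes "\<And>i x. i \<in> I \<Longrightarrow> x \<in> carrier R \<Longrightarrow> h (i \<oplus> x) = h x" and x: "x \<in> carrier R"
  shows "induced h (I +> x) = h x"
proof -
  have "h y = h x" if y: "y \<in> I +> x" for y
    using y assms by (auto simp: a_r_coset_def')
  moreover have "x \<in> I +> x" using x by (rule a_rcos_self)
  ultimately have "h ` (I +> x) = {h x}" by blast
  then show ?thesis by (simp add: induced_def)
qed

lemma ideal_ideal_power:
  fixes J :: "'a::comm_ring_1 set"
  assumes "ideal J ring_of_type_algebra"
  shows "ideal (ideal_power ring_of_type_algebra J n) ring_of_type_algebra"
proof (induction n)
  case 0
  show ?case unfolding ideal_power.simps by (rule ring.oneideal[OF ring_from_type_algebra])
next
  case (Suc n)
  show ?case
    unfolding ideal_power.simps by (rule ring.ideal_prod_is_ideal[OF ring_from_type_algebra assms Suc])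
qed

lemma ideal_power_Suc_subset:
  fixes J :: "'a::comm_ring_1 set"
  assumes "ideal J ring_of_type_algebra"
  shows "ideal_power ring_of_type_algebra J (Suc n) \<subseteq> J"
    and "ideal_power ring_of_type_algebra J (Suc n) \<subseteq> ideal_power ring_of_type_algebra J n"
  using ring.ideal_prod_inter[OF ring_from_type_algebra assms ideal_ideal_power[OF assms, of n]] by auto

lemma (in comm_ring_map) ideal_power_image:
  assumes "\<delta> ` J \<subseteq> J'"
  shows "\<delta> ` ideal_power ring_of_type_algebra J n \<subseteq> ideal_power ring_of_type_algebra J' n"
proof (induction n)
  case 0
  show ?case by simp
next
  case (Suc n)
  have "\<delta> x \<in> ideal_prod ring_of_type_algebra J' (ideal_power ring_of_type_algebra J' n)"
    if "x \<in> ideal_prod ring_of_type_algebra J (ideal_power ring_of_type_algebra J n)" for x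
    using that
  proof (induction x rule: ideal_prod.induct)
    case (prod i j)
    then have "\<delta> i \<in> J'" "\<delta> j \<in> ideal_power ring_of_type_algebra J' n"
      using assms Suc by blast+
    from ideal_prod.prod[OF this, of ring_of_type_algebra] show ?case by (simp add: mult)
  next
    case (sum x y)
    from ideal_prod.sum[OF sum(3,4)] show ?case by (simp add: add)
  qed
  then show ?case by auto
qed

lemma (in comm_ring_map) a_kernel_eq: "a_kernel ring_of_type_algebra ring_of_type_algebra \<delta> = {x. \<delta> x = 0}"
  by (simp add: a_kernel_def')

lemma (in comm_ring_map) ideal_max_ideal:
  "ideal (a_kernel ring_of_type_algebra ring_of_type_algebra \<delta>) ring_of_type_algebra"
  unfolding a_kernel_eq by (rule type_idealI) (simp_all add: add mult)

text \<open>Surjectivity lifts the multipliers, which makes the image of an ideal an ideal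
  again.\<close>

lemma (in comm_ring_map) image_genideal:
  assumes "surj \<delta>"
  shows "genideal ring_of_type_algebra (\<delta> ` S) \<subseteq> \<delta> ` genideal ring_of_type_algebra S"
proof (rule type_genideal_minimal)
  let ?J = "genideal ring_of_type_algebra S"
  show "ideal (\<delta> ` ?J) ring_of_type_algebra"
  proof (rule type_idealI)
    have "\<delta> 0 \<in> \<delta> ` ?J" by (rule imageI) (rule type_idealD(1)[OF ideal_type_genideal])
    then show "0 \<in> \<delta> ` ?J" by simp
    show "x + y \<in> \<delta> ` ?J" if x: "x \<in> \<delta> ` ?J" and y: "y \<in> \<delta> ` ?J" for x y
    proof -
      obtain x' where x': "x' \<in> ?J" "x = \<delta> x'" using x by blast
      obtain y' where y': "y' \<in> ?J" "y = \<delta> y'" using y by blast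
      show ?thesis
        unfolding x'(2) y'(2) add[symmetric] by (rule imageI[OF type_idealD(2)[OF ideal_type_genideal x'(1) y'(1)]])
    qed
    show "r * x \<in> \<delta> ` ?J" if x: "x \<in> \<delta> ` ?J" for r x
    proof -
      obtain x' where x': "x' \<in> ?J" "x = \<delta> x'" using x by blast
      obtain r' where r': "r = \<delta> r'" using assms by (rule surjE)
      show ?thesis
        unfolding x'(2) r' mult[symmetric] by (rule imageI[OF type_idealD(3)[OF ideal_type_genideal x'(1)]])
    qed
  qed
  show "\<delta> ` S \<subseteq> \<delta> ` ?J" by (auto intro: type_genideal_self)
qed

lemma (in comm_ring_map) genideal_image:
  "\<delta> ` genideal ring_of_type_algebra S \<subseteq> genideal ring_of_type_algebra (\<delta> ` S)"
proof -
  let ?J = "genideal ring_of_type_algebra (\<delta> ` S)"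
  have "genideal ring_of_type_algebra S \<subseteq> {x. \<delta> x \<in> ?J}"
  proof (rule type_genideal_minimal)
    show "ideal {x. \<delta> x \<in> ?J} ring_of_type_algebra"
      by (rule type_idealI) (simp_all add: add mult type_idealD[OF ideal_type_genideal])
    show "S \<subseteq> {x. \<delta> x \<in> ?J}" by (auto intro: type_genideal_self)
  qed
  then show ?thesis by blast
qed

lemma Const_coefficients_mem:
  fixes f :: "('v, 'k::comm_ring_1) mpolynomial"
  assumes "\<And>e. Poly_Mapping.lookup f e \<in> C"
  shows "f \<in> genideal ring_of_type_algebra (Const ` C)"
proof -
  have "(\<Sum>e\<in>Poly_Mapping.keys f. Poly_Mapping.single e (Poly_Mapping.lookup f e))
      \<in> genideal ring_of_type_algebra (Const ` C)"
  proof (rule type_ideal_sum[OF ideal_type_genideal])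
    fix e
    have "Const (Poly_Mapping.lookup f e) \<in> genideal ring_of_type_algebra (Const ` C)"
      using assms by (intro type_genideal_self imageI)
    from type_idealD(3)[OF ideal_type_genideal this, of "Poly_Mapping.single e 1"]
    show "Poly_Mapping.single e (Poly_Mapping.lookup f e) \<in> genideal ring_of_type_algebra (Const ` C)"
      by (simp add: Const_def mult_single)
  qed
  then show ?thesis by (simp only: poly_mapping_sum_single[symmetric])
qed

lemma ideal_coset_zero_iff:
  fixes J :: "'a::comm_ring_1 set"
  assumes "ideal J ring_of_type_algebra"
  shows "J +>\<^bsub>ring_of_type_algebra\<^esub> x = J \<longleftrightarrow> x \<in> J"
  by (rule ideal.coset_zero_iff[OF assms]) simp

lemma ideal_coset_eq_iff:
  fixes J :: "'a::comm_ring_1 set"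
  assumes "ideal J ring_of_type_algebra"
  shows "J +>\<^bsub>ring_of_type_algebra\<^esub> x = J +>\<^bsub>ring_of_type_algebra\<^esub> y \<longleftrightarrow> x - y \<in> J"
  using ideal.coset_eq_iff[OF assms, of x y] by simp

lemma ideal_coset_image:
  fixes J :: "'a::comm_ring_1 set"
  assumes "ideal J ring_of_type_algebra" "surj h"
  shows "range (\<lambda>x. J +>\<^bsub>ring_of_type_algebra\<^esub> h x) = carrier (ring_of_type_algebra Quot J)"
proof -
  have "range (\<lambda>x. J +>\<^bsub>ring_of_type_algebra\<^esub> h x) = (\<lambda>x. J +>\<^bsub>ring_of_type_algebra\<^esub> x) ` range h"
    by (simp only: image_image)
  then show ?thesis by (simp only: assms(2) ideal.carrier_quot[OF assms(1)] type_ring_simps)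
qed

lemma ideal_coset_kills:
  fixes J :: "'a::comm_ring_1 set"
  assumes J: "ideal J ring_of_type_algebra" and "h ` S \<subseteq> J"
  shows "(\<lambda>x. J +>\<^bsub>ring_of_type_algebra\<^esub> h x) ` S \<subseteq> {\<zero>\<^bsub>ring_of_type_algebra Quot J\<^esub>}"
proof (rule image_subsetI)
  fix x assume "x \<in> S"
  then have "h x \<in> J" using assms(2) by blast
  then show "J +>\<^bsub>ring_of_type_algebra\<^esub> h x \<in> {\<zero>\<^bsub>ring_of_type_algebra Quot J\<^esub>}"
    by (simp only: ideal.quot_zero[OF J] ideal_coset_zero_iff[OF J] singleton_iff)
qed

lemma (in comm_ring_map) coset_ring_hom:
  assumes "ideal J ring_of_type_algebra"
  shows "(\<lambda>x. J +>\<^bsub>ring_of_type_algebra\<^esub> \<delta> x) \<in> ring_hom ring_of_type_algebra (ring_of_type_algebra Quot J)"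
  by (rule ideal.to_quot_ring_hom[OF assms ring_hom])

text \<open>One statement for two uses: the transition maps, where \<open>\<delta>\<close> is the
  identity, and the restriction to an axis, where \<open>\<delta>\<close> sets a parameter to zero.
  The content is the kernel: a polynomial whose image lies in \<open>I' J'\<close> comes from
  \<open>I J\<close> and the constants that \<open>\<delta>\<close> sends into
  \<open>J'\<close>.\<close>

lemma (in comm_ring_map) base_change_family:
  fixes F :: "('v, 'a) mpolynomial set"
  defines "I \<equiv> \<lambda>J. genideal mpoly_ring (Const ` J \<union> F)"
    and "I' \<equiv> \<lambda>J'. genideal mpoly_ring (Const ` J' \<union> Poly_Mapping.map \<delta> ` F)"
  assumes surj: "surj \<delta>" and J: "ideal J ring_of_type_algebra" and J': "ideal J' ring_of_type_algebra"
    and JJ': "\<delta> ` J \<subseteq> J'"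
  shows "base_change (ring_of_type_algebra Quot J) (ring_of_type_algebra Quot J')
      (induced (\<lambda>b. J' +>\<^bsub>ring_of_type_algebra\<^esub> \<delta> b))
      (mpoly_ring Quot I J) (induced (\<lambda>b. I J +>\<^bsub>mpoly_ring\<^esub> Const b))
      (mpoly_ring Quot I' J') (induced (\<lambda>b. I' J' +>\<^bsub>mpoly_ring\<^esub> Const b))
      (induced (\<lambda>f. I' J' +>\<^bsub>mpoly_ring\<^esub> Poly_Mapping.map \<delta> f))"
proof -
  interpret map: comm_ring_map "Poly_Mapping.map \<delta> :: ('v, 'a) mpolynomial \<Rightarrow> _" by (rule map_ring_map)
  interpret Const: comm_ring_map "Const :: 'a \<Rightarrow> ('v, 'a) mpolynomial" by (rule Const_ring_map)
  interpret Const': comm_ring_map "Const :: 'b \<Rightarrow> ('v, 'b) mpolynomial" by (rule Const_ring_map)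
  have II: "ideal (I J) ring_of_type_algebra" and II': "ideal (I' J') ring_of_type_algebra"
    unfolding I_def I'_def mpoly_ring_def by (rule ideal_type_genideal)+
  have ConstJ: "Const b \<in> I J" if "b \<in> J" for b
    using that unfolding I_def mpoly_ring_def by (intro type_genideal_self) simp
  have ConstJ': "Const b \<in> I' J'" if "b \<in> J'" for b
    using that unfolding I'_def mpoly_ring_def by (intro type_genideal_self) simp
  have kernel: "a_kernel ring_of_type_algebra (ring_of_type_algebra Quot J') (\<lambda>b. J' +>\<^bsub>ring_of_type_algebra\<^esub> \<delta> b)
      = {b. \<delta> b \<in> J'}"
    by (simp add: a_kernel_def' ideal.quot_zero[OF J'] ideal_coset_zero_iff[OF J'])
  have kills: "(\<lambda>b. I' J' +>\<^bsub>ring_of_type_algebra\<^esub> Const b) ` J' \<subseteq> {\<zero>\<^bsub>ring_of_type_algebra Quot I' J'\<^esub>}"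
    using ConstJ' by (intro ideal_coset_kills[OF II'] image_subsetI)
  show ?thesis
    unfolding mpoly_ring_def
  proof (rule base_change_quot)
    show "cring (ring_of_type_algebra :: 'a ring)" "cring (ring_of_type_algebra :: ('v, 'a) mpolynomial ring)"
      by (rule cring_from_type_algebra)+
    show "ring (ring_of_type_algebra Quot J')" "ring (ring_of_type_algebra Quot I' J')"
      using ideal.quotient_is_ring[OF J'] ideal.quotient_is_ring[OF II'] by simp_all
    show "ideal J ring_of_type_algebra" "ideal (I J) ring_of_type_algebra" by fact+
    show "Const \<in> ring_hom ring_of_type_algebra (ring_of_type_algebra :: ('v, 'a) mpolynomial ring)"
      by (rule Const.ring_hom)
    show "Const ` J \<subseteq> I J" using ConstJ by blast
    show "(\<lambda>b. J' +>\<^bsub>ring_of_type_algebra\<^esub> \<delta> b) \<in> ring_hom ring_of_type_algebra (ring_of_type_algebra Quot J')"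
      by (rule coset_ring_hom[OF J'])
    show "(\<lambda>b. J' +>\<^bsub>ring_of_type_algebra\<^esub> \<delta> b) ` carrier ring_of_type_algebra = carrier (ring_of_type_algebra Quot J')"
      unfolding type_ring_simps by (rule ideal_coset_image[OF J' surj])
    show "(\<lambda>b. J' +>\<^bsub>ring_of_type_algebra\<^esub> \<delta> b) ` J \<subseteq> {\<zero>\<^bsub>ring_of_type_algebra Quot J'\<^esub>}"
      by (rule ideal_coset_kills[OF J' JJ'])
    show "induced (\<lambda>b. I' J' +>\<^bsub>ring_of_type_algebra\<^esub> Const b)
        \<in> ring_hom (ring_of_type_algebra Quot J') (ring_of_type_algebra Quot I' J')"
      by (rule ideal.induced_ring_hom[OF J' Const'.coset_ring_hom[OF II'] ideal.quotient_is_ring[OF II'] kills])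
    show "(\<lambda>f. I' J' +>\<^bsub>ring_of_type_algebra\<^esub> Poly_Mapping.map \<delta> f) \<in> ring_hom ring_of_type_algebra (ring_of_type_algebra Quot I' J')"
      by (rule map.coset_ring_hom[OF II'])
    show "(\<lambda>f. I' J' +>\<^bsub>ring_of_type_algebra\<^esub> Poly_Mapping.map \<delta> f) ` carrier ring_of_type_algebra = carrier (ring_of_type_algebra Quot I' J')"
      unfolding type_ring_simps by (rule ideal_coset_image[OF II' surj_map[OF surj]])
    have "Poly_Mapping.map \<delta> ` I J \<subseteq> I' J'"
    proof -
      have "Poly_Mapping.map \<delta> ` (Const ` J \<union> F) \<subseteq> Const ` J' \<union> Poly_Mapping.map \<delta> ` F"
        using JJ' by (auto simp: map_Const)
      from type_genideal_mono[OF this] map.genideal_image[of "Const ` J \<union> F"] show ?thesis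
        unfolding I_def I'_def mpoly_ring_def by blast
    qed
    then show "(\<lambda>f. I' J' +>\<^bsub>ring_of_type_algebra\<^esub> Poly_Mapping.map \<delta> f) ` I J \<subseteq> {\<zero>\<^bsub>ring_of_type_algebra Quot I' J'\<^esub>}"
      by (rule ideal_coset_kills[OF II'])
    show "I' J' +>\<^bsub>ring_of_type_algebra\<^esub> Poly_Mapping.map \<delta> (Const b) =
        induced (\<lambda>b. I' J' +>\<^bsub>ring_of_type_algebra\<^esub> Const b) (J' +>\<^bsub>ring_of_type_algebra\<^esub> \<delta> b)" for b
      unfolding map_Const
      by (rule ideal.induced_coset[OF J' Const'.coset_ring_hom[OF II'] ideal.quotient_is_ring[OF II'] kills, symmetric])
        simp
  next
    fix f assume "I' J' +>\<^bsub>ring_of_type_algebra\<^esub> Poly_Mapping.map \<delta> f = \<zero>\<^bsub>ring_of_type_algebra Quot I' J'\<^esub>"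
    then have "Poly_Mapping.map \<delta> f \<in> I' J'"
      by (simp only: ideal.quot_zero[OF II'] ideal_coset_zero_iff[OF II'])
    let ?S = "I J \<union> Const ` {b. \<delta> b \<in> J'}"
    let ?L = "genideal ring_of_type_algebra ?S"
    \<comment> \<open>By surjectivity of \<open>\<delta>\<close> every generator of
      \<open>I' J'\<close> is the image of an element of \<open>?S\<close>, so elements of the ideal
      \<open>I' J'\<close> lift to \<open>?L\<close>.\<close>
    have "Const ` J' \<union> Poly_Mapping.map \<delta> ` F \<subseteq> Poly_Mapping.map \<delta> ` ?S"
    proof (rule Un_least)
      show "Const ` J' \<subseteq> Poly_Mapping.map \<delta> ` ?S"
      proof
        fix x :: "('v, 'b) mpolynomial" assume "x \<in> Const ` J'"
        then obtain b where b: "b \<in> J'" "x = Const b" by blast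
        obtain b' where "b = \<delta> b'" using surj by (rule surjE)
        then have "x = Poly_Mapping.map \<delta> (Const b')" "b' \<in> {b. \<delta> b \<in> J'}" using b by (simp_all add: map_Const)
        then show "x \<in> Poly_Mapping.map \<delta> ` ?S" by blast
      qed
      have "F \<subseteq> I J" unfolding I_def mpoly_ring_def by (auto intro: type_genideal_self)
      then show "Poly_Mapping.map \<delta> ` F \<subseteq> Poly_Mapping.map \<delta> ` ?S" by blast
    qed
    from type_genideal_mono[OF this] have "I' J' \<subseteq> Poly_Mapping.map \<delta> ` ?L"
      using map.image_genideal[OF surj_map[OF surj], of ?S] unfolding I'_def mpoly_ring_def by blast
    \<comment> \<open>The lift \<open>g\<close> need not be \<open>f\<close>, but
      \<open>f - g\<close> has coefficients in the kernel of \<open>\<delta>\<close>, and 0 \<in>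
      \<open>J'\<close> puts these among the constants in \<open>?S\<close>.\<close>
    then obtain g where g: "g \<in> ?L" "Poly_Mapping.map \<delta> f = Poly_Mapping.map \<delta> g"
      using \<open>Poly_Mapping.map \<delta> f \<in> I' J'\<close> by blast
    have "\<delta> (Poly_Mapping.lookup (f - g) e) = 0" for e
    proof -
      have "Poly_Mapping.map \<delta> (f - g) = 0" using g(2) by (simp add: map.minus)
      then show ?thesis by (metis lookup_map lookup_zero)
    qed
    then have "f - g \<in> genideal ring_of_type_algebra (Const ` {b. \<delta> b \<in> J'})"
      using type_idealD(1)[OF J'] by (intro Const_coefficients_mem) simp
    then have "f - g \<in> ?L" using type_genideal_mono[of "Const ` {b. \<delta> b \<in> J'}" ?S] by blast
    from type_idealD(2)[OF ideal_type_genideal this g(1)] have "f \<in> ?L" by simp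
    then show "f \<in> genideal ring_of_type_algebra
        (I J \<union> Const ` a_kernel ring_of_type_algebra (ring_of_type_algebra Quot J') (\<lambda>b. J' +>\<^bsub>ring_of_type_algebra\<^esub> \<delta> b))"
      unfolding kernel .
  qed
qed

section \<open>The special fibre\<close>

lemma residue2_ring_map: "comm_ring_map residue2"
  by standard (simp_all add: residue2_def fps_mult_nth_0)

lemma residue1_ring_map: "comm_ring_map residue1"
  by standard (simp_all add: residue1_def fps_mult_nth_0)

lemma set_t2_zero_ring_map: "comm_ring_map set_t2_zero"
  by standard (simp_all add: set_t2_zero_def fps_mult_nth_0)

lemma set_t1_zero_ring_map: "comm_ring_map set_t1_zero"
  by standard (auto simp: set_t1_zero_def fps_eq_iff fps_mult_nth fps_sum_nth)

lemma toric_const_ring_map: "comm_ring_map toric_const"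
  by standard (simp_all add: toric_const_def single_add mult_single)

lemma residue2_t: "residue2 t1 = 0" "residue2 t2 = 0"
  by (simp_all add: residue2_def t1_def t2_def)

lemma surj_residue2: "surj residue2"
  by (rule surjI[of _ "\<lambda>c. fps_const (fps_const c)"]) (simp add: residue2_def)

lemma surj_set_t2_zero: "surj set_t2_zero"
  by (rule surjI[of _ fps_const]) (simp add: set_t2_zero_def)

lemma surj_set_t1_zero: "surj set_t1_zero"
  by (rule surjI[of _ "\<lambda>f. Abs_fps (\<lambda>i. fps_const (fps_nth f i))"]) (simp add: set_t1_zero_def fps_eq_iff)

lemma ring_semigroup_algebra:
  fixes S :: "'m::comm_monoid_add set"
  assumes "0 \<in> S" "\<And>x y. x \<in> S \<Longrightarrow> y \<in> S \<Longrightarrow> x + y \<in> S"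
  shows "ring (semigroup_algebra S)"
proof -
  have "subring {f :: 'm \<Rightarrow>\<^sub>0 complex. Poly_Mapping.keys f \<subseteq> S} ring_of_type_algebra"
  proof (rule ring.subringI[OF ring_from_type_algebra])
    fix f :: "'m \<Rightarrow>\<^sub>0 complex" assume f: "f \<in> {f. Poly_Mapping.keys f \<subseteq> S}"
    then show "\<ominus>\<^bsub>ring_of_type_algebra\<^esub> f \<in> {f. Poly_Mapping.keys f \<subseteq> S}"
      by (auto simp: in_keys_iff)
    fix g :: "'m \<Rightarrow>\<^sub>0 complex" assume g: "g \<in> {f. Poly_Mapping.keys f \<subseteq> S}"
    show "f \<otimes>\<^bsub>ring_of_type_algebra\<^esub> g \<in> {f. Poly_Mapping.keys f \<subseteq> S}"
      using keys_mult[of f g] f g assms(2) by fastforce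
    show "f \<oplus>\<^bsub>ring_of_type_algebra\<^esub> g \<in> {f. Poly_Mapping.keys f \<subseteq> S}"
      using keys_add[of f g] f g by auto
  qed (use assms(1) in auto)
  then show ?thesis
    unfolding semigroup_algebra_def by (rule ring.subring_is_ring[OF ring_from_type_algebra])
qed

lemma module_module_along:
  assumes B: "cring B" and A: "cring A" and \<phi>: "\<phi> \<in> ring_hom B A"
  shows "Module.module B (module_along \<phi> A)"
proof -
  interpret A: cring A by fact
  show ?thesis
  proof (rule moduleI)
    show "cring B" by fact
    show "abelian_group (module_along \<phi> A)"
    proof (rule abelian_groupI)
      fix x assume "x \<in> carrier (module_along \<phi> A)"
      then show "\<exists>y\<in>carrier (module_along \<phi> A). y \<oplus>\<^bsub>module_along \<phi> A\<^esub> x = \<zero>\<^bsub>module_along \<phi> A\<^esub>"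
        by (intro bexI[of _ "\<ominus>\<^bsub>A\<^esub> x"]) (simp_all add: module_along_def A.l_neg)
    qed (simp_all add: module_along_def A.a_ac)
  qed (use ring_hom_closed[OF \<phi>] ring_hom_add[OF \<phi>] ring_hom_mult[OF \<phi>] ring_hom_one[OF \<phi>] in
      \<open>simp_all add: module_along_def A.l_distr A.r_distr A.m_assoc\<close>)
qed

context twisted_toric
begin

text \<open>Closure of the semigroup is read off from its description by generators; it makes
  \<open>semigroup_algebra\<close> a ring.\<close>

lemma zero_mem: "0 \<in> dual_semigroup P"
proof -
  have "combination s (\<lambda>_. 0) + mscale (int 0) Rstar = 0"
    by (simp add: combination_def mscale_simps)
  then show ?thesis unfolding generators by (metis (mono_tags, lifting) mem_Collect_eq)
qed

lemma add_mem:
  assumes "x \<in> dual_semigroup P" "y \<in> dual_semigroup P"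
  shows "x + y \<in> dual_semigroup P"
proof -
  obtain k l where x: "x = combination s k + mscale (int l) Rstar" using assms(1) unfolding generators by blast
  obtain k' l' where y: "y = combination s k' + mscale (int l') Rstar" using assms(2) unfolding generators by blast
  have "x + y = combination s (\<lambda>j. k j + k' j) + mscale (int (l + l')) Rstar"
    by (simp add: x y combination_add mscale_simps)
  then show ?thesis unfolding generators by blast
qed

abbreviation fibre :: "('r option, complex fps fps) mpolynomial \<Rightarrow> ('n ext_dual \<Rightarrow>\<^sub>0 complex)" where
  "fibre \<equiv> substitute (\<lambda>c. toric_const (residue2 c)) (toric_coordinates s)"

sublocale residue: comm_ring_map residue2 by (rule residue2_ring_map)

sublocale residue_map: comm_ring_map "Poly_Mapping.map residue2 :: ('n ext_dual \<Rightarrow>\<^sub>0 complex fps fps) \<Rightarrow> _"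
  by (rule residue.map_ring_map)

sublocale fibre: comm_ring_map fibre
proof -
  interpret c: comm_ring_map toric_const by (rule toric_const_ring_map)
  interpret comm_ring_map "\<lambda>c. toric_const (residue2 c) :: 'n ext_dual \<Rightarrow>\<^sub>0 complex"
    by standard (simp_all add: residue.add residue.mult residue.one c.add c.mult c.one)
  show "comm_ring_map fibre" by (rule substitute_ring_map)
qed

lemma toric_const_residue_zero: "toric_const (residue2 0) = 0"
  by (simp add: toric_const_def)

lemma fibre_Const: "fibre (Const c) = Poly_Mapping.single 0 (residue2 c)"
  unfolding Const_def substitute_single[of "\<lambda>c. toric_const (residue2 c)", OF toric_const_residue_zero]
  by (simp add: toric_const_def)

lemma fibre_Var: "fibre (Var v) = toric_coordinates s v"
proof -
  have "(\<Prod>w\<in>UNIV. toric_coordinates s w ^ Poly_Mapping.lookup (Poly_Mapping.single v 1) w) =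
      (\<Prod>w\<in>UNIV. if w = v then toric_coordinates s w else 1)"
    by (rule prod.cong) (auto simp: lookup_single when_def)
  then show ?thesis
    unfolding Var_def substitute_single[of "\<lambda>c. toric_const (residue2 c)", OF toric_const_residue_zero]
    by (simp add: toric_const_def residue.one)
qed

lemma character_power: "character m ^ n = (character (mscale (int n) m) :: 'n ext_dual \<Rightarrow>\<^sub>0 complex)"
  using single_power[of "- m" "1 :: complex" n]
  by (simp add: character_def mscale_def vec_eq_iff)

lemma fibre_monomial:
  "fibre (xmonomial k * Var None ^ l) = character (combination s k + mscale (int l) Rstar)"
proof -
  have v: "fibre (Var (Some j)) = character (s j)" "fibre (Var None) = character Rstar" for j
    unfolding fibre_Var by (simp_all add: toric_coordinates_def)
  have "fibre (xmonomial k) = (\<Prod>j\<in>UNIV. character (mscale (int (k j)) (s j)))"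
    by (simp add: xmonomial_def fibre.prod fibre.power v character_power)
  also have "\<dots> = character (combination s k)"
    unfolding character_def prod_single_one combination_def ..
  finally show ?thesis
    unfolding fibre.mult fibre.power v character_power by (simp add: character_def mult_single)
qed

lemma residue_twist: "Poly_Mapping.map residue2 (twist p q) = 1"
  by (simp add: twist_def residue_map.mult residue_map.power residue_map.add residue_map.one
      residue.map_single residue2_t)

text \<open>Modulo the parameters every twist becomes 1, and what remains of a normal monomial is
  the character of s_k + l \<open>Rstar\<close>, the value of the toric substitution. So the reduced
  normal form is a ring homomorphism even where \<open>normal_form\<close> is not.\<close>

lemma fibre_eq: "fibre f = Poly_Mapping.map residue2 (normal_form f)"
proof (induction f rule: mpolynomial_induct)
  case (add f g)
  then show ?case by (simp add: fibre.add normal_form_add residue_map.add)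
next
  case (monomial c k l)
  show ?case
    by (simp add: fibre.mult[of "Const c"] fibre_Const fibre_monomial normal_form_monomial residue_map.mult
        normal_monomial_def residue_twist residue.map_single residue.one character_def)
qed

lemma fibre_equation: "fibre (equation k) = 0"
  using normal_form_mult_equation[of 1 k] by (simp add: fibre_eq)

lemma fibre_closed: "Poly_Mapping.keys (fibre f) \<subseteq> dual_semigroup P"
proof (induction f rule: mpolynomial_induct)
  case (add f g)
  then show ?case using keys_add[of "fibre f" "fibre g"] by (auto simp: fibre.add)
next
  case (monomial c k l)
  have "combination s k + mscale (int l) Rstar \<in> dual_semigroup P"
    unfolding generators by blast
  then show ?case
    by (simp add: fibre.mult[of "Const c"] fibre_Const fibre_monomial character_def mult_single)
qed

text \<open>Surjectivity onto the semigroup algebra combines the generation of the semigroup by the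
  s_j and \<open>Rstar\<close> with the surjectivity of the residue map on coefficients.\<close>

lemma fibre_range: "range fibre = {w. Poly_Mapping.keys w \<subseteq> dual_semigroup P}"
proof (intro equalityI subsetI)
  fix w :: "'n ext_dual \<Rightarrow>\<^sub>0 complex" assume "w \<in> {w. Poly_Mapping.keys w \<subseteq> dual_semigroup P}"
  then have w: "Poly_Mapping.keys w \<subseteq> dual_semigroup P" by simp
  have "\<exists>f. fibre f = Poly_Mapping.single x c" if x: "x \<in> Poly_Mapping.keys w" for x c
  proof -
    obtain k l where "x = combination s k + mscale (int l) Rstar"
      using w x unfolding generators by blast
    moreover obtain b where "c = residue2 b" using surj_residue2 by (rule surjE)
    ultimately have "fibre (Const b * (xmonomial k * Var None ^ l)) = Poly_Mapping.single x c"
      by (simp add: fibre.mult[of "Const b"] fibre_Const fibre_monomial character_def mult_single)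
    then show ?thesis by blast
  qed
  then obtain g where g: "fibre (g x c) = Poly_Mapping.single x c" if "x \<in> Poly_Mapping.keys w" for x c
    by metis
  have "fibre (\<Sum>x\<in>Poly_Mapping.keys w. g x (Poly_Mapping.lookup w x)) =
      (\<Sum>x\<in>Poly_Mapping.keys w. Poly_Mapping.single x (Poly_Mapping.lookup w x))"
    unfolding fibre.sum by (rule sum.cong[OF refl g])
  then have "fibre (\<Sum>x\<in>Poly_Mapping.keys w. g x (Poly_Mapping.lookup w x)) = w"
    by (simp only: poly_mapping_sum_single[symmetric])
  then show "w \<in> range fibre" by (rule range_eqI[OF sym])
next
  fix w assume "w \<in> range fibre"
  then show "w \<in> {w. Poly_Mapping.keys w \<subseteq> dual_semigroup P}" using fibre_closed by auto
qed

lemma fibre_kills: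
  assumes "residue2 ` J \<subseteq> {0}" "f \<in> genideal ring_of_type_algebra (Const ` J \<union> range equation)"
  shows "fibre f = 0"
proof -
  have "genideal ring_of_type_algebra (Const ` J \<union> range equation) \<subseteq> {f. fibre f = 0}"
  proof (rule type_genideal_minimal)
    show "ideal {f. fibre f = 0} ring_of_type_algebra"
      using fibre.ideal_max_ideal by (simp only: fibre.a_kernel_eq)
    show "Const ` J \<union> range equation \<subseteq> {f. fibre f = 0}"
      using assms(1) by (auto simp: fibre_Const fibre_equation)
  qed
  then show ?thesis using assms(2) by blast
qed

text \<open>That the reduced equations generate the toric ideal is not assumed but comes out: a
  polynomial with zero fibre has a normal form with coefficients in the maximal ideal, and by
  \<open>expansion_mem\<close> it lies in the ideal generated by these constants and the
  equations.\<close>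

lemma base_change_fibre:
  fixes J :: "complex fps fps set"
  defines "I \<equiv> genideal mpoly_ring (Const ` J \<union> range equation)"
  assumes J: "ideal J ring_of_type_algebra" and res: "residue2 ` J \<subseteq> {0}"
  shows "base_change (ring_of_type_algebra Quot J) complex_ring (induced residue2)
      (mpoly_ring Quot I) (induced (\<lambda>b. I +>\<^bsub>mpoly_ring\<^esub> Const b))
      (semigroup_algebra (dual_semigroup P)) toric_const (induced fibre)"
proof -
  interpret Const: comm_ring_map "Const :: complex fps fps \<Rightarrow> ('r option, complex fps fps) mpolynomial"
    by (rule Const_ring_map)
  have I: "ideal I ring_of_type_algebra"
    unfolding I_def mpoly_ring_def by (rule ideal_type_genideal)
  show ?thesis
    unfolding mpoly_ring_def
  proof (rule base_change_quot)
    show "cring (ring_of_type_algebra :: complex fps fps ring)"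
        "cring (ring_of_type_algebra :: ('r option, complex fps fps) mpolynomial ring)"
      by (rule cring_from_type_algebra)+
    show "ring complex_ring" by (rule ring_from_type_algebra)
    show "ideal J ring_of_type_algebra" "ideal I ring_of_type_algebra" by fact+
    show "Const \<in> ring_hom ring_of_type_algebra (ring_of_type_algebra :: ('r option, complex fps fps) mpolynomial ring)"
      by (rule Const.ring_hom)
    show "Const ` J \<subseteq> I"
      unfolding I_def mpoly_ring_def by (auto intro: type_genideal_self)
    show "ring (semigroup_algebra (dual_semigroup P))"
      by (rule ring_semigroup_algebra[OF zero_mem add_mem])
    show "residue2 \<in> ring_hom ring_of_type_algebra complex_ring" by (rule residue.ring_hom)
    show "residue2 ` carrier ring_of_type_algebra = carrier complex_ring" using surj_residue2 by simp
    show "residue2 ` J \<subseteq> {\<zero>\<^bsub>complex_ring\<^esub>}" using res by simp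
    show "toric_const \<in> ring_hom complex_ring (semigroup_algebra (dual_semigroup P))"
      using zero_mem
      by (intro ring_hom_memI)
         (simp_all add: semigroup_algebra_def toric_const_def mult_single single_add)
    show "fibre \<in> ring_hom ring_of_type_algebra (semigroup_algebra (dual_semigroup P))"
    proof (rule ring_hom_memI)
      fix f g :: "('r option, complex fps fps) mpolynomial"
      show "fibre f \<in> carrier (semigroup_algebra (dual_semigroup P))"
        using fibre_closed by (simp add: semigroup_algebra_def)
      show "fibre (f \<otimes>\<^bsub>ring_of_type_algebra\<^esub> g) = fibre f \<otimes>\<^bsub>semigroup_algebra (dual_semigroup P)\<^esub> fibre g"
        "fibre (f \<oplus>\<^bsub>ring_of_type_algebra\<^esub> g) = fibre f \<oplus>\<^bsub>semigroup_algebra (dual_semigroup P)\<^esub> fibre g"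
        by (simp_all add: semigroup_algebra_def fibre.mult fibre.add)
    qed (simp add: semigroup_algebra_def fibre.one)
    show "fibre ` carrier ring_of_type_algebra = carrier (semigroup_algebra (dual_semigroup P))"
      by (simp add: fibre_range semigroup_algebra_def)
    show "fibre ` I \<subseteq> {\<zero>\<^bsub>semigroup_algebra (dual_semigroup P)\<^esub>}"
      using fibre_kills[OF res] by (auto simp: semigroup_algebra_def I_def mpoly_ring_def)
    show "fibre (Const b) = toric_const (residue2 b)" for b
      unfolding fibre_Const by (simp only: toric_const_def)
  next
    fix f assume "fibre f = \<zero>\<^bsub>semigroup_algebra (dual_semigroup P)\<^esub>"
    then have "fibre f = 0" by (simp add: semigroup_algebra_def)
    then have "residue2 (Poly_Mapping.lookup (normal_form f) x) = 0" for x
      unfolding fibre_eq by (metis residue.lookup_map lookup_zero)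
    then have "f \<in> genideal ring_of_type_algebra (Const ` {b. residue2 b = 0} \<union> range equation)"
      by (intro expansion_mem) simp
    moreover have "Const ` {b. residue2 b = 0} \<union> range equation \<subseteq> I \<union> Const ` {b. residue2 b = 0}"
      unfolding I_def mpoly_ring_def by (auto intro: type_genideal_self)
    ultimately show "f \<in> genideal ring_of_type_algebra (I \<union> Const ` a_kernel ring_of_type_algebra complex_ring residue2)"
      unfolding residue.a_kernel_eq using type_genideal_mono by blast
  qed
qed

end

section \<open>Flatness of the levels\<close>

lemma lookup_single_zero_mult:
  "Poly_Mapping.lookup (Poly_Mapping.single 0 c * w) x = (c :: 'k::comm_ring_1) * Poly_Mapping.lookup w x"
  by (simp add: mult_map_scale_conv_mult[symmetric] Poly_Mapping.map.rep_eq when_def)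

lemma finsum_coset:
  fixes I :: "'a::comm_ring_1 set" and g :: "'i \<Rightarrow> 'a"
  assumes I: "ideal I ring_of_type_algebra"
  shows "finite T \<Longrightarrow> finsum (ring_of_type_algebra Quot I) (\<lambda>i. I +>\<^bsub>ring_of_type_algebra\<^esub> g i) T =
    I +>\<^bsub>ring_of_type_algebra\<^esub> sum g T"
proof (induction T rule: finite_induct)
  case empty
  interpret Q: ring "ring_of_type_algebra Quot I" by (rule ideal.quotient_is_ring[OF I])
  show ?case
    using type_idealD(1)[OF I] ideal_coset_zero_iff[OF I, of 0] by (simp add: ideal.quot_zero[OF I])
next
  case (insert i T)
  interpret Q: ring "ring_of_type_algebra Quot I" by (rule ideal.quotient_is_ring[OF I])
  have c: "I +>\<^bsub>ring_of_type_algebra\<^esub> x \<in> carrier (ring_of_type_algebra Quot I)" for x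
    by (rule ideal.quot_closed[OF I]) simp
  have "finsum (ring_of_type_algebra Quot I) (\<lambda>i. I +>\<^bsub>ring_of_type_algebra\<^esub> g i) (insert i T) =
      (I +>\<^bsub>ring_of_type_algebra\<^esub> g i) \<oplus>\<^bsub>ring_of_type_algebra Quot I\<^esub> (I +>\<^bsub>ring_of_type_algebra\<^esub> sum g T)"
    unfolding insert.IH[symmetric] by (rule Q.finsum_insert[OF insert.hyps]) (use c in auto)
  then show ?case
    using insert.hyps by (simp add: ideal.quot_simps[OF I])
qed

lemma finsum_module_along: "finsum (module_along \<phi> A) g T = finsum A g T"
  by (simp add: finsum_def finprod_def module_along_def)

context twisted_toric
begin

text \<open>\<open>normal_form_ideal\<close> makes the coordinates well defined modulo
  \<open>J\<close>, and \<open>normal_form_congruent\<close> is the expansion. The index set is the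
  whole lattice; points outside the semigroup do no harm, as their coordinates vanish.\<close>

theorem flat_level:
  fixes J :: "complex fps fps set"
  defines "I \<equiv> genideal mpoly_ring (Const ` J \<union> range equation)"
  assumes J: "ideal J ring_of_type_algebra"
  shows "flat_module TYPE('t) (ring_of_type_algebra Quot J)
      (module_along (induced (\<lambda>b. I +>\<^bsub>mpoly_ring\<^esub> Const b)) (mpoly_ring Quot I))"
proof -
  let ?B = "ring_of_type_algebra :: complex fps fps ring"
  let ?R = "ring_of_type_algebra :: ('r option, complex fps fps) mpolynomial ring"
  interpret Const: comm_ring_map "Const :: complex fps fps \<Rightarrow> ('r option, complex fps fps) mpolynomial"
    by (rule Const_ring_map)
  have I: "ideal I ?R"
    unfolding I_def mpoly_ring_def by (rule ideal_type_genideal)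
  define \<phi> where "\<phi> = induced (\<lambda>b. I +>\<^bsub>?R\<^esub> Const b)"
  define c where "c = (\<lambda>x. induced (\<lambda>f. J +>\<^bsub>?B\<^esub> Poly_Mapping.lookup (normal_form f) x))"
  define e where "e = (\<lambda>x. I +>\<^bsub>?R\<^esub> chi P d x)"
  let ?M = "module_along \<phi> (?R Quot I)"
  have carrier_M: "carrier ?M = carrier (?R Quot I)"
    and add_M: "add ?M = add (?R Quot I)"
    and smult_M: "a \<odot>\<^bsub>?M\<^esub> x = \<phi> a \<otimes>\<^bsub>?R Quot I\<^esub> x" for a x
    by (simp_all add: module_along_def)
  have kills: "(\<lambda>b. I +>\<^bsub>?R\<^esub> Const b) ` J \<subseteq> {\<zero>\<^bsub>?R Quot I\<^esub>}"
    by (rule ideal_coset_kills[OF I]) (auto simp: I_def mpoly_ring_def intro: type_genideal_self)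
  have \<phi>: "\<phi> (J +>\<^bsub>?B\<^esub> b) = I +>\<^bsub>?R\<^esub> Const b" for b
    unfolding \<phi>_def
    by (rule ideal.induced_coset[OF J Const.coset_ring_hom[OF I] ideal.quotient_is_ring[OF I] kills]) simp
  have \<phi>_hom: "\<phi> \<in> ring_hom (?B Quot J) (?R Quot I)"
    unfolding \<phi>_def
    by (rule ideal.induced_ring_hom[OF J Const.coset_ring_hom[OF I] ideal.quotient_is_ring[OF I] kills])
  have c: "c x (I +>\<^bsub>?R\<^esub> f) = J +>\<^bsub>?B\<^esub> Poly_Mapping.lookup (normal_form f) x" for x f
    unfolding c_def
  proof (rule ideal.induced_coset_of_invariant[OF I])
    fix i g assume "i \<in> I"
    then have "Poly_Mapping.lookup (normal_form i) x \<in> J"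
      unfolding I_def mpoly_ring_def by (rule normal_form_ideal[OF J])
    then show "J +>\<^bsub>?B\<^esub> Poly_Mapping.lookup (normal_form (i \<oplus>\<^bsub>?R\<^esub> g)) x =
        J +>\<^bsub>?B\<^esub> Poly_Mapping.lookup (normal_form g) x"
      by (simp add: ideal_coset_eq_iff[OF J] normal_form_add lookup_add)
  qed simp
  have B_closed: "J +>\<^bsub>?B\<^esub> b \<in> carrier (?B Quot J)" for b
    by (rule ideal.quot_closed[OF J]) simp
  have M_closed: "I +>\<^bsub>?R\<^esub> f \<in> carrier (?R Quot I)" for f
    by (rule ideal.quot_closed[OF I]) simp
  have "module_dual_basis (?B Quot J) ?M e c"
  proof (rule module_dual_basis.intro)
    show "Module.module (?B Quot J) ?M"
      by (rule module_module_along[OF ideal.quotient_is_cring[OF J cring_from_type_algebra]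
            ideal.quotient_is_cring[OF I cring_from_type_algebra] \<phi>_hom])
    show "module_dual_basis_axioms (?B Quot J) ?M e c"
    proof
      show "e i \<in> carrier ?M" for i
        unfolding carrier_M e_def by (rule M_closed)
    next
      fix i x assume "x \<in> carrier ?M"
      then obtain f where x: "x = I +>\<^bsub>?R\<^esub> f"
        unfolding carrier_M by (rule ideal.quot_cases[OF I])
      show "c i x \<in> carrier (?B Quot J)" unfolding x c by (rule B_closed)
      fix r assume "r \<in> carrier (?B Quot J)"
      then obtain b where r: "r = J +>\<^bsub>?B\<^esub> b" by (rule ideal.quot_cases[OF J])
      show "c i (r \<odot>\<^bsub>?M\<^esub> x) = r \<otimes>\<^bsub>?B Quot J\<^esub> c i x"
        unfolding smult_M x r \<phi>
        by (simp add: ideal.quot_simps[OF I] ideal.quot_simps[OF J] c normal_form_Const lookup_single_zero_mult)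
    next
      fix i x y assume "x \<in> carrier ?M" "y \<in> carrier ?M"
      then obtain f g where x: "x = I +>\<^bsub>?R\<^esub> f" and y: "y = I +>\<^bsub>?R\<^esub> g"
        unfolding carrier_M by (metis ideal.quot_cases[OF I])
      show "c i (x \<oplus>\<^bsub>?M\<^esub> y) = c i x \<oplus>\<^bsub>?B Quot J\<^esub> c i y"
        unfolding add_M x y
        by (simp add: ideal.quot_simps[OF I] ideal.quot_simps[OF J] c normal_form_add lookup_add)
    next
      fix x assume "x \<in> carrier ?M"
      then obtain f where x: "x = I +>\<^bsub>?R\<^esub> f"
        unfolding carrier_M by (rule ideal.quot_cases[OF I])
      \<comment> \<open>This is the support for the chosen representative \<open>f\<close>. Another
        representative may change it, but off it the coefficient of \<open>f\<close> is zero and so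
        is its class modulo \<open>J\<close>.\<close>
      let ?T = "Poly_Mapping.keys (normal_form f)"
      have "c i x = \<zero>\<^bsub>?B Quot J\<^esub>" if "i \<notin> ?T" for i
        using that type_idealD(1)[OF J] unfolding x c
        by (simp add: ideal.quot_zero[OF J] ideal_coset_zero_iff[OF J] in_keys_iff)
      moreover have "finsum ?M (\<lambda>i. c i x \<odot>\<^bsub>?M\<^esub> e i) ?T = x"
      proof -
        have "(\<lambda>i. c i x \<odot>\<^bsub>?M\<^esub> e i) =
            (\<lambda>i. I +>\<^bsub>?R\<^esub> (Const (Poly_Mapping.lookup (normal_form f) i) * chi P d i))"
          unfolding smult_M x c \<phi> e_def by (simp add: ideal.quot_simps[OF I])
        moreover have "finsum ?M g ?T = finsum (?R Quot I) g ?T" for g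
          by (simp only: finsum_module_along)
        ultimately have "finsum ?M (\<lambda>i. c i x \<odot>\<^bsub>?M\<^esub> e i) ?T =
            finsum (?R Quot I) (\<lambda>i. I +>\<^bsub>?R\<^esub> (Const (Poly_Mapping.lookup (normal_form f) i) * chi P d i)) ?T"
          by simp
        also have "\<dots> = I +>\<^bsub>?R\<^esub> expansion (normal_form f)"
          unfolding expansion_def by (rule finsum_coset[OF I finite_keys])
        also have "\<dots> = x"
        proof -
          have "f - expansion (normal_form f) \<in> I"
            unfolding I_def mpoly_ring_def
            using normal_form_congruent type_genideal_mono[of "range equation" "Const ` J \<union> range equation"] by blast
          then have "- (f - expansion (normal_form f)) \<in> I" by (rule type_idealD(4)[OF I])
          then show ?thesis unfolding x by (simp add: ideal_coset_eq_iff[OF I])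
        qed
        finally show ?thesis .
      qed
      ultimately show "\<exists>T. finite T \<and> (\<forall>i. i \<notin> T \<longrightarrow> c i x = \<zero>\<^bsub>?B Quot J\<^esub>) \<and>
          x = finsum ?M (\<lambda>i. c i x \<odot>\<^bsub>?M\<^esub> e i) T"
        by (intro exI[of _ ?T] conjI allI impI) (simp_all only: finite_keys)
    qed
  qed
  from module_dual_basis.flat[OF this] show ?thesis
    unfolding \<phi>_def mpoly_ring_def .
qed

end

section \<open>The formal deformation and its restrictions\<close>

lemma induced_coset_map:
  assumes h: "comm_ring_map h" and I: "ideal I ring_of_type_algebra" and I': "ideal I' ring_of_type_algebra"
    and sub: "h ` I \<subseteq> I'"
  shows "induced (\<lambda>f. I' +>\<^bsub>ring_of_type_algebra\<^esub> h f) (I +>\<^bsub>ring_of_type_algebra\<^esub> f) =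
    I' +>\<^bsub>ring_of_type_algebra\<^esub> h f"
  by (rule ideal.induced_coset[OF I comm_ring_map.coset_ring_hom[OF h I'] ideal.quotient_is_ring[OF I']
        ideal_coset_kills[OF I' sub]]) simp

lemma id_ring_map: "comm_ring_map (\<lambda>x. x)"
  by standard simp_all

lemma map_ident: "Poly_Mapping.map (\<lambda>x. x) = (\<lambda>f. f)"
  by (intro ext poly_mapping_eqI) (simp add: Poly_Mapping.map.rep_eq when_def)

lemma (in comm_ring_map) substitute_map:
  assumes "comm_ring_map h"
  shows "substitute h g (Poly_Mapping.map \<delta> f) = substitute (\<lambda>c. h (\<delta> c)) g f"
proof -
  interpret h: comm_ring_map h by fact
  interpret map: comm_ring_map "Poly_Mapping.map \<delta> :: ('v, 'a) mpolynomial \<Rightarrow> _" by (rule map_ring_map)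
  have comp: "(\<lambda>c. h (\<delta> c)) (x + y) = (\<lambda>c. h (\<delta> c)) x + (\<lambda>c. h (\<delta> c)) y" for x y
    by (simp add: add h.add)
  show ?thesis
  proof (induction f rule: poly_mapping_single_induct)
    case zero
    then show ?case by (simp add: substitute_def)
  next
    case (add p q)
    then show ?case by (simp add: map.add substitute_add[OF h.add] substitute_add[of "\<lambda>c. h (\<delta> c)", OF comp])
  next
    case (single k c)
    then show ?case by (simp add: map_single substitute_single)
  qed
qed

lemma level_ideal_eq:
  "level_ideal \<epsilon> F q = genideal ring_of_type_algebra
     (Const ` ideal_power ring_of_type_algebra (max_ideal ring_of_type_algebra \<epsilon>) (Suc q) \<union> F)"
  by (simp add: level_ideal_def mpoly_ring_def)

lemma ideal_level_ideal: "ideal (level_ideal \<epsilon> F q) ring_of_type_algebra"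
  unfolding level_ideal_eq by (rule ideal_type_genideal)

abbreviation thickening_ideal :: "('a::comm_ring_1 \<Rightarrow> complex) \<Rightarrow> nat \<Rightarrow> 'a set" where
  "thickening_ideal \<epsilon> q \<equiv> ideal_power ring_of_type_algebra (max_ideal ring_of_type_algebra \<epsilon>) (Suc q)"

lemma
  assumes "comm_ring_map \<epsilon>"
  shows ideal_thickening: "ideal (thickening_ideal \<epsilon> q) ring_of_type_algebra"
    and thickening_kernel: "\<epsilon> ` thickening_ideal \<epsilon> q \<subseteq> {0}"
    and thickening_decreasing: "thickening_ideal \<epsilon> (Suc q) \<subseteq> thickening_ideal \<epsilon> q"
proof -
  interpret comm_ring_map \<epsilon> by fact
  show "ideal (thickening_ideal \<epsilon> q) ring_of_type_algebra"
    unfolding max_ideal_def by (rule ideal_ideal_power[OF ideal_max_ideal])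
  show "\<epsilon> ` thickening_ideal \<epsilon> q \<subseteq> {0}"
    using ideal_power_Suc_subset(1)[OF ideal_max_ideal, of q] unfolding max_ideal_def a_kernel_eq by blast
  show "thickening_ideal \<epsilon> (Suc q) \<subseteq> thickening_ideal \<epsilon> q"
    using ideal_power_Suc_subset(2)[OF ideal_max_ideal, of "Suc q"] unfolding max_ideal_def .
qed

lemma level_ideal_decreasing:
  assumes "comm_ring_map \<epsilon>"
  shows "level_ideal \<epsilon> F (Suc q) \<subseteq> level_ideal \<epsilon> F q"
  unfolding level_ideal_eq
  by (rule type_genideal_mono) (use thickening_decreasing[OF assms, of q] in blast)

lemma (in comm_ring_map) map_level_ideal:
  assumes "comm_ring_map \<epsilon>'" and "\<And>b. \<epsilon>' (\<delta> b) = \<epsilon> b"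
  shows "Poly_Mapping.map \<delta> ` level_ideal \<epsilon> F q \<subseteq> level_ideal \<epsilon>' (Poly_Mapping.map \<delta> ` F) q"
    and "\<delta> ` ideal_power ring_of_type_algebra (max_ideal ring_of_type_algebra \<epsilon>) (Suc q)
      \<subseteq> ideal_power ring_of_type_algebra (max_ideal ring_of_type_algebra \<epsilon>') (Suc q)"
proof -
  interpret map: comm_ring_map "Poly_Mapping.map \<delta> :: ('v, 'a) mpolynomial \<Rightarrow> _" by (rule map_ring_map)
  show sub: "\<delta> ` ideal_power ring_of_type_algebra (max_ideal ring_of_type_algebra \<epsilon>) (Suc q)
      \<subseteq> ideal_power ring_of_type_algebra (max_ideal ring_of_type_algebra \<epsilon>') (Suc q)"
    by (rule ideal_power_image) (auto simp: max_ideal_def a_kernel_def' assms(2))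
  let ?J = "\<lambda>\<epsilon>. ideal_power ring_of_type_algebra (max_ideal ring_of_type_algebra \<epsilon>) (Suc q)"
  have "Poly_Mapping.map \<delta> ` (Const ` ?J \<epsilon> \<union> F) = Const ` \<delta> ` ?J \<epsilon> \<union> Poly_Mapping.map \<delta> ` F"
    by (simp only: image_Un image_image map_Const)
  also have "\<dots> \<subseteq> Const ` ?J \<epsilon>' \<union> Poly_Mapping.map \<delta> ` F"
    using sub by blast
  finally have "genideal ring_of_type_algebra (Poly_Mapping.map \<delta> ` (Const ` ?J \<epsilon> \<union> F)) \<subseteq>
      level_ideal \<epsilon>' (Poly_Mapping.map \<delta> ` F) q"
    unfolding level_ideal_eq by (rule type_genideal_mono)
  then show "Poly_Mapping.map \<delta> ` level_ideal \<epsilon> F q \<subseteq> level_ideal \<epsilon>' (Poly_Mapping.map \<delta> ` F) q"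
    using map.genideal_image[of "Const ` ?J \<epsilon> \<union> F"] unfolding level_ideal_eq by (rule order_trans[rotated])
qed

context twisted_toric
begin

abbreviation "family \<equiv> two_param_family P s d m1 Q1 m2 Q2"
abbreviation "levels \<equiv> level_ideal residue2 (range equation)"

lemma family_simps:
  "level family q = mpoly_ring Quot levels q"
  "structure_map family q = induced (\<lambda>b. levels q +>\<^bsub>mpoly_ring\<^esub> Const b)"
  "transition family q = induced (\<lambda>f. levels q +>\<^bsub>mpoly_ring\<^esub> f)"
  "fibre_map family q = induced fibre"
  by (simp_all add: two_param_family_def family_of_equations_def)

lemma induced_fibre: "induced fibre (levels q +>\<^bsub>ring_of_type_algebra\<^esub> f) = fibre f"
proof (rule ideal.induced_coset[OF ideal_level_ideal fibre.ring_hom ring_from_type_algebra])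
  show "fibre ` levels q \<subseteq> {\<zero>\<^bsub>ring_of_type_algebra\<^esub>}"
    using fibre_kills[OF thickening_kernel[OF residue2_ring_map]] unfolding level_ideal_eq by auto
qed simp

lemma induced_transition:
  "induced (\<lambda>f. levels q +>\<^bsub>ring_of_type_algebra\<^esub> f) (levels (Suc q) +>\<^bsub>ring_of_type_algebra\<^esub> f) =
    levels q +>\<^bsub>ring_of_type_algebra\<^esub> f"
  using level_ideal_decreasing[OF residue2_ring_map, of "range equation" q]
  by (intro induced_coset_map[OF id_ring_map ideal_level_ideal ideal_level_ideal]) simp

theorem formal_deformation_family:
  "formal_deformation TYPE('t) ring_of_type_algebra residue2
     (semigroup_algebra (dual_semigroup P)) toric_const family"
  unfolding formal_deformation_def
proof (intro allI conjI ballI)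
  fix q
  show "cring (level family q)"
    unfolding family_simps mpoly_ring_def
    by (rule ideal.quotient_is_cring[OF ideal_level_ideal cring_from_type_algebra])
  show "flat_module TYPE('t) (thickening ring_of_type_algebra residue2 q)
      (module_along (structure_map family q) (level family q))"
    unfolding family_simps thickening_def level_ideal_def by (rule flat_level[OF ideal_thickening[OF residue2_ring_map]])
  show "base_change (thickening ring_of_type_algebra residue2 q) complex_ring (induced residue2)
      (level family q) (structure_map family q) (semigroup_algebra (dual_semigroup P)) toric_const (fibre_map family q)"
    unfolding family_simps thickening_def level_ideal_def
    by (rule base_change_fibre[OF ideal_thickening[OF residue2_ring_map] thickening_kernel[OF residue2_ring_map]])
  show "base_change (thickening ring_of_type_algebra residue2 (Suc q)) (thickening ring_of_type_algebra residue2 q)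
      (induced (to_thickening ring_of_type_algebra residue2 q))
      (level family (Suc q)) (structure_map family (Suc q)) (level family q) (structure_map family q)
      (transition family q)"
  proof -
    \<comment> \<open>A transition is the base change of the family along the identity of the
      coefficients, for the ideals m^(q + 2) \<subseteq> m^(q + 1).\<close>
    have "(\<lambda>x. x) ` thickening_ideal residue2 (Suc q) \<subseteq> thickening_ideal residue2 q"
      using thickening_decreasing[OF residue2_ring_map] by simp
    from comm_ring_map.base_change_family[OF id_ring_map surj_id[unfolded id_def]
        ideal_thickening[OF residue2_ring_map] ideal_thickening[OF residue2_ring_map] this, of "range equation"]
    show ?thesis
      unfolding map_ident image_ident family_simps thickening_def level_ideal_def to_thickening_def[abs_def] .
  qed
  fix a assume "a \<in> carrier (level family (Suc q))"
  then obtain f where a: "a = levels (Suc q) +>\<^bsub>ring_of_type_algebra\<^esub> f"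
    unfolding family_simps mpoly_ring_def by (rule ideal.quot_cases[OF ideal_level_ideal])
  show "fibre_map family q (transition family q a) = fibre_map family (Suc q) a"
    unfolding a family_simps mpoly_ring_def induced_transition induced_fibre ..
qed

text \<open>Both axes are instances. The map \<open>g\<close> reduces the coefficients of
  representatives, and its compatibility with fibres and transitions is tested on these.\<close>

theorem restricts_to_axis:
  assumes \<delta>: "comm_ring_map \<delta>" and surj: "surj \<delta>" and res: "\<And>b. residue1 (\<delta> b) = residue2 b"
    and eq: "\<And>k. Poly_Mapping.map \<delta> (equation k) = equation' k"
  shows "restricts_to ring_of_type_algebra residue2 ring_of_type_algebra residue1 \<delta> family
     (family_of_equations residue1 toric_const (toric_coordinates s) (range equation'))"
proof -
  interpret \<delta>: comm_ring_map \<delta> by fact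
  interpret res1: comm_ring_map residue1 by (rule residue1_ring_map)
  interpret map: comm_ring_map "Poly_Mapping.map \<delta> :: ('r option, complex fps fps) mpolynomial \<Rightarrow> _"
    by (rule \<delta>.map_ring_map)
  interpret c: comm_ring_map toric_const by (rule toric_const_ring_map)
  interpret h: comm_ring_map "\<lambda>c. toric_const (residue1 c) :: 'n ext_dual \<Rightarrow>\<^sub>0 complex"
    by standard (simp_all add: res1.add res1.mult res1.one c.add c.mult c.one)
  let ?family' = "family_of_equations residue1 toric_const (toric_coordinates s) (range equation')"
  let ?fibre' = "substitute (\<lambda>c. toric_const (residue1 c)) (toric_coordinates s)"
  let ?levels' = "level_ideal residue1 (range equation')"
  interpret fibre': comm_ring_map ?fibre' by (rule h.substitute_ring_map)
  have range': "Poly_Mapping.map \<delta> ` range equation = range equation'"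
    by (simp add: image_image eq)
  have map_levels: "Poly_Mapping.map \<delta> ` levels q \<subseteq> ?levels' q" for q
    using \<delta>.map_level_ideal(1)[OF residue1_ring_map res, where F = "range equation" and q = q] unfolding range' .
  have fibre'_map: "?fibre' (Poly_Mapping.map \<delta> f) = fibre f" for f
    unfolding \<delta>.substitute_map[OF h.comm_ring_map_axioms] res ..
  \<comment> \<open>The new equations are images of the old ones, and \<open>?fibre'\<close> after
    the coefficient map is \<open>fibre\<close>. The vanishing is thus inherited, and no normal form
    is set up for one parameter.\<close>
  have fibre'_kills: "?fibre' ` ?levels' q \<subseteq> {0}" for q
  proof -
    have "?levels' q \<subseteq> {f. ?fibre' f = 0}"
      unfolding level_ideal_eq
    proof (rule type_genideal_minimal)
      show "ideal {f. ?fibre' f = 0} ring_of_type_algebra"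
        using fibre'.ideal_max_ideal by (simp only: fibre'.a_kernel_eq)
      have "?fibre' (Const b) = toric_const (residue1 b)" for b
        by (simp add: Const_def substitute_single)
      then have "?fibre' (Const b) = 0" if "b \<in> thickening_ideal residue1 q" for b
        using that thickening_kernel[OF residue1_ring_map, of q] by auto
      moreover have "?fibre' (equation' k) = 0" for k
        using fibre'_map[of "equation k"] by (simp add: eq fibre_equation)
      ultimately show "Const ` thickening_ideal residue1 q \<union> range equation' \<subseteq> {f. ?fibre' f = 0}"
        by auto
    qed
    then show ?thesis by blast
  qed
  have induced_fibre': "induced ?fibre' (?levels' q +>\<^bsub>ring_of_type_algebra\<^esub> f) = ?fibre' f" for q f
    by (rule ideal.induced_coset[OF ideal_level_ideal fibre'.ring_hom ring_from_type_algebra])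
      (use fibre'_kills in simp_all)
  have family'_simps:
    "level ?family' q = mpoly_ring Quot ?levels' q"
    "structure_map ?family' q = induced (\<lambda>b. ?levels' q +>\<^bsub>mpoly_ring\<^esub> Const b)"
    "transition ?family' q = induced (\<lambda>f. ?levels' q +>\<^bsub>mpoly_ring\<^esub> f)"
    "fibre_map ?family' q = induced ?fibre'" for q
    by (simp_all add: family_of_equations_def)
  define g where "g q = induced (\<lambda>f. ?levels' q +>\<^bsub>ring_of_type_algebra\<^esub> Poly_Mapping.map \<delta> f)" for q
  have g: "g q (levels q +>\<^bsub>ring_of_type_algebra\<^esub> f) = ?levels' q +>\<^bsub>ring_of_type_algebra\<^esub> Poly_Mapping.map \<delta> f" for q f
    unfolding g_def
    by (rule induced_coset_map[OF map.comm_ring_map_axioms ideal_level_ideal ideal_level_ideal map_levels])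
  have transition': "induced (\<lambda>f. ?levels' q +>\<^bsub>ring_of_type_algebra\<^esub> f) (?levels' (Suc q) +>\<^bsub>ring_of_type_algebra\<^esub> f) =
      ?levels' q +>\<^bsub>ring_of_type_algebra\<^esub> f" for q f
    using level_ideal_decreasing[OF residue1_ring_map, of "range equation'" q]
    by (intro induced_coset_map[OF id_ring_map ideal_level_ideal ideal_level_ideal]) simp
  show ?thesis
    unfolding restricts_to_def
  proof (intro exI[of _ g] allI conjI ballI)
    fix q
    show "base_change (thickening ring_of_type_algebra residue2 q) (thickening ring_of_type_algebra residue1 q)
        (induced (\<lambda>b. to_thickening ring_of_type_algebra residue1 q (\<delta> b)))
        (level family q) (structure_map family q) (level ?family' q) (structure_map ?family' q) (g q)"
      using \<delta>.base_change_family[OF surj ideal_thickening[OF residue2_ring_map] ideal_thickening[OF residue1_ring_map]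
          \<delta>.map_level_ideal(2)[OF residue1_ring_map res], of q "range equation"]
      unfolding family_simps family'_simps thickening_def to_thickening_def g_def level_ideal_def range' mpoly_ring_def .
  next
    fix q a assume "a \<in> carrier (level family q)"
    then obtain f where a: "a = levels q +>\<^bsub>ring_of_type_algebra\<^esub> f"
      unfolding family_simps mpoly_ring_def by (rule ideal.quot_cases[OF ideal_level_ideal])
    show "fibre_map ?family' q (g q a) = fibre_map family q a"
      unfolding a g family_simps family'_simps induced_fibre induced_fibre' fibre'_map ..
  next
    fix q a assume "a \<in> carrier (level family (Suc q))"
    then obtain f where a: "a = levels (Suc q) +>\<^bsub>ring_of_type_algebra\<^esub> f"
      unfolding family_simps mpoly_ring_def by (rule ideal.quot_cases[OF ideal_level_ideal])
    show "g q (transition family q a) = transition ?family' q (g (Suc q) a)"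
      unfolding a g family_simps family'_simps mpoly_ring_def induced_transition transition' ..
  qed
qed

end

lemma (in comm_ring_map) map_chi:
  "Poly_Mapping.map \<delta> (chi P d x :: ('r::finite option, 'a) mpolynomial) = chi P d x"
proof -
  interpret map: comm_ring_map "Poly_Mapping.map \<delta> :: ('r option, 'a) mpolynomial \<Rightarrow> _" by (rule map_ring_map)
  show ?thesis by (simp add: chi_def map.mult map.power map_monomial)
qed

text \<open>The iterated sum replaces the sum over pairs so that the sum over the exponents of the
  vanishing parameter can be collapsed by itself.\<close>

lemma map_two_param_equation:
  assumes "comm_ring_map \<delta>"
  shows "Poly_Mapping.map \<delta> (two_param_equation P s d m1 Q1 m2 Q2 k) =
    xmonomial k - (\<Sum>a1\<le>eta_defect Q1 s k. \<Sum>a2\<le>eta_defect Q2 s k.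
        Const (of_nat (eta_defect Q1 s k choose a1) * of_nat (eta_defect Q2 s k choose a2) *
               \<delta> t1 ^ a1 * \<delta> t2 ^ a2) *
        chi P d (combination s k - mscale (int a1) m1 - mscale (int a2) m2))"
proof -
  interpret comm_ring_map \<delta> by fact
  interpret map: comm_ring_map "Poly_Mapping.map \<delta> :: ('r option, complex fps fps) mpolynomial \<Rightarrow> _"
    by (rule map_ring_map)
  show ?thesis
    unfolding two_param_equation_def
    by (simp add: map.minus map.sum map.mult map_Const map_chi map_monomial mult power of_nat
        case_prod_unfold sum.cartesian_product)
qed

lemma set_t2_zero_equation:
  "Poly_Mapping.map set_t2_zero (two_param_equation P s d m1 Q1 m2 Q2 k) = one_param_equation P s d m1 Q1 k"
proof -
  have t: "set_t2_zero t1 = fps_X" "set_t2_zero t2 = 0"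
    by (simp_all add: set_t2_zero_def t1_def t2_def)
  have "(\<Sum>a2\<le>n. Const (of_nat N * of_nat (n choose a2) * fps_X ^ a1 * (0 :: complex fps) ^ a2) *
        chi P d (x - mscale (int a2) m2)) = Const (of_nat N * fps_X ^ a1) * chi P d x" for n N a1 x
  proof -
    have "(\<Sum>a2\<le>n. Const (of_nat N * of_nat (n choose a2) * fps_X ^ a1 * (0 :: complex fps) ^ a2) *
        chi P d (x - mscale (int a2) m2)) =
       (\<Sum>a2\<le>n. if a2 = 0 then Const (of_nat N * fps_X ^ a1) * chi P d x else 0)"
      \<comment> \<open>Since \<open>0 ^ 0 = 1\<close>, the summand with \<open>a2 = 0\<close>
        survives and all others vanish.\<close>
      by (rule sum.cong) (auto simp: mscale_simps Const_def power_0_left)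
    then show ?thesis by simp
  qed
  then show ?thesis
    unfolding map_two_param_equation[OF set_t2_zero_ring_map] t one_param_equation_def by simp
qed

lemma set_t1_zero_equation:
  "Poly_Mapping.map set_t1_zero (two_param_equation P s d m1 Q1 m2 Q2 k) = one_param_equation P s d m2 Q2 k"
proof -
  have t: "set_t1_zero t1 = 0" "set_t1_zero t2 = fps_X"
    by (auto simp: set_t1_zero_def t1_def t2_def fps_eq_iff fps_X_def)
  have "(\<Sum>a1\<le>n. Const (of_nat (n choose a1) * of_nat N * (0 :: complex fps) ^ a1 * fps_X ^ a2) *
        chi P d (x - mscale (int a1) m1 - y)) = Const (of_nat N * fps_X ^ a2) * chi P d (x - y)" for n N a2 x y
  proof -
    have "(\<Sum>a1\<le>n. Const (of_nat (n choose a1) * of_nat N * (0 :: complex fps) ^ a1 * fps_X ^ a2) *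
        chi P d (x - mscale (int a1) m1 - y)) =
       (\<Sum>a1\<le>n. if a1 = 0 then Const (of_nat N * fps_X ^ a2) * chi P d (x - y) else 0)"
      by (rule sum.cong) (auto simp: mscale_simps Const_def power_0_left)
    then show ?thesis by simp
  qed
  then show ?thesis
    unfolding map_two_param_equation[OF set_t1_zero_ring_map] t one_param_equation_def
    \<comment> \<open>The sum over the exponent of \<open>t1\<close> is the outer one and has to
      move inside before it collapses.\<close>
    by (subst sum.swap) simp
qed

section \<open>Lattice polytopes and deformation pairs\<close>

lemma pairing_simps:
  "pairing (c + c') v = pairing c v + pairing c' v" "pairing (c - c') v = pairing c v - pairing c' v"
  "pairing (a *s c) v = of_int a * pairing c v" "pairing 0 v = 0"
  "pairing c (v + w) = pairing c v + pairing c w" "pairing c (r *\<^sub>R v) = r * pairing c v"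
  by (simp_all add: pairing_def distrib_left distrib_right left_diff_distrib right_diff_distrib sum.distrib sum_subtractf
      sum_distrib_left ac_simps)

lemma pairing_sum: "pairing (sum c T) v = (\<Sum>i\<in>T. pairing (c i) v)"
  by (induction T rule: infinite_finite_induct) (simp_all add: pairing_simps)

lemma pairing_Ints: "(\<And>i. (v :: real ^ 'n) $ i \<in> \<int>) \<Longrightarrow> pairing c v \<in> \<int>"
  unfolding pairing_def by (intro Ints_sum Ints_mult) auto

lemma ext_pairing_linear:
  "ext_pairing m (w + w') = ext_pairing m w + ext_pairing m w'"
  "ext_pairing m (r *\<^sub>R w) = r * ext_pairing m w"
  by (simp_all add: ext_pairing_def pairing_simps distrib_left mult.left_commute)

lemma phi_eq: "phi m v = pairing (fst m) v + of_int (snd m)"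
  by (simp add: phi_def ext_pairing_def)

lemma phi_simps:
  "phi (m + m') v = phi m v + phi m' v" "phi (m - m') v = phi m v - phi m' v"
  "phi (mscale a m) v = of_int a * phi m v" "phi Rstar v = 1" "phi 0 v = 0"
  by (simp_all add: phi_eq pairing_simps mscale_def Rstar_def algebra_simps)

lemma phi_affine:
  assumes "t + u = 1"
  shows "phi m (t *\<^sub>R v + u *\<^sub>R w) = t * phi m v + u * phi m w"
proof -
  have "t * of_int (snd m) + u * of_int (snd m) = of_int (snd m)"
    using assms by (simp flip: distrib_right)
  then show ?thesis by (simp add: phi_eq pairing_simps distrib_left)
qed

lemma phi_combination: "phi (combination s k) v = (\<Sum>j\<in>UNIV. real (k j) * phi (s j) v)"
proof -
  have "phi (sum g T) v = (\<Sum>j\<in>T. phi (g j) v)" for g :: "'b \<Rightarrow> 'a ext_dual" and T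
    by (induction T rule: infinite_finite_induct) (simp_all add: phi_simps)
  then show ?thesis by (simp add: combination_def phi_simps)
qed

lemma fst_combination: "fst (combination s k) = (\<Sum>j\<in>UNIV. int (k j) *s fst (s j))"
  by (simp add: combination_def fst_sum mscale_def)

section \<open>The dual semigroup and heights\<close>

lemma dual_semigroup_iff: "m \<in> dual_semigroup P \<longleftrightarrow> (\<forall>v\<in>P. 0 \<le> phi m v)"
proof
  assume "m \<in> dual_semigroup P"
  then show "\<forall>v\<in>P. 0 \<le> phi m v"
    using hull_inc[of _ "P \<times> {1}" convex_cone] by (auto simp: dual_semigroup_def phi_def)
next
  assume *: "\<forall>v\<in>P. 0 \<le> phi m v"
  \<comment> \<open>A half-space through the origin is a convex cone, so it contains the whole cone
    as soon as it contains the generators.\<close>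
  let ?C = "{w. 0 \<le> ext_pairing m w}"
  have "convex_cone ?C"
    unfolding convex_cone_def
  proof (intro conjI)
    have "0 \<in> ?C" using ext_pairing_linear(2)[of m 0 0] by simp
    then show "?C \<noteq> {}" by blast
    show "convex ?C"
      by (rule convexI) (simp add: ext_pairing_linear)
    show "conic ?C"
      by (simp add: conic_def ext_pairing_linear)
  qed
  moreover have "P \<times> {1} \<subseteq> ?C" using * by (auto simp: phi_def)
  ultimately have "convex_cone hull (P \<times> {1}) \<subseteq> ?C" by (intro hull_minimal)
  then show "m \<in> dual_semigroup P" by (auto simp: dual_semigroup_def)
qed

text \<open>Subtracting \<open>Rstar\<close> lowers every value on \<open>P\<close> by 1, so
  membership after k subtractions is inherited by smaller k. Hence there is at most one exit point,
  and \<open>THE\<close> picks it.\<close>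

lemma height_eqI:
  assumes "s - mscale (int k) Rstar \<in> dual_semigroup P" "s - mscale (int k) Rstar - Rstar \<notin> dual_semigroup P"
  shows "height P s = k"
  unfolding height_def
proof (rule the_equality)
  have mono: "i \<le> j" if "s - mscale (int i) Rstar \<in> dual_semigroup P"
    "s - mscale (int j) Rstar - Rstar \<notin> dual_semigroup P" for i j
  proof (rule ccontr)
    assume "\<not> i \<le> j"
    then have "real j + 1 \<le> real i" by simp
    then have "s - mscale (int j) Rstar - Rstar \<in> dual_semigroup P"
      using that(1) by (fastforce simp: dual_semigroup_iff phi_simps)
    with that(2) show False ..
  qed
  show "s - mscale (int k) Rstar \<in> dual_semigroup P \<and> s - mscale (int k) Rstar - Rstar \<notin> dual_semigroup P"
    using assms ..
  fix j assume "s - mscale (int j) Rstar \<in> dual_semigroup P \<and> s - mscale (int j) Rstar - Rstar \<notin> dual_semigroup P"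
  then show "j = k" using mono assms by (intro antisym) blast+
qed

lemma height_boundary:
  assumes "P \<noteq> {}" "s \<in> dual_semigroup P"
  shows "boundary_part P s \<in> dual_semigroup P" "boundary_part P s - Rstar \<notin> dual_semigroup P"
proof -
  obtain v where v: "v \<in> P" using assms(1) by blast
  let ?below = "\<lambda>k::nat. s - mscale (int k) Rstar - Rstar \<notin> dual_semigroup P"
  obtain n :: nat where "phi s v < real n" using reals_Archimedean2 by blast
  then have "?below n" using v by (force simp: dual_semigroup_iff phi_simps)
  \<comment> \<open>One point \<open>v\<close> of \<open>P\<close> bounds the number of possible
    subtractions, so an exit occurs. At the least such \<open>k\<close> minimality gives membership,
    and for \<open>k = 0\<close> it is the membership of \<open>s\<close>.\<close>
  define k where "k = (LEAST k. ?below k)"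
  have below: "?below k" unfolding k_def using \<open>?below n\<close> by (rule LeastI)
  have "s - mscale (int k) Rstar \<in> dual_semigroup P"
  proof (cases k)
    case 0
    then show ?thesis using assms(2) by (simp add: mscale_simps)
  next
    case (Suc j)
    then have "\<not> ?below j" unfolding k_def using not_less_Least[of j ?below] by simp
    then show ?thesis by (simp add: Suc mscale_simps diff_diff_add add.commute)
  qed
  from height_eqI[OF this below] this below show
    "boundary_part P s \<in> dual_semigroup P" "boundary_part P s - Rstar \<notin> dual_semigroup P"
    unfolding boundary_part_def by (simp_all only: not_False_eq_True)
qed

lemma height_add:
  assumes "P \<noteq> {}" "s \<in> dual_semigroup P"
  shows "height P (s + mscale (int l) Rstar) = height P s + l"
    and "boundary_part P (s + mscale (int l) Rstar) = boundary_part P s"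
proof -
  have eq: "s + mscale (int l) Rstar - mscale (int (height P s + l)) Rstar = boundary_part P s"
    by (simp add: boundary_part_def mscale_simps algebra_simps)
  show h: "height P (s + mscale (int l) Rstar) = height P s + l"
    using height_boundary[OF assms] unfolding eq[symmetric] by (rule height_eqI)
  show "boundary_part P (s + mscale (int l) Rstar) = boundary_part P s"
    unfolding boundary_part_def[of P "s + mscale (int l) Rstar"] h eq ..
qed

lemma fst_boundary_part: "fst (boundary_part P s) = fst s"
  by (simp add: boundary_part_def mscale_def Rstar_def)

section \<open>The function \<open>eta\<close> and its defects\<close>

lemma eta_attained:
  fixes Q :: "(real ^ 'n) set"
  assumes "lattice_polytope Q"
  obtains q where "q \<in> Q" "eta Q c = - pairing c q" "\<And>v. v \<in> Q \<Longrightarrow> pairing c q \<le> pairing c v"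
    "pairing c q \<in> \<int>"
proof -
  obtain V :: "(real ^ 'n) set" where V: "finite V" "V \<noteq> {}" "\<And>v i. v \<in> V \<Longrightarrow> v $ i \<in> \<int>" "Q = convex hull V"
    using assms unfolding lattice_polytope_def by blast
  \<comment> \<open>The minimum is sought among the finitely many lattice points of
    \<open>V\<close>, where the pairing is an integer; convexity of the half-space spreads the
    inequality to the hull. The integrality of \<open>eta\<close> rests on this choice.\<close>
  obtain q where q: "q \<in> V" "\<And>v. v \<in> V \<Longrightarrow> pairing c q \<le> pairing c v"
    using V(1,2) ex_min_if_finite[of "pairing c ` V"] by (metis (no_types, lifting) arg_min_if_finite not_le)
  have "convex {v. pairing c q \<le> pairing c v}"
  proof (rule convexI)
    fix x y and u v :: real
    assume xy: "x \<in> {v. pairing c q \<le> pairing c v}" "y \<in> {v. pairing c q \<le> pairing c v}"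
      and uv: "0 \<le> u" "0 \<le> v" "u + v = 1"
    have "pairing c q = u * pairing c q + v * pairing c q"
      using uv(3) by (metis distrib_right mult_1)
    also have "\<dots> \<le> u * pairing c x + v * pairing c y"
      using xy uv by (intro add_mono mult_left_mono) auto
    finally show "u *\<^sub>R x + v *\<^sub>R y \<in> {v. pairing c q \<le> pairing c v}"
      by (simp add: pairing_simps)
  qed
  then have "Q \<subseteq> {v. pairing c q \<le> pairing c v}"
    unfolding V(4) using q(2) by (intro hull_minimal) auto
  then have le: "pairing c q \<le> pairing c v" if "v \<in> Q" for v using that by blast
  have qQ: "q \<in> Q" unfolding V(4) using q(1) by (rule hull_inc)
  have "(INF v\<in>Q. pairing c v) = pairing c q"
    using qQ le by (intro cInf_eq_minimum) auto
  then show ?thesis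
    using that[of q] qQ le pairing_Ints[of q c] V(3)[OF q(1)] by (simp add: eta_def)
qed

lemma eta_ge: "lattice_polytope Q \<Longrightarrow> v \<in> Q \<Longrightarrow> - pairing c v \<le> eta Q c"
  by (metis eta_attained neg_le_iff_le)

lemma eta_Ints: "lattice_polytope Q \<Longrightarrow> eta Q c \<in> \<int>"
  by (metis eta_attained Ints_minus)

lemma eta_scale:
  assumes "lattice_polytope Q"
  shows "eta Q (int k *s c) = real k * eta Q c"
proof (rule antisym)
  obtain q where q: "q \<in> Q" "eta Q (int k *s c) = - pairing (int k *s c) q" using eta_attained[OF assms] by metis
  have "real k * - pairing c q \<le> real k * eta Q c"
    using eta_ge[OF assms q(1), of c] by (rule mult_left_mono) simp
  then show "eta Q (int k *s c) \<le> real k * eta Q c" using q(2) by (simp add: pairing_simps)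
next
  obtain q where "q \<in> Q" "eta Q c = - pairing c q" using eta_attained[OF assms] by metis
  then show "real k * eta Q c \<le> eta Q (int k *s c)"
    using eta_ge[OF assms, of q "int k *s c"] by (simp add: pairing_simps)
qed

lemma eta_cong: "(\<And>v. v \<in> Q \<Longrightarrow> pairing c v = pairing c' v) \<Longrightarrow> eta Q c = eta Q c'"
  unfolding eta_def by (simp cong: INF_cong_simp)

text \<open>At a minimiser \<open>q\<close> of the sum, each summand obeys its own bound
  \<open>eta_ge\<close>. This subadditivity is the nonnegativity of defects.\<close>

lemma eta_sum_le:
  assumes "lattice_polytope Q"
  shows "eta Q (sum c T) \<le> (\<Sum>i\<in>T. eta Q (c i))"
proof -
  obtain q where q: "q \<in> Q" "eta Q (sum c T) = - pairing (sum c T) q" using eta_attained[OF assms] by metis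
  then show ?thesis
    using eta_ge[OF assms q(1)] by (simp add: pairing_sum sum_mono flip: sum_negf)
qed

text \<open>Integrality and subadditivity make the floor and \<open>nat\<close> harmless, and
  homogeneity pulls out the multiplicities. From here on, defects are computed as real expressions
  linear in values of \<open>eta\<close>.\<close>

lemma eta_defect_eq:
  assumes "lattice_polytope Q"
  shows "real (eta_defect Q s k) = (\<Sum>j\<in>UNIV. real (k j) * eta Q (fst (s j))) - eta Q (fst (combination s k))"
    (is "_ = ?x")
proof -
  have x: "(\<Sum>j\<in>UNIV. eta Q (int (k j) *s fst (s j))) - eta Q (\<Sum>j\<in>UNIV. int (k j) *s fst (s j)) = ?x"
    by (simp add: eta_scale[OF assms] fst_combination)
  have "?x \<in> \<int>"
    unfolding x[symmetric] by (intro Ints_diff Ints_sum eta_Ints[OF assms])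
  moreover have "0 \<le> ?x"
    unfolding x[symmetric] using eta_sum_le[OF assms, of "\<lambda>j. int (k j) *s fst (s j)" UNIV] by simp
  ultimately show ?thesis
    unfolding eta_defect_def x by (auto elim: Ints_cases)
qed

text \<open>Write \<open>v = i q + r\<close>. Since \<open>i q' + r\<close> lies in \<open>P\<close> for every \<open>q'\<close> in \<open>Q\<close>, each \<open>s\<^sub>j\<close> can be
  tested at its own minimiser \<open>q'\<close> on \<open>Q\<close>.\<close>

lemma deformation_pair_bound:
  assumes def: "deformation_pair P m Q" and s: "\<And>j. s j \<in> dual_semigroup P"
    and v: "v \<in> P" "phi m v = real i"
  shows "real i * real (eta_defect Q s k) \<le> phi (combination s k) v"
proof -
  have Q: "lattice_polytope Q" using def by (simp add: deformation_pair_def)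
  have "P \<inter> {v. phi m v = real i} \<noteq> {}" using v by blast
  then obtain R where R: "P \<inter> {v. phi m v = real i} = (\<lambda>v. real i *\<^sub>R v) ` Q + R"
    using def unfolding deformation_pair_def by blast
  have "v \<in> (\<lambda>v. real i *\<^sub>R v) ` Q + R" using v unfolding R[symmetric] by blast
  then obtain q r where q: "q \<in> Q" and r: "r \<in> R" and vqr: "v = real i *\<^sub>R q + r"
    by (auto elim: set_plus_elim)
  have bound: "real i * (pairing (fst (s j)) q + eta Q (fst (s j))) \<le> phi (s j) v" for j
  proof -
    obtain q' where q': "q' \<in> Q" "eta Q (fst (s j)) = - pairing (fst (s j)) q'"
      using eta_attained[OF Q] by metis
    have "real i *\<^sub>R q' + r \<in> (\<lambda>v. real i *\<^sub>R v) ` Q + R"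
      using q'(1) r by (intro set_plus_intro) auto
    then have "real i *\<^sub>R q' + r \<in> P" unfolding R[symmetric] by blast
    then have "0 \<le> phi (s j) (real i *\<^sub>R q' + r)" using s[of j] by (simp add: dual_semigroup_iff)
    then show ?thesis
      by (simp add: vqr q'(2) phi_eq pairing_simps algebra_simps)
  qed
  have "real i * real (eta_defect Q s k) \<le>
      real i * (\<Sum>j\<in>UNIV. real (k j) * (pairing (fst (s j)) q + eta Q (fst (s j))))"
  proof (rule mult_left_mono)
    \<comment> \<open>The point \<open>q\<close> comes from the decomposition of \<open>v\<close>
      and need not minimise anything; the inequality at \<open>q\<close> for the subtracted term
      still bounds the defect by the weighted gaps of the single generators.\<close>
    have "- pairing (fst (combination s k)) q \<le> eta Q (fst (combination s k))" by (rule eta_ge[OF Q q])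
    then show "real (eta_defect Q s k) \<le> (\<Sum>j\<in>UNIV. real (k j) * (pairing (fst (s j)) q + eta Q (fst (s j))))"
      unfolding eta_defect_eq[OF Q] by (simp add: fst_combination pairing_sum pairing_simps distrib_left sum.distrib)
  qed simp
  also have "\<dots> = (\<Sum>j\<in>UNIV. real (k j) * (real i * (pairing (fst (s j)) q + eta Q (fst (s j)))))"
    by (simp add: sum_distrib_left mult.left_commute)
  also have "\<dots> \<le> phi (combination s k) v"
    unfolding phi_combination using bound by (intro sum_mono mult_left_mono) auto
  finally show ?thesis .
qed

text \<open>Deformation pairs speak only of slices at natural heights. At a height that is not
  positive the subtraction cannot hurt; a positive integral height is natural, and there the slice
  bound covers even the extreme case \<open>a = eta_defect Q s k\<close>.\<close>

lemma deformation_pair_shift_le: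
  assumes def: "deformation_pair P m Q" and s: "\<And>j. s j \<in> dual_semigroup P"
    and v: "v \<in> P" "phi m v \<in> \<int>" and a: "a \<le> eta_defect Q s k"
  shows "real a * phi m v \<le> phi (combination s k) v"
proof (cases "phi m v \<le> 0")
  case True
  have "0 \<le> phi (combination s k) v"
    unfolding phi_combination using s v(1) by (intro sum_nonneg mult_nonneg_nonneg) (auto simp: dual_semigroup_iff)
  then show ?thesis using True mult_nonneg_nonpos[of "real a" "phi m v"] by simp
next
  case False
  obtain z where z: "phi m v = of_int z" using v(2) by (rule Ints_cases)
  with False have i: "phi m v = real (nat z)" by simp
  have "real a * phi m v \<le> real (nat z) * real (eta_defect Q s k)"
    unfolding i mult.commute[of "real a"] using a by (intro mult_left_mono) simp_all
  also have "\<dots> \<le> phi (combination s k) v" by (rule deformation_pair_bound[OF def s v(1) i])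
  finally show ?thesis .
qed

text \<open>Nonnegativity of an affine function is tested at the vertices of \<open>P\<close>. These
  are lattice points, so both heights there are integers, and one of them is zero: the two shifts
  act like a single one, and the bound for one deformation pair applies. Elsewhere in
  \<open>P\<close> both heights may be nonzero, which is why the argument passes through the convex
  hull.\<close>

lemma shift_mem_dual_semigroup:
  fixes P :: "(real ^ 'n) set"
  assumes P: "lattice_polytope P" and def: "deformation_pair P m1 Q1" "deformation_pair P m2 Q2"
    and ext: "\<And>v. v extreme_point_of P \<Longrightarrow> phi m1 v * phi m2 v = 0"
    and s: "\<And>j. s j \<in> dual_semigroup P"
    and a: "a1 \<le> eta_defect Q1 s k" "a2 \<le> eta_defect Q2 s k"
  shows "combination s k - mscale (int a1) m1 - mscale (int a2) m2 \<in> dual_semigroup P"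
    (is "?x \<in> _")
proof -
  obtain V :: "(real ^ 'n) set" where V: "finite V" "\<And>v i. v \<in> V \<Longrightarrow> v $ i \<in> \<int>" "P = convex hull V"
    using P unfolding lattice_polytope_def by blast
  have "0 \<le> phi ?x v" if v: "v extreme_point_of P" for v
  proof -
    have vP: "v \<in> P" using v by (simp add: extreme_point_of_def)
    have "v \<in> V" using v unfolding V(3) by (rule extreme_point_of_convex_hull)
    then have int: "phi m v \<in> \<int>" for m
      unfolding phi_eq using V(2) by (intro Ints_add pairing_Ints) auto
    from ext[OF v] consider "phi m1 v = 0" | "phi m2 v = 0" by auto
    then show ?thesis
    proof cases
      case 1
      then show ?thesis using deformation_pair_shift_le[OF def(2) s vP int a(2)] by (simp add: phi_simps)
    next
      case 2
      then show ?thesis using deformation_pair_shift_le[OF def(1) s vP int a(1)] by (simp add: phi_simps)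
    qed
  qed
  moreover have "convex {v. 0 \<le> phi ?x v}"
  proof (rule convexI)
    fix v w and t u :: real
    assume vw: "v \<in> {v. 0 \<le> phi ?x v}" "w \<in> {v. 0 \<le> phi ?x v}" and tu: "0 \<le> t" "0 \<le> u" "t + u = 1"
    show "t *\<^sub>R v + u *\<^sub>R w \<in> {v. 0 \<le> phi ?x v}"
      unfolding mem_Collect_eq phi_affine[OF tu(3)]
      using vw tu(1,2) by (intro add_nonneg_nonneg mult_nonneg_nonneg) simp_all
  qed
  ultimately have "convex hull {v. v extreme_point_of P} \<subseteq> {v. 0 \<le> phi ?x v}"
    by (intro hull_minimal) auto
  moreover have "P = convex hull {v. v extreme_point_of P}"
    unfolding V(3) using V(1) by (intro Krein_Milman_Minkowski finite_imp_compact_convex_hull convex_convex_hull)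
  ultimately show ?thesis by (auto simp: dual_semigroup_iff)
qed

text \<open>Only values on \<open>Q\<close> enter \<open>eta\<close>, and the linear parts of
  \<open>m1\<close> and \<open>m2\<close> vanish there, so \<open>b\<close> may be exchanged for s_k
  inside \<open>eta\<close>. Zero defect of \<open>d b\<close> says that the weighted values of
  \<open>eta\<close> on its generators add up to \<open>eta\<close> of \<open>b\<close>. Only the
  first component of \<open>b\<close> is prescribed, since passing to a boundary part changes the
  second.\<close>

lemma eta_defect_shift:
  assumes Q: "lattice_polytope Q" "Q \<subseteq> kernel_of m1 \<inter> kernel_of m2"
    and rep: "combination s (d b) = b" "eta_defect Q s (d b) = 0"
    and b: "fst b = fst (combination s k - mscale (int a1) m1 - mscale (int a2) m2)"
  shows "eta_defect Q s k + eta_defect Q s (\<lambda>j. k' j + d b j) = eta_defect Q s (\<lambda>j. k' j + k j)"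
proof -
  have ker: "pairing (fst m1) v = 0" "pairing (fst m2) v = 0" if "v \<in> Q" for v
    using that Q(2) by (auto simp: kernel_of_def)
  have "eta Q (c + fst b) = eta Q (c + fst (combination s k))" for c
    unfolding b by (rule eta_cong) (simp add: pairing_simps mscale_def ker)
  \<comment> \<open>The choice 0 compares b with s_k, the other one compares s_k' + b with s_k' +
    s_k; these are the two values of \<open>eta\<close> in which the sides differ.\<close>
  from this[of 0] this[of "fst (combination s k')"]
  have "real (eta_defect Q s k + eta_defect Q s (\<lambda>j. k' j + d b j)) = real (eta_defect Q s (\<lambda>j. k' j + k j))"
    using eta_defect_eq[OF Q(1), of s "d b"]
    by (simp add: eta_defect_eq[OF Q(1)] rep combination_add distrib_right sum.distrib)
  then show ?thesis by (simp only: of_nat_eq_iff)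
qed

theorem corollary3p7:
  fixes P Q1 Q2 :: "(real ^ 'n) set"
    and m1 m2 :: "'n ext_dual"
    and s :: "'r::finite \<Rightarrow> 'n ext_dual"
    and d :: "'n ext_dual \<Rightarrow> 'r \<Rightarrow> nat"
  assumes "lattice_polytope P" and "aff_dim P = int CARD('n)"
    and "deformation_pair P m1 Q1" and "deformation_pair P m2 Q2"
    and "Q1 \<subseteq> kernel_of m1 \<inter> kernel_of m2" and "Q2 \<subseteq> kernel_of m1 \<inter> kernel_of m2"
    and "\<And>v. v extreme_point_of P \<Longrightarrow> phi m1 v * phi m2 v = 0"
    and "boundary_generators P s"
    and "boundary_representatives P s d"
    and "adapted P s d Q1" and "adapted P s d Q2"
  shows "formal_deformation TYPE('t) ring_of_type_algebra residue2
           (semigroup_algebra (dual_semigroup P)) toric_const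
           (two_param_family P s d m1 Q1 m2 Q2)
       \<and> (\<forall>k. Poly_Mapping.map set_t2_zero (two_param_equation P s d m1 Q1 m2 Q2 k)
              = one_param_equation P s d m1 Q1 k)
       \<and> restricts_to ring_of_type_algebra residue2 ring_of_type_algebra residue1 set_t2_zero
           (two_param_family P s d m1 Q1 m2 Q2) (one_param_family P s d m1 Q1)
       \<and> (\<forall>k. Poly_Mapping.map set_t1_zero (two_param_equation P s d m1 Q1 m2 Q2 k)
              = one_param_equation P s d m2 Q2 k)
       \<and> restricts_to ring_of_type_algebra residue2 ring_of_type_algebra residue1 set_t1_zero
           (two_param_family P s d m1 Q1 m2 Q2) (one_param_family P s d m2 Q2)"
proof -
  have P: "P \<noteq> {}"
    using assms(1) by (auto simp: lattice_polytope_def)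
  have Q: "lattice_polytope Q1" "lattice_polytope Q2"
    using assms(3,4) by (simp_all add: deformation_pair_def)
  have boundary: "boundary_part P b \<in> boundary_elements P" if "b \<in> dual_semigroup P" for b
    using that by (simp add: boundary_elements_def)
  have rep: "combination s (d (boundary_part P b)) = boundary_part P b" if "b \<in> dual_semigroup P" for b
    using assms(9) boundary[OF that] by (simp add: boundary_representatives_def)
  have s: "s j \<in> dual_semigroup P" for j
  proof -
    have "s j \<in> boundary_elements P" using assms(8) unfolding boundary_generators_def by blast
    then obtain b where "b \<in> dual_semigroup P" "s j = boundary_part P b"
      unfolding boundary_elements_def by (rule imageE)
    then show ?thesis using height_boundary(1)[OF P] by simp
  qed
  have shift: "combination s k - mscale (int a1) m1 - mscale (int a2) m2 \<in> dual_semigroup P"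
    if "a1 \<le> eta_defect Q1 s k" "a2 \<le> eta_defect Q2 s k" for a1 a2 k
    by (rule shift_mem_dual_semigroup[OF assms(1,3,4,7) s that])
  \<comment> \<open>The vertex condition enters through \<open>shift\<close>; the kernel conditions
    and the adapted representatives enter through \<open>eta_defect_shift\<close>.\<close>
  interpret twisted_toric P Q1 Q2 m1 m2 s d
  proof
    show "combination s (d (boundary_part P b)) + mscale (int (height P b)) Rstar = b"
      if "b \<in> dual_semigroup P" for b
      using rep[OF that] by (simp add: boundary_part_def)
    show "height P (b + mscale (int l) Rstar) = height P b + l"
      "boundary_part P (b + mscale (int l) Rstar) = boundary_part P b"
      if "b \<in> dual_semigroup P" for b l
      by (rule height_add[OF P that])+
    show "combination s k - mscale (int a1) m1 - mscale (int a2) m2 \<in> dual_semigroup P"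
      if "a1 \<le> eta_defect Q1 s k" "a2 \<le> eta_defect Q2 s k" for a1 a2 k
      by (rule shift[OF that])
    show "eta_defect Q s k + eta_defect Q s (\<lambda>j. k' j +
          d (boundary_part P (combination s k - mscale (int a1) m1 - mscale (int a2) m2)) j) =
        eta_defect Q s (\<lambda>j. k' j + k j)"
      if a: "a1 \<le> eta_defect Q1 s k" "a2 \<le> eta_defect Q2 s k" and "Q \<in> {Q1, Q2}" for a1 a2 k k' Q
    proof (rule eta_defect_shift)
      show "lattice_polytope Q" "Q \<subseteq> kernel_of m1 \<inter> kernel_of m2"
        using that(3) Q assms(5,6) by auto
      show "eta_defect Q s (d (boundary_part P (combination s k - mscale (int a1) m1 - mscale (int a2) m2))) = 0"
        using that(3) assms(10,11) boundary[OF shift[OF a]] by (auto simp: adapted_def)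
    qed (rule rep[OF shift[OF a]] fst_boundary_part)+
    show "dual_semigroup P = {combination s k + mscale (int l) Rstar | k l. True}"
      using assms(8) by (simp add: boundary_generators_def)
  qed
  show ?thesis
    unfolding one_param_family_def
    by (intro conjI allI formal_deformation_family set_t2_zero_equation set_t1_zero_equation
        restricts_to_axis set_t2_zero_ring_map set_t1_zero_ring_map surj_set_t2_zero surj_set_t1_zero)
      (simp_all add: residue1_def residue2_def set_t2_zero_def set_t1_zero_def)
qed

end
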